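(* Let $G$ be a finitely generated abelian group and fix a tempered Følner sequence $(F_n)$ in $G$. There is no infinite compact metric space $X$ with a continuous action of $G$ and a $G$-invariant Borel probability measure $\mu$ on $X$ such that $(X,G,\mu)$ is minimal, uniquely ergodic, mixing of all orders, has minimal self-joinings of all orders, and has no weakly asymptotic pairs.
   Context: Let $d_X$ be the metric on $X$; $G$ is discrete. Write $g^{\times N}(x_1,\dots,x_N)=(gx_1,\dots,gx_N)$. **Minimal / uniquely ergodic:** every orbit is dense / there is exactly one $G$-invariant Borel probability measure on $X$. **Mixing of all orders:** for every $N\ge1$ and Borel $A_0,\dots,A_N\subset X$, $\mu(g_0A_0\cap\dots\cap g_NA_N)\to\mu(A_0)\cdots\mu(A_N)$ as $g_i^{-1}g_j\to\infty$ for all $i\neq j$. **Joinings.** An $N$-fold self-joining is a $\{g^{\times N}\}_{g\in G}$-invariant Borel probability measure on $X^{\times N}$ with all one-coordinate marginals equal to $\mu$. Let ${}^N\Delta(A_1\times\dots\times A_N)=\mu(A_1\cap\dots\cap A_N)$, and for $\mathbf{g}=(g_1,\dots,g_N)\in G^N$ let ${}^N\Delta^{\mathbf g}=(g_1\times\dots\times g_N)_*{}^N\Delta$ (an off-diagonal joining, $G$ being abelian). A self-joining is trivial if, possibly after permuting coordinates, it is a direct product of off-diagonal joinings (including the one-fold joining $\mu$). The system has minimal self-joinings of all orders if for every $N\ge2$ every $N$-fold self-joining that is ergodic for $(X^{\times N},\{g^{\times N}\}_{g\in G})$ is trivial. **Weakly asymptotic pair.** For $D\subset G$ let $\bar d(D)=\limsup_n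 |F_n\cap D|/|F_n|$. Points $x\ne y$ of $X$ form a weakly asymptotic pair if there is $D\subset G$ with $\bar d(D)>0$ such that $d_X(gx,gy)\to0$ as $g\to\infty$ along $D$. *)

theory Defs
  imports "HOL-Probability.Probability" "HOL-Computational_Algebra.Group_Closure"
begin

text \<open>
  The abelian group is the (discrete) type \<open>'g :: ab_group_add\<close>, written additively, so
  \<open>g\<^sup>-\<^sup>1 h\<close> becomes \<open>h - g\<close>. Its compact metric phase space is the whole type
  \<open>'x :: metric_space\<close>, and an action is a curried function \<open>T :: 'g \<Rightarrow> 'x \<Rightarrow> 'x\<close>.
  ``To infinity in the group'' means leaving every finite subset, i.e. the filter \<open>cofinite\<close>.
\<close>

subsection \<open>The group\<close>

definition finitely_generated :: "'g::ab_group_add itself \<Rightarrow> bool" where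
  "finitely_generated _ \<longleftrightarrow> (\<exists>S::'g set. finite S \<and> group_closure S = UNIV)"

definition folner_sequence :: "(nat \<Rightarrow> 'g::ab_group_add set) \<Rightarrow> bool" where
  "folner_sequence F \<longleftrightarrow>
     (\<forall>n. finite (F n) \<and> F n \<noteq> {}) \<and>
     (\<forall>g. (\<lambda>n. real (card (sym_diff ((+) g ` F n) (F n))) / real (card (F n)))
            \<longlonglongrightarrow> 0)"

text \<open>Temperedness: \<open>|\<Union>\<^sub>k\<^sub><\<^sub>n F\<^sub>k\<^sup>-\<^sup>1 F\<^sub>n| \<le> C |F\<^sub>n|\<close> for some constant \<open>C\<close> and all \<open>n\<close>.\<close>

definition tempered_folner_sequence :: "(nat \<Rightarrow> 'g::ab_group_add set) \<Rightarrow> bool" where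
  "tempered_folner_sequence F \<longleftrightarrow>
     folner_sequence F \<and>
     (\<exists>C::real. \<forall>n. real (card (\<Union>k<n. {b - a |a b. a \<in> F k \<and> b \<in> F n}))
                      \<le> C * real (card (F n)))"

definition upper_density :: "(nat \<Rightarrow> 'g set) \<Rightarrow> 'g set \<Rightarrow> ereal" where
  "upper_density F D = limsup (\<lambda>n. ereal (real (card (F n \<inter> D)) / real (card (F n))))"

subsection \<open>Topological and measure-preserving actions\<close>

definition continuous_action :: "('g::ab_group_add \<Rightarrow> 'x::topological_space \<Rightarrow> 'x) \<Rightarrow> bool" where
  "continuous_action T \<longleftrightarrow>
     (\<forall>x. T 0 x = x) \<and> (\<forall>g h x. T (g + h) x = T g (T h x)) \<and> (\<forall>g. continuous_on UNIV (T g))"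

definition minimal_action :: "('g \<Rightarrow> 'x::topological_space \<Rightarrow> 'x) \<Rightarrow> bool" where
  "minimal_action T \<longleftrightarrow> (\<forall>x. closure (range (\<lambda>g. T g x)) = UNIV)"

definition invariant_prob :: "('g \<Rightarrow> 'a \<Rightarrow> 'a) \<Rightarrow> 'a measure \<Rightarrow> bool" where
  "invariant_prob T M \<longleftrightarrow> prob_space M \<and> (\<forall>g. T g \<in> measurable M M \<and> distr M M (T g) = M)"

definition ergodic :: "('g \<Rightarrow> 'a \<Rightarrow> 'a) \<Rightarrow> 'a measure \<Rightarrow> bool" where
  "ergodic T M \<longleftrightarrow> invariant_prob T M \<and>
     (\<forall>A\<in>sets M. (\<forall>g. T g -` A \<inter> space M = A) \<longrightarrow> emeasure M A = 0 \<or> emeasure M A = 1)"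

definition uniquely_ergodic :: "('g \<Rightarrow> 'x::topological_space \<Rightarrow> 'x) \<Rightarrow> bool" where
  "uniquely_ergodic T \<longleftrightarrow> (\<exists>!M::'x measure. sets M = sets borel \<and> invariant_prob T M)"

subsection \<open>Mixing of all orders\<close>

text \<open>The filter along which \<open>g\<^sub>j - g\<^sub>i\<close> tends to infinity for all distinct \<open>i, j \<le> N\<close>.\<close>

definition differences_to_infinity :: "nat \<Rightarrow> (nat \<Rightarrow> 'g::ab_group_add) filter" where
  "differences_to_infinity N =
     (INF (i, j)\<in>{(i, j). i \<le> N \<and> j \<le> N \<and> i \<noteq> j}. filtercomap (\<lambda>g. g j - g i) cofinite)"

lemma eventually_differences_to_infinity:
  "eventually P (differences_to_infinity N :: (nat \<Rightarrow> 'g::ab_group_add) filter) \<longleftrightarrow>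
     (\<exists>K. finite K \<and> (\<forall>g. (\<forall>i\<le>N. \<forall>j\<le>N. i \<noteq> j \<longrightarrow> g j - g i \<notin> K) \<longrightarrow> P g))"
proof -
  define B where "B = {(i, j). i \<le> N \<and> j \<le> N \<and> i \<noteq> j}"
  define E :: "nat \<times> nat \<Rightarrow> (nat \<Rightarrow> 'g) filter"
    where "E = (\<lambda>p. filtercomap (\<lambda>g. g (snd p) - g (fst p)) cofinite)"
  have fin: "finite B"
    by (rule finite_subset[of _ "{..N} \<times> {..N}"]) (auto simp: B_def)
  have E: "eventually Q (E p) \<longleftrightarrow>
      (\<exists>K. finite K \<and> (\<forall>g. g (snd p) - g (fst p) \<notin> K \<longrightarrow> Q g))" for Q p
  proof
    assume "eventually Q (E p)"
    then obtain R where "eventually R cofinite" "\<forall>g. R (g (snd p) - g (fst p)) \<longrightarrow> Q g"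
      unfolding E_def eventually_filtercomap by blast
    then show "\<exists>K. finite K \<and> (\<forall>g. g (snd p) - g (fst p) \<notin> K \<longrightarrow> Q g)"
      by (intro exI[of _ "{x. \<not> R x}"]) (simp add: eventually_cofinite)
  next
    assume "\<exists>K. finite K \<and> (\<forall>g. g (snd p) - g (fst p) \<notin> K \<longrightarrow> Q g)"
    then obtain K where K: "finite K" "\<forall>g. g (snd p) - g (fst p) \<notin> K \<longrightarrow> Q g"
      by blast
    then show "eventually Q (E p)"
      unfolding E_def eventually_filtercomap
      by (intro exI[of _ "\<lambda>x. x \<notin> K"]) (simp add: eventually_cofinite)
  qed
  have D: "differences_to_infinity N = (INF p\<in>B. E p)"
    unfolding differences_to_infinity_def B_def E_def by (simp add: case_prod_beta)
  have "eventually P (INF p\<in>B. E p) \<longleftrightarrow>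
      (\<exists>K. finite K \<and> (\<forall>g. (\<forall>p\<in>B. g (snd p) - g (fst p) \<notin> K) \<longrightarrow> P g))"
  proof
    assume "eventually P (INF p\<in>B. E p)"
    then obtain Q where Q: "\<forall>p\<in>B. eventually (Q p) (E p)"
      and P: "\<forall>g. (\<forall>p\<in>B. Q p g) \<longrightarrow> P g"
      unfolding eventually_INF_finite[OF fin] by blast
    from Q[unfolded E] obtain K
      where K: "\<forall>p\<in>B. finite (K p) \<and> (\<forall>g. g (snd p) - g (fst p) \<notin> K p \<longrightarrow> Q p g)"
      by (rule bchoice[THEN exE])
    show "\<exists>K. finite K \<and> (\<forall>g. (\<forall>p\<in>B. g (snd p) - g (fst p) \<notin> K) \<longrightarrow> P g)"
    proof (intro exI[of _ "\<Union>p\<in>B. K p"] conjI allI impI)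
      show "finite (\<Union>p\<in>B. K p)"
        using K fin by simp
    next
      fix g assume g: "\<forall>p\<in>B. g (snd p) - g (fst p) \<notin> (\<Union>p\<in>B. K p)"
      have "Q p g" if p: "p \<in> B" for p
      proof -
        have "g (snd p) - g (fst p) \<notin> K p"
          using g p by blast
        then show ?thesis
          using K p by simp
      qed
      then show "P g"
        using P by simp
    qed
  next
    assume "\<exists>K. finite K \<and> (\<forall>g. (\<forall>p\<in>B. g (snd p) - g (fst p) \<notin> K) \<longrightarrow> P g)"
    then obtain K where K: "finite K"
      and P: "\<forall>g. (\<forall>p\<in>B. g (snd p) - g (fst p) \<notin> K) \<longrightarrow> P g"
      by blast
    have "eventually (\<lambda>g. g (snd p) - g (fst p) \<notin> K) (E p)" for p
      unfolding E using K by (intro exI[of _ K]) simp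
    then show "eventually P (INF p\<in>B. E p)"
      unfolding eventually_INF_finite[OF fin]
      by (intro exI[of _ "\<lambda>p g. g (snd p) - g (fst p) \<notin> K"]) (simp add: P)
  qed
  moreover have "(\<forall>p\<in>B. g (snd p) - g (fst p) \<notin> K) \<longleftrightarrow>
      (\<forall>i\<le>N. \<forall>j\<le>N. i \<noteq> j \<longrightarrow> g j - g i \<notin> K)" for g :: "nat \<Rightarrow> 'g" and K
    unfolding B_def by (simp add: split_paired_all) metis
  ultimately show ?thesis
    unfolding D by simp
qed

definition mixing_of_all_orders ::
    "('g::ab_group_add \<Rightarrow> 'x::topological_space \<Rightarrow> 'x) \<Rightarrow> 'x measure \<Rightarrow> bool" where
  "mixing_of_all_orders T \<mu> \<longleftrightarrow>
     (\<forall>N\<ge>1. \<forall>A::nat \<Rightarrow> 'x set. (\<forall>i\<le>N. A i \<in> sets borel) \<longrightarrow>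
        ((\<lambda>g. measure \<mu> (\<Inter>i\<le>N. T (g i) ` A i)) \<longlongrightarrow> (\<Prod>i\<le>N. measure \<mu> (A i)))
          (differences_to_infinity N))"

subsection \<open>Joinings\<close>

text \<open>
  The power \<open>X\<^sup>I\<close> consists of the functions in \<open>extensional I\<close>, with the product
  \<open>\<sigma>\<close>-algebra. For a compact (hence second countable) metric space and finite \<open>I\<close> this is
  the Borel \<open>\<sigma>\<close>-algebra of \<open>X\<^sup>I\<close>. The \<open>N\<close>-fold power uses \<open>I = {..<N}\<close>.
\<close>

abbreviation borel_power :: "nat set \<Rightarrow> (nat \<Rightarrow> 'x::topological_space) measure" where
  "borel_power I \<equiv> PiM I (\<lambda>_. borel)"

definition diagonal_action :: "('g \<Rightarrow> 'x \<Rightarrow> 'x) \<Rightarrow> nat set \<Rightarrow> 'g \<Rightarrow> (nat \<Rightarrow> 'x) \<Rightarrow> (nat \<Rightarrow> 'x)" where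
  "diagonal_action T I g x = (\<lambda>i\<in>I. T g (x i))"

definition self_joining ::
    "('g \<Rightarrow> 'x::topological_space \<Rightarrow> 'x) \<Rightarrow> 'x measure \<Rightarrow> nat \<Rightarrow> (nat \<Rightarrow> 'x) measure \<Rightarrow> bool" where
  "self_joining T \<mu> N \<nu> \<longleftrightarrow>
     sets \<nu> = sets (borel_power {..<N}) \<and>
     invariant_prob (diagonal_action T {..<N}) \<nu> \<and>
     (\<forall>i<N. distr \<nu> borel (\<lambda>x. x i) = \<mu>)"

definition diagonal_measure :: "'x::topological_space measure \<Rightarrow> nat set \<Rightarrow> (nat \<Rightarrow> 'x) measure" where
  "diagonal_measure \<mu> I = distr \<mu> (borel_power I) (\<lambda>x. \<lambda>i\<in>I. x)"

lemma emeasure_diagonal_measure: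
  assumes \<mu>: "sets \<mu> = sets borel" and I: "finite I" and A: "\<And>i. i \<in> I \<Longrightarrow> A i \<in> sets borel"
  shows "emeasure (diagonal_measure \<mu> I) (PiE I A) = emeasure \<mu> (\<Inter>i\<in>I. A i)"
proof -
  have 1: "(\<lambda>x. \<lambda>i\<in>I. x) \<in> measurable \<mu> (borel_power I)"
    by (intro measurable_restrict) (simp add: measurable_ident_sets[OF \<mu>])
  have 2: "PiE I A \<in> sets (borel_power I)"
    by (intro sets_PiM_I_finite I A)
  have 3: "(\<lambda>x. \<lambda>i\<in>I. x) -` PiE I A \<inter> space \<mu> = (\<Inter>i\<in>I. A i)"
    using sets_eq_imp_space_eq[OF \<mu>] by (auto simp: PiE_iff)
  show ?thesis
    unfolding diagonal_measure_def by (simp only: emeasure_distr[OF 1 2] 3)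
qed

text \<open>For \<open>I = {i}\<close> and \<open>\<mu>\<close> invariant, this is the one-fold joining \<open>\<mu>\<close>.\<close>

definition off_diagonal_measure ::
    "('g \<Rightarrow> 'x::topological_space \<Rightarrow> 'x) \<Rightarrow> 'x measure \<Rightarrow> nat set \<Rightarrow> (nat \<Rightarrow> 'g) \<Rightarrow> (nat \<Rightarrow> 'x) measure"
where
  "off_diagonal_measure T \<mu> I g =
     distr (diagonal_measure \<mu> I) (borel_power I) (\<lambda>x. \<lambda>i\<in>I. T (g i) (x i))"

text \<open>
  A direct product, up to a permutation of the coordinates, is encoded by a labelling \<open>b\<close> of the
  coordinates by the \<open>k\<close> factors: factor \<open>j\<close> is an off-diagonal joining on the coordinates
  labelled \<open>j\<close>, and \<open>\<omega> \<mapsto> (\<omega>\<^bsub>b i\<^esub> i)\<^sub>i\<close> identifies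
  \<open>\<Prod>\<^sub>j X\<^bsup>{i. b i = j}\<^esup>\<close> with \<open>X\<^sup>N\<close>.
\<close>

definition trivial_joining ::
    "('g \<Rightarrow> 'x::topological_space \<Rightarrow> 'x) \<Rightarrow> 'x measure \<Rightarrow> nat \<Rightarrow> (nat \<Rightarrow> 'x) measure \<Rightarrow> bool" where
  "trivial_joining T \<mu> N \<nu> \<longleftrightarrow>
     (\<exists>(k::nat) (b::nat \<Rightarrow> nat) (g::nat \<Rightarrow> 'g).
        b ` {..<N} = {..<k} \<and>
        \<nu> = distr (PiM {..<k} (\<lambda>j. off_diagonal_measure T \<mu> {i \<in> {..<N}. b i = j} g))
                  (borel_power {..<N}) (\<lambda>\<omega>. \<lambda>i\<in>{..<N}. \<omega> (b i) i))"

definition minimal_self_joinings_of_all_orders ::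
    "('g \<Rightarrow> 'x::topological_space \<Rightarrow> 'x) \<Rightarrow> 'x measure \<Rightarrow> bool" where
  "minimal_self_joinings_of_all_orders T \<mu> \<longleftrightarrow>
     (\<forall>N\<ge>2. \<forall>\<nu>. self_joining T \<mu> N \<nu> \<and> ergodic (diagonal_action T {..<N}) \<nu> \<longrightarrow>
        trivial_joining T \<mu> N \<nu>)"

subsection \<open>Weakly asymptotic pairs\<close>

definition weakly_asymptotic_pair ::
    "(nat \<Rightarrow> 'g set) \<Rightarrow> ('g \<Rightarrow> 'x::metric_space \<Rightarrow> 'x) \<Rightarrow> 'x \<Rightarrow> 'x \<Rightarrow> bool" where
  "weakly_asymptotic_pair F T x y \<longleftrightarrow>
     x \<noteq> y \<and>
     (\<exists>D. upper_density F D > 0 \<and>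
          ((\<lambda>g. dist (T g x) (T g y)) \<longlongrightarrow> 0) (inf cofinite (principal D)))"

end

theory Submission
  imports Defs
begin

text \<open>
  The proof exhibits a weakly asymptotic pair in any infinite system with the other properties.
  Fix a small \<open>\<epsilon> > 0\<close> and ask whether there are points \<open>x \<noteq> y\<close> that stay \<open>\<epsilon>\<close>-close
  along the whole group, that is \<open>dist (T g x) (T g y) \<le> \<epsilon>\<close> for every \<open>g\<close>.

  If there are none, the action is expansive, and the argument is purely topological. Write group
  elements as integer combinations of a finite generating set \<open>S\<close>. Call a unit vector \<open>u\<close> a
  nonexpansive normal if some pair of points at distance at least \<open>\<epsilon>\<close> stays
  \<open>\<epsilon>\<close>-close over the half-space where \<open>u\<close> is negative. For every integer vector \<open>w\<close> there
  is a nonexpansive normal \<open>u\<close> with \<open>\<langle>u, w\<rangle> \<le> 0\<close>: by the pigeonhole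
  principle some pair \<open>x \<noteq> y\<close> is close on balls of radius \<open>r\<close> around \<open>k w\<close> for
  arbitrarily large \<open>k\<close>. By expansiveness it is separated somewhere, so such a ball, moved towards
  the place of separation, has a first moment at which it touches a position where the pair is
  separated. Seen from that position the ball of closeness becomes a half-space as \<open>r\<close> grows
  (lemma \<open>halfspace_toward\<close>). A theorem of alternatives then
  (\<open>positive_along_filter_imp_positive\<close>) excludes that, for every nonexpansive normal \<open>u\<close>, almost
  all group elements in the sense of density lie where \<open>u\<close> is positive. Hence one of the half-spaces
  of closeness has positive upper density. Density is translation invariant, so the same holds
  arbitrarily deep inside the half-space, where expansiveness improves \<open>\<epsilon>\<close>-closeness to
  closeness of any prescribed quality.

  If there are such points \<open>x \<noteq> y\<close>, consider the averages of \<open>dist (T g x) (T g y)\<close> over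
  the Folner sets. If they tend to zero, the pair is weakly asymptotic. Otherwise the averages along
  the orbit of \<open>(x, y)\<close> have a limit which is an invariant state on the continuous functions on
  \<open>X \<times> X\<close>, concentrated on pairs at distance at most \<open>\<epsilon>\<close>, and positive on the
  distance function. An extreme point among the states that maximise the distance
  (\<open>extreme_maximizer\<close>) is represented by an ergodic measure, and unique ergodicity makes this
  measure a self-joining of order two. So it is trivial: either the product measure, or carried by the
  graph of some \<open>T h\<close>. The product charges pairs further apart than the small \<open>\<epsilon>\<close>. In the
  second case \<open>T h\<close> displaces no point by more than \<open>\<epsilon>\<close>. By mixing only finitely many \<open>h\<close>
  displace all points so little, and for \<open>\<epsilon>\<close> small enough only those acting as the identity
  (\<open>displacement_threshold\<close>). Then the measure lives on the diagonal, where the distance vanishes, a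
  contradiction (\<open>weakly_asymptotic_if_close\<close>).
\<close>

section \<open>Compactness and strict linear inequalities\<close>

text \<open>
  Refining the filter replaces the extraction of a convergent subsequence. Function spaces over an
  uncountable index set carry the product topology and need not be sequentially compact.
\<close>

lemma compact_cluster_filter:
  assumes "compact K" "F \<noteq> bot" "eventually (\<lambda>i. p i \<in> K) F"
  obtains q G where "q \<in> K" "G \<le> F" "G \<noteq> bot" "(p \<longlongrightarrow> q) G"
proof -
  have "filtermap p F \<noteq> bot" using assms(2) by (simp add: filtermap_bot_iff)
  moreover have "eventually (\<lambda>x. x \<in> K) (filtermap p F)"
    using assms(3) by (simp add: eventually_filtermap)
  ultimately obtain q where q: "q \<in> K" "inf (nhds q) (filtermap p F) \<noteq> bot"
    using assms(1) unfolding compact_filter by blast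
  define G where "G = inf F (filtercomap p (nhds q))"
  have "G \<noteq> bot"
  proof
    assume "G = bot"
    then have "eventually (\<lambda>_. False) G" by simp
    then obtain P Q where PQ: "eventually P F" "eventually Q (filtercomap p (nhds q))"
      "\<And>x. P x \<Longrightarrow> Q x \<Longrightarrow> False"
      unfolding G_def eventually_inf by blast
    then obtain Q' where Q': "eventually Q' (nhds q)" "\<And>x. Q' (p x) \<Longrightarrow> Q x"
      unfolding eventually_filtercomap by blast
    have "eventually (\<lambda>x. \<not> Q' x) (filtermap p F)"
      unfolding eventually_filtermap using PQ(1) by eventually_elim (use PQ(3) Q'(2) in blast)
    with Q'(1) have "eventually (\<lambda>_. False) (inf (nhds q) (filtermap p F))"
      unfolding eventually_inf by blast
    with q(2) show False by (simp add: trivial_limit_def)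
  qed
  moreover have "(p \<longlongrightarrow> q) G"
    unfolding G_def by (rule filterlim_mono[OF filterlim_filtercomap order_refl]) simp
  ultimately show ?thesis using q(1) that[of q G] by (simp add: G_def)
qed

lemma compact_box: "compact {u :: 'i \<Rightarrow> real. \<forall>i. \<bar>u i\<bar> \<le> B i}"
proof -
  have "{u :: 'i \<Rightarrow> real. \<forall>i. \<bar>u i\<bar> \<le> B i} = PiE UNIV (\<lambda>i. {- B i .. B i})"
    by (auto simp: PiE_iff abs_le_iff minus_le_iff)
  moreover have "compactin (product_topology (\<lambda>_. euclidean) UNIV) (PiE UNIV (\<lambda>i. {- B i .. B i}))"
    by (simp add: compactin_PiE)
  ultimately show ?thesis by (simp add: euclidean_product_topology)
qed

lemma tendsto_apply:
  fixes q :: "'s \<Rightarrow> 'a::topological_space"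
  assumes "(p \<longlongrightarrow> q) G" shows "((\<lambda>i. p i s) \<longlongrightarrow> q s) G"
proof (rule topological_tendstoI)
  fix A :: "'a set" assume A: "open A" "q s \<in> A"
  have "open ((\<lambda>x :: 's \<Rightarrow> 'a. x s) -` A)"
    by (intro open_vimage A continuous_on_product_coordinates)
  from topological_tendstoD[OF assms this] A(2) show "eventually (\<lambda>i. p i s \<in> A) G" by simp
qed

lemma continuous_on_apply: "continuous_on A (\<lambda>x. x s)"
  by (rule continuous_on_subset[OF continuous_on_product_coordinates]) simp

definition dot :: "'s set \<Rightarrow> ('s \<Rightarrow> real) \<Rightarrow> ('s \<Rightarrow> real) \<Rightarrow> real" where
  "dot S u v = (\<Sum>s\<in>S. u s * v s)"

lemma dot_commute: "dot S u v = dot S v u"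
  by (simp add: dot_def mult.commute)

lemma dot_add: "dot S u (\<lambda>s. v s + w s) = dot S u v + dot S u w"
  and dot_diff: "dot S u (\<lambda>s. v s - w s) = dot S u v - dot S u w"
  and dot_scale: "dot S u (\<lambda>s. c * v s) = c * dot S u v"
  by (simp_all add: dot_def distrib_left right_diff_distrib sum.distrib sum_subtractf
      sum_distrib_left mult.left_commute)

lemma tendsto_dot:
  assumes "(p \<longlongrightarrow> q) G" "(p' \<longlongrightarrow> q') G"
  shows "((\<lambda>i. dot S (p i) (p' i)) \<longlongrightarrow> dot S q q') G"
  unfolding dot_def by (intro tendsto_intros tendsto_apply[OF assms(1)] tendsto_apply[OF assms(2)])

lemma continuous_dot: "continuous_on A (\<lambda>u. dot S u v)"
  unfolding dot_def by (intro continuous_intros continuous_on_apply)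

text \<open>
  The witness is \<open>n v + w\<close> for large \<open>n\<close>: if it failed for every \<open>n\<close>, the violating points of
  \<open>K\<close> would cluster at a point where \<open>v\<close> vanishes and \<open>w\<close> is not positive.
\<close>

lemma perturb_positive:
  assumes K: "compact K" and nonneg: "\<And>u. u \<in> K \<Longrightarrow> dot S u v \<ge> 0"
    and pos: "\<And>u. u \<in> K \<Longrightarrow> dot S u v = 0 \<Longrightarrow> dot S u w > 0"
  shows "\<exists>v'. \<forall>u\<in>K. dot S u v' > 0"
proof (rule ccontr)
  assume "\<not> ?thesis"
  then have "\<forall>n::nat. \<exists>u\<in>K. dot S u (\<lambda>s. real n * v s + w s) \<le> 0" by (metis not_less)
  then obtain u where u: "\<And>n. u n \<in> K" "\<And>n. dot S (u n) (\<lambda>s. real n * v s + w s) \<le> 0"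
    by metis
  obtain q G where q: "q \<in> K" "G \<le> sequentially" "G \<noteq> bot" "(u \<longlongrightarrow> q) G"
    using compact_cluster_filter[OF K, of sequentially u] u(1) by auto
  have le: "real n * dot S (u n) v + dot S (u n) w \<le> 0" for n
    using u(2)[of n] by (simp add: dot_add dot_scale)
  have wlim: "((\<lambda>n. dot S (u n) w) \<longlongrightarrow> dot S q w) G"
    by (intro tendsto_dot q tendsto_const)
  have "((\<lambda>n. dot S (u n) v + inverse (real n) * dot S (u n) w) \<longlongrightarrow> dot S q v + 0 * dot S q w) G"
    by (intro tendsto_intros tendsto_dot q wlim tendsto_mono[OF q(2) lim_inverse_n] )
  moreover have "eventually (\<lambda>n. dot S (u n) v + inverse (real n) * dot S (u n) w \<le> 0) G"
  proof (rule filter_leD[OF q(2)])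
    show "eventually (\<lambda>n. dot S (u n) v + inverse (real n) * dot S (u n) w \<le> 0) sequentially"
      using eventually_gt_at_top[of 0]
    proof eventually_elim
      case (elim n)
      then have "dot S (u n) v + inverse (real n) * dot S (u n) w
          = inverse (real n) * (real n * dot S (u n) v + dot S (u n) w)"
        by (simp add: field_simps)
      also have "\<dots> \<le> 0" using le[of n] by (simp add: mult_nonneg_nonpos)
      finally show ?case .
    qed
  qed
  ultimately have "dot S q v + 0 * dot S q w \<le> 0"
    by (rule tendsto_upperbound) (rule q(3))
  then have "dot S q v = 0" using nonneg[OF q(1)] by simp
  then have "dot S q w > 0" using pos q(1) by simp
  moreover have "dot S (u n) w \<le> 0" for n
    using le[of n] nonneg[OF u(1), of n] by (smt (verit) mult_nonneg_nonneg of_nat_0_le_iff)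
  then have "dot S q w \<le> 0"
    by (intro tendsto_upperbound[OF wlim _ q(3)]) simp
  ultimately show False by simp
qed

text \<open>
  A theorem of alternatives in the manner of Gordan, with a filter in place of a single vector. The
  normalised vectors \<open>a i\<close> cluster at a direction \<open>v\<close>, on which every \<open>u\<close> in \<open>K\<close> is
  nonnegative, but possibly zero. The functionals in \<open>K\<close> that vanish on \<open>v\<close> do not change when a
  multiple of \<open>v\<close> is subtracted from \<open>a i\<close>; this removes one coordinate, and induction provides a
  vector that is positive on them. A small multiple of it corrects \<open>v\<close>.
\<close>

lemma positive_along_filter_imp_positive:
  assumes "finite S" "compact K" "F \<noteq> bot"
    and "\<And>u. u \<in> K \<Longrightarrow> \<forall>\<^sub>F i in F. dot S u (a i) > 0"
  shows "\<exists>v. \<forall>u\<in>K. dot S u v > 0"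
  using assms
proof (induction "card S" arbitrary: S K F a rule: less_induct)
  case less
  show ?case
  proof (cases "K = {}")
    case False
    then obtain u0 where "u0 \<in> K" by blast
    with less.prems(4) have ev0: "\<forall>\<^sub>F i in F. dot S u0 (a i) > 0" by blast
    define m where "m = (\<lambda>i. \<Sum>s\<in>S. \<bar>a i s\<bar>)"
    define b where "b = (\<lambda>i s. if s \<in> S then inverse (m i) * a i s else 0)"
    have mpos: "\<forall>\<^sub>F i in F. m i > 0" using ev0
    proof eventually_elim
      case (elim i)
      then obtain s where "s \<in> S" "a i s \<noteq> 0" unfolding dot_def
        by (metis (mono_tags, lifting) less_irrefl mult_zero_right sum.neutral)
      then show ?case unfolding m_def by (intro sum_pos2[of S s]) (use less.prems(1) in auto)
    qed
    have m0: "m i \<ge> 0" for i by (simp add: m_def sum_nonneg)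
    have "\<bar>b i s\<bar> \<le> 1" for i s
    proof (cases "s \<in> S")
      case True
      have "\<bar>a i s\<bar> \<le> m i" unfolding m_def using True less.prems(1)
        by (intro member_le_sum) auto
      then show ?thesis using True m0[of i]
        by (cases "m i = 0") (auto simp: b_def abs_mult field_simps)
    qed (simp add: b_def)
    then have "\<forall>\<^sub>F i in F. b i \<in> {u. \<forall>s. \<bar>u s\<bar> \<le> 1}" by simp
    from compact_cluster_filter[OF compact_box less.prems(3) this]
    obtain v G where v: "G \<le> F" "G \<noteq> bot" "(b \<longlongrightarrow> v) G" by blast
    have mG: "\<forall>\<^sub>F i in G. m i > 0" using mpos v(1) by (rule filter_leD[rotated])
    have dotb: "dot S u (b i) = inverse (m i) * dot S u (a i)" for u i
      unfolding dot_scale[symmetric] by (simp add: dot_def b_def)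
    have "((\<lambda>i. \<Sum>s\<in>S. \<bar>b i s\<bar>) \<longlongrightarrow> (\<Sum>s\<in>S. \<bar>v s\<bar>)) G"
      by (intro tendsto_intros tendsto_apply[OF v(3)])
    moreover have "\<forall>\<^sub>F i in G. (\<Sum>s\<in>S. \<bar>b i s\<bar>) = 1" using mG
    proof eventually_elim
      case (elim i)
      have "(\<Sum>s\<in>S. \<bar>b i s\<bar>) = inverse (m i) * m i"
        unfolding m_def sum_distrib_left using elim
        by (intro sum.cong) (auto simp: b_def abs_mult m_def)
      then show ?case using elim by simp
    qed
    ultimately have "(\<Sum>s\<in>S. \<bar>v s\<bar>) = 1"
      using tendsto_unique[OF v(2) _ tendsto_eventually] by blast
    then obtain s0 where s0: "s0 \<in> S" "v s0 \<noteq> 0"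
      by (metis (mono_tags, lifting) abs_zero sum.neutral zero_neq_one)
    have nonneg: "dot S u v \<ge> 0" if "u \<in> K" for u
    proof (rule tendsto_lowerbound[OF tendsto_dot[OF tendsto_const v(3)] _ v(2)])
      show "\<forall>\<^sub>F i in G. dot S u (b i) \<ge> 0"
        using filter_leD[OF v(1) less.prems(4)[OF that]] mG
        by eventually_elim (simp add: dotb)
    qed
    define K1 where "K1 = K \<inter> {u. dot S u v = 0}"
    \<comment> \<open>Functionals vanishing on \<open>v\<close> take the same value at \<open>a i\<close> and at \<open>a' i\<close>, whose coordinate \<open>s0\<close> is zero.\<close>
    define a' where "a' = (\<lambda>i s. a i s - (a i s0 / v s0) * v s)"
    have restr: "dot S u w = dot (S - {s0}) u w" if "w s0 = 0" for u w
      unfolding dot_def using s0(1) less.prems(1) that by (simp add: sum.remove)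
    have "\<exists>w. \<forall>u\<in>K1. dot (S - {s0}) u w > 0"
    proof (rule less.hyps)
      show "card (S - {s0}) < card S" by (rule card_Diff1_less[OF less.prems(1) s0(1)])
      show "compact K1" unfolding K1_def
        by (intro compact_Int_closed less.prems closed_Collect_eq continuous_dot continuous_on_const)
      show "\<forall>\<^sub>F i in G. dot (S - {s0}) u (a' i) > 0" if "u \<in> K1" for u
      proof -
        have "dot (S - {s0}) u (a' i) = dot S u (a i)" for i
        proof -
          have "dot (S - {s0}) u (a' i) = dot S u (a' i)"
            using s0(2) by (intro restr[symmetric]) (simp add: a'_def)
          also have "\<dots> = dot S u (a i)"
            using that unfolding a'_def dot_diff dot_scale by (simp add: K1_def)
          finally show ?thesis .
        qed
        then show ?thesis
          using filter_leD[OF v(1) less.prems(4)[of u]] that by (simp add: K1_def)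
      qed
    qed (use less.prems v in auto)
    then obtain w where w: "\<And>u. u \<in> K1 \<Longrightarrow> dot (S - {s0}) u w > 0" by blast
    have "dot S u (w(s0 := 0)) > 0" if "u \<in> K1" for u
    proof -
      have "dot S u (w(s0 := 0)) = dot (S - {s0}) u (w(s0 := 0))" by (rule restr) simp
      also have "\<dots> = dot (S - {s0}) u w" unfolding dot_def by (intro sum.cong) auto
      finally show ?thesis using w that by simp
    qed
    then show ?thesis
      by (intro perturb_positive[OF less.prems(2) nonneg]) (auto simp: K1_def)
  qed simp
qed

text \<open>
  Rounding \<open>n v\<close> to an integer vector costs a bounded amount, while the values at \<open>n v\<close> grow
  uniformly on the compact set \<open>K\<close>.
\<close>

lemma positive_imp_integer_positive:
  assumes "finite S" "compact K" "\<forall>u\<in>K. dot S u v > 0"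
  shows "\<exists>w::'s \<Rightarrow> int. \<forall>u\<in>K. dot S u (\<lambda>s. of_int (w s)) > 0"
proof (rule ccontr)
  assume "\<not> ?thesis"
  then have "\<exists>u\<in>K. dot S u (\<lambda>s. of_int (w s)) \<le> 0" for w :: "'s \<Rightarrow> int"
    by (simp add: not_less)
  note this[of "\<lambda>s. \<lfloor>real n * v s\<rfloor>" for n]
  then have "\<forall>n::nat. \<exists>u\<in>K. dot S u (\<lambda>s. of_int \<lfloor>real n * v s\<rfloor>) \<le> 0" by blast
  then obtain u where u: "\<And>n. u n \<in> K" "\<And>n. dot S (u n) (\<lambda>s. of_int \<lfloor>real n * v s\<rfloor>) \<le> 0"
    by metis
  obtain q G where q: "q \<in> K" "G \<le> sequentially" "G \<noteq> bot" "(u \<longlongrightarrow> q) G"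
    using compact_cluster_filter[OF assms(2), of sequentially u] u(1) by auto
  have lim: "((\<lambda>n. inverse (real n) * of_int \<lfloor>real n * v s\<rfloor>) \<longlongrightarrow> v s) sequentially" for s
  proof (rule tendsto_sandwich)
    show "\<forall>\<^sub>F n in sequentially. v s - inverse (real n) \<le> inverse (real n) * of_int \<lfloor>real n * v s\<rfloor>"
      using eventually_gt_at_top[of 0]
    proof eventually_elim
      case (elim n)
      then have "inverse (real n) * (real n * v s - 1) \<le> inverse (real n) * of_int \<lfloor>real n * v s\<rfloor>"
        by (intro mult_left_mono) (linarith, simp)
      then show ?case using elim by (simp add: right_diff_distrib mult.assoc[symmetric])
    qed
    show "\<forall>\<^sub>F n in sequentially. inverse (real n) * of_int \<lfloor>real n * v s\<rfloor> \<le> v s"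
      using eventually_gt_at_top[of 0]
    proof eventually_elim
      case (elim n)
      then have "inverse (real n) * of_int \<lfloor>real n * v s\<rfloor> \<le> inverse (real n) * (real n * v s)"
        by (intro mult_left_mono) auto
      then show ?case using elim by (simp add: mult.assoc[symmetric])
    qed
    show "((\<lambda>n. v s - inverse (real n)) \<longlongrightarrow> v s) sequentially"
      using tendsto_diff[OF tendsto_const lim_inverse_n, of "v s"] by simp
  qed simp
  have "((\<lambda>n. dot S (u n) (\<lambda>s. inverse (real n) * of_int \<lfloor>real n * v s\<rfloor>)) \<longlongrightarrow> dot S q v) G"
    unfolding dot_def by (intro tendsto_intros tendsto_apply[OF q(4)] tendsto_mono[OF q(2) lim])
  moreover have "dot S (u n) (\<lambda>s. inverse (real n) * of_int \<lfloor>real n * v s\<rfloor>) \<le> 0" for n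
    unfolding dot_scale using u(2)[of n] by (simp add: mult_nonneg_nonpos)
  ultimately have "dot S q v \<le> 0"
    by (intro tendsto_upperbound[OF _ _ q(3)]) auto
  with assms(3) q(1) show False by (simp add: not_less[symmetric])
qed

section \<open>Density along a Folner sequence\<close>

definition proportion :: "(nat \<Rightarrow> 'g set) \<Rightarrow> 'g set \<Rightarrow> nat \<Rightarrow> real" where
  "proportion F D n = real (card (F n \<inter> D)) / real (card (F n))"

lemma proportion_nonneg: "0 \<le> proportion F D n"
  by (simp add: proportion_def)

lemma proportion_mono:
  assumes "finite (F n)" "F n \<inter> D \<subseteq> E" shows "proportion F D n \<le> proportion F E n"
  unfolding proportion_def using assms by (intro divide_right_mono of_nat_mono card_mono) auto

lemma proportion_Un:
  assumes "finite (F n)" shows "proportion F (D \<union> E) n \<le> proportion F D n + proportion F E n"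
proof -
  have "card (F n \<inter> (D \<union> E)) \<le> card (F n \<inter> D) + card (F n \<inter> E)"
    unfolding Int_Un_distrib by (rule card_Un_le)
  then have "real (card (F n \<inter> (D \<union> E))) \<le> real (card (F n \<inter> D)) + real (card (F n \<inter> E))"
    by linarith
  then show ?thesis
    unfolding proportion_def add_divide_distrib[symmetric] by (rule divide_right_mono) simp
qed

lemma proportion_translate:
  fixes F :: "nat \<Rightarrow> 'g::ab_group_add set"
  assumes "finite (F n)"
  shows "proportion F D n \<le> proportion F ((+) t ` D) n +
    real (card (sym_diff ((+) t ` F n) (F n))) / real (card (F n))"
proof -
  have "card (F n \<inter> D) = card ((+) t ` (F n \<inter> D))" by (intro card_image[symmetric]) simp
  also have "\<dots> \<le> card ((F n \<inter> (+) t ` D) \<union> sym_diff ((+) t ` F n) (F n))"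
    using assms by (intro card_mono) auto
  also have "\<dots> \<le> card (F n \<inter> (+) t ` D) + card (sym_diff ((+) t ` F n) (F n))"
    by (rule card_Un_le)
  finally have "real (card (F n \<inter> D)) \<le> real (card (F n \<inter> (+) t ` D)) +
      real (card (sym_diff ((+) t ` F n) (F n)))"
    by linarith
  then show ?thesis
    unfolding proportion_def add_divide_distrib[symmetric] by (rule divide_right_mono) simp
qed

text \<open>
  Translation changes the proportion in a Folner set by an error that tends to zero.
\<close>

lemma frequently_proportion_translate:
  assumes F: "folner_sequence F" and c: "0 < c" "\<exists>\<^sub>F n in sequentially. proportion F D n \<ge> c"
  shows "\<exists>\<^sub>F n in sequentially. proportion F ((+) t ` D) n \<ge> c / 2"
proof -
  have "(\<lambda>n. real (card (sym_diff ((+) t ` F n) (F n))) / real (card (F n))) \<longlonglongrightarrow> 0"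
    using F by (auto simp: folner_sequence_def)
  then have "\<forall>\<^sub>F n in sequentially.
      real (card (sym_diff ((+) t ` F n) (F n))) / real (card (F n)) < c / 2"
    by (rule order_tendstoD) (use c in simp)
  then have "\<exists>\<^sub>F n in sequentially. proportion F D n \<ge> c \<and>
      real (card (sym_diff ((+) t ` F n) (F n))) / real (card (F n)) < c / 2"
    using c(2) by (intro frequently_eventually_frequently) auto
  then show ?thesis
  proof (rule frequently_elim1)
    fix n assume "proportion F D n \<ge> c \<and>
      real (card (sym_diff ((+) t ` F n) (F n))) / real (card (F n)) < c / 2"
    moreover have "finite (F n)" using F by (auto simp: folner_sequence_def)
    note proportion_translate[of F n D t, OF this]
    ultimately show "proportion F ((+) t ` D) n \<ge> c / 2" by linarith
  qed
qed

lemma not_tendsto_0_imp_frequently: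
  fixes f :: "nat \<Rightarrow> real"
  assumes "\<And>n. 0 \<le> f n" "\<not> f \<longlonglongrightarrow> 0"
  obtains c where "0 < c" "\<exists>\<^sub>F n in sequentially. f n \<ge> c"
proof -
  obtain c where c: "c > 0" "\<not> (\<forall>\<^sub>F n in sequentially. dist (f n) 0 < c)"
    using assms(2) unfolding tendsto_iff by auto
  have "\<exists>\<^sub>F n in sequentially. f n \<ge> c"
    using c(2) unfolding frequently_def by (simp add: assms(1) not_le)
  with c(1) show ?thesis by (rule that)
qed

text \<open>
  A property fails to hold eventually along this filter exactly if the set of exceptions has positive
  upper density. This lets density enter \<open>positive_along_filter_imp_positive\<close>.
\<close>

definition density_one_filter :: "(nat \<Rightarrow> 'g set) \<Rightarrow> 'g filter" where
  "density_one_filter F = Abs_filter (\<lambda>P. proportion F {g. \<not> P g} \<longlonglongrightarrow> 0)"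

lemma eventually_density_one_filter:
  assumes "\<And>n. finite (F n)"
  shows "eventually P (density_one_filter F) \<longleftrightarrow> proportion F {g. \<not> P g} \<longlonglongrightarrow> 0"
  unfolding density_one_filter_def
proof (rule eventually_Abs_filter, rule is_filter.intro)
  have squeeze: "f \<longlonglongrightarrow> 0" if "\<And>n. 0 \<le> f n" "\<And>n. f n \<le> g n" "g \<longlonglongrightarrow> 0" for f g :: "nat \<Rightarrow> real"
    by (rule tendsto_sandwich[OF _ _ tendsto_const that(3)]) (simp_all add: that)
  show "proportion F {g. \<not> True} \<longlonglongrightarrow> 0" by (simp add: proportion_def[abs_def])
  show "proportion F {g. \<not> (P g \<and> Q g)} \<longlonglongrightarrow> 0"
    if "proportion F {g. \<not> P g} \<longlonglongrightarrow> 0" "proportion F {g. \<not> Q g} \<longlonglongrightarrow> 0" for P Q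
  proof (rule squeeze)
    have eq: "{g. \<not> (P g \<and> Q g)} = {g. \<not> P g} \<union> {g. \<not> Q g}" by auto
    show "proportion F {g. \<not> (P g \<and> Q g)} n \<le> proportion F {g. \<not> P g} n + proportion F {g. \<not> Q g} n" for n
      unfolding eq by (rule proportion_Un[OF assms])
    show "(\<lambda>n. proportion F {g. \<not> P g} n + proportion F {g. \<not> Q g} n) \<longlonglongrightarrow> 0"
      using tendsto_add[OF that] by simp
  qed (rule proportion_nonneg)
  show "proportion F {g. \<not> Q g} \<longlonglongrightarrow> 0"
    if PQ: "\<forall>x. P x \<longrightarrow> Q x" and P: "proportion F {g. \<not> P g} \<longlonglongrightarrow> 0" for P Q
  proof (rule squeeze[OF proportion_nonneg _ P])
    fix n
    have "F n \<inter> {g. \<not> Q g} \<subseteq> {g. \<not> P g}" using PQ by blast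
    then show "proportion F {g. \<not> Q g} n \<le> proportion F {g. \<not> P g} n"
      by (rule proportion_mono[OF assms])
  qed
qed

lemma density_one_filter_neq_bot:
  assumes "\<And>n. finite (F n)" "\<And>n. F n \<noteq> {}"
  shows "density_one_filter F \<noteq> bot"
proof
  assume "density_one_filter F = bot"
  then have "proportion F {g. \<not> False} \<longlonglongrightarrow> 0"
    unfolding eventually_density_one_filter[OF assms(1), symmetric] by simp
  moreover have "proportion F {g. \<not> False} = (\<lambda>n. 1)"
    using assms by (auto simp: proportion_def fun_eq_iff card_gt_0_iff)
  ultimately have "(\<lambda>n::nat. 1::real) \<longlonglongrightarrow> 0" by simp
  then show False by (simp add: LIMSEQ_const_iff)
qed

text \<open>
  The set \<open>D\<close> demanded by the definition is glued from pieces: the part of the \<open>k\<close>-th Folner set of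
  a subsequence where the distance is below \<open>1 / (k + 1)\<close>. Each piece keeps the proportion above
  \<open>c\<close>, and all but finitely many elements of \<open>D\<close> belong to late pieces.
\<close>

lemma weakly_asymptotic_pairI:
  assumes fin: "\<And>n. finite (F n)" and "x \<noteq> y" "0 < c"
    and freq: "\<And>\<delta>. 0 < \<delta> \<Longrightarrow>
      \<exists>\<^sub>F n in sequentially. proportion F {g. dist (T g x) (T g y) < \<delta>} n \<ge> c"
  shows "weakly_asymptotic_pair F T x y"
proof -
  define E where "E = (\<lambda>k::nat. {g. dist (T g x) (T g y) < 1 / real (Suc k)})"
  have "\<exists>n\<ge>k. proportion F (E k) n \<ge> c" for k
  proof -
    have "\<exists>\<^sub>F n in sequentially. proportion F (E k) n \<ge> c"
      unfolding E_def by (rule freq) simp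
    then show ?thesis by (simp add: frequently_sequentially)
  qed
  then obtain m where m: "\<And>k. m k \<ge> k" "\<And>k. proportion F (E k) (m k) \<ge> c" by metis
  define D where "D = (\<Union>k. F (m k) \<inter> E k)"
  have "ereal c \<le> upper_density F D"
  proof (rule ccontr)
    assume "\<not> ereal c \<le> upper_density F D"
    then have "limsup (\<lambda>n. ereal (proportion F D n)) < ereal c"
      by (simp add: upper_density_def proportion_def not_le)
    then have "\<forall>\<^sub>F n in sequentially. ereal (proportion F D n) < ereal c"
      by (rule Limsup_lessD)
    then obtain N where N: "\<And>n. n \<ge> N \<Longrightarrow> proportion F D n < c"
      by (auto simp: eventually_sequentially)
    have "proportion F (E N) (m N) \<le> proportion F D (m N)"
      by (rule proportion_mono[OF fin]) (auto simp: D_def)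
    with N[OF m(1)] m(2)[of N] show False by linarith
  qed
  then have "upper_density F D > 0"
    using \<open>0 < c\<close> by (metis ereal_less(2) less_le_trans)
  moreover have "((\<lambda>g. dist (T g x) (T g y)) \<longlongrightarrow> 0) (inf cofinite (principal D))"
  proof (rule tendstoI)
    fix e :: real assume "0 < e"
    then obtain k where k: "1 / real (Suc k) < e" using nat_approx_posE by blast
    have "{g. \<not> (g \<in> D \<longrightarrow> dist (dist (T g x) (T g y)) 0 < e)} \<subseteq> (\<Union>j<k. F (m j))"
    proof
      fix g assume "g \<in> {g. \<not> (g \<in> D \<longrightarrow> dist (dist (T g x) (T g y)) 0 < e)}"
      then have g: "g \<in> D" "dist (T g x) (T g y) \<ge> e" by auto
      then obtain j where j: "g \<in> F (m j)" "dist (T g x) (T g y) < 1 / real (Suc j)"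
        by (auto simp: D_def E_def)
      have "j < k"
      proof (rule ccontr)
        assume "\<not> j < k"
        then have "1 / real (Suc j) \<le> 1 / real (Suc k)" by (simp add: frac_le)
        with j(2) k g(2) show False by linarith
      qed
      with j(1) show "g \<in> (\<Union>j<k. F (m j))" by auto
    qed
    then have "finite {g. \<not> (g \<in> D \<longrightarrow> dist (dist (T g x) (T g y)) 0 < e)}"
      by (rule finite_subset) (simp add: fin)
    then show "\<forall>\<^sub>F g in inf cofinite (principal D). dist (dist (T g x) (T g y)) 0 < e"
      unfolding eventually_inf_principal eventually_cofinite .
  qed
  ultimately show ?thesis
    unfolding weakly_asymptotic_pair_def using \<open>x \<noteq> y\<close> by blast
qed

section \<open>Integer coordinates on a finitely generated abelian group\<close>

text \<open>
  Scalar multiplication of the integers on an abelian group. One of the two sums is always empty; their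
  difference avoids a case distinction on the sign.
\<close>

definition zmult :: "int \<Rightarrow> 'g::ab_group_add \<Rightarrow> 'g" where
  "zmult k g = (\<Sum>i<nat k. g) - (\<Sum>i<nat (- k). g)"

lemma zmult_add: "zmult (a + b) g = zmult a g + zmult b g"
proof -
  have add: "(\<Sum>i<m + n. g) = (\<Sum>i<m. g) + (\<Sum>i<n. g)" for m n :: nat
    by (induction n) (simp_all add: add.assoc)
  have "nat (a + b) + (nat (- a) + nat (- b)) = nat a + nat b + nat (- (a + b))" by linarith
  then have "(\<Sum>i<nat (a + b). g) + ((\<Sum>i<nat (- a). g) + (\<Sum>i<nat (- b). g))
      = (\<Sum>i<nat a. g) + (\<Sum>i<nat b. g) + (\<Sum>i<nat (- (a + b)). g)"
    unfolding add[symmetric] by simp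
  then show ?thesis unfolding zmult_def by (simp add: algebra_simps)
qed

definition lattice_sum :: "'g::ab_group_add set \<Rightarrow> ('g \<Rightarrow> int) \<Rightarrow> 'g" where
  "lattice_sum S n = (\<Sum>s\<in>S. zmult (n s) s)"

lemma lattice_sum_add: "lattice_sum S (\<lambda>s. m s + n s) = lattice_sum S m + lattice_sum S n"
  by (simp add: lattice_sum_def zmult_add sum.distrib)

lemma lattice_sum_diff: "lattice_sum S (\<lambda>s. m s - n s) = lattice_sum S m - lattice_sum S n"
  using lattice_sum_add[of S "\<lambda>s. m s - n s" n] by (simp add: algebra_simps)

lemma lattice_sum_zero: "lattice_sum S (\<lambda>_. 0) = 0"
  by (simp add: lattice_sum_def zmult_def)

lemma lattice_sum_surj:
  assumes "finite S" "group_closure S = UNIV"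
  shows "\<exists>n. lattice_sum S n = g"
proof -
  have "g \<in> group_closure S" using assms by simp
  then show ?thesis
  proof induction
    case (base s)
    show ?case
    proof (cases "s \<in> S")
      case True
      have "lattice_sum S (\<lambda>t. if t = s then 1 else 0) = (\<Sum>t\<in>S. if t = s then s else 0)"
        unfolding lattice_sum_def by (intro sum.cong) (auto simp: zmult_def)
      then show ?thesis using True assms(1) by auto
    next
      case False
      then show ?thesis using base lattice_sum_zero by auto
    qed
  next
    case (diff s t)
    then show ?case using lattice_sum_diff by metis
  qed
qed

section \<open>Actions on compact spaces and nonexpansive half-spaces\<close>

locale compact_action =
  fixes T :: "'g::ab_group_add \<Rightarrow> 'x::metric_space \<Rightarrow> 'x"
  assumes compact_space: "compact (UNIV :: 'x set)" and action: "continuous_action T"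
begin

lemma T_zero [simp]: "T 0 x = x"
  and T_add: "T (g + h) x = T g (T h x)"
  and continuous_T: "continuous_on UNIV (T g)"
  using action by (auto simp: continuous_action_def)

lemma T_minus [simp]: "T (- g) (T g x) = x" "T g (T (- g) x) = x"
  by (simp_all flip: T_add)

lemma tendsto_T:
  assumes "(x \<longlongrightarrow> x0) G" shows "((\<lambda>i. T g (x i)) \<longlongrightarrow> T g x0) G"
  using continuous_on_tendsto_compose[OF continuous_T assms] by simp

lemma uniform_T:
  assumes "finite A" "0 < e"
  shows "\<exists>\<delta>>0. \<forall>x y. dist x y < \<delta> \<longrightarrow> (\<forall>g\<in>A. dist (T g x) (T g y) < e)"
  using assms(1)
proof induction
  case empty
  show ?case by (intro exI[of _ 1]) simp
next
  case (insert g A)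
  then obtain d where d: "d > 0" "\<And>x y. dist x y < d \<Longrightarrow> \<forall>g\<in>A. dist (T g x) (T g y) < e" by blast
  have "uniformly_continuous_on UNIV (T g)"
    by (rule compact_uniformly_continuous[OF continuous_T compact_space])
  then obtain d' where d': "d' > 0" "\<And>x y. dist x y < d' \<Longrightarrow> dist (T g x) (T g y) < e"
    unfolding uniformly_continuous_on_def using assms(2) by (metis UNIV_I dist_commute)
  show ?case by (intro exI[of _ "min d d'"]) (use d d' in auto)
qed

text \<open>
  Cover the space by finitely many small balls and take one point more than there are balls. At each
  time two of the points lie in the same ball, and one pair has to do so infinitely often.
\<close>

lemma recurrently_close_pair:
  fixes h :: "nat \<Rightarrow> 'g"
  assumes "infinite (UNIV :: 'x set)" "finite A" "0 < e"
  shows "\<exists>x y. x \<noteq> y \<and> infinite {k. \<forall>g\<in>A. dist (T (g + h k) x) (T (g + h k) y) < e}"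
proof -
  obtain d where d: "d > 0" "\<And>x y. dist x y < d \<Longrightarrow> \<forall>g\<in>A. dist (T g x) (T g y) < e"
    using uniform_T[OF assms(2,3)] by blast
  obtain C where C: "finite C" "UNIV \<subseteq> (\<Union>x\<in>C. ball x (d / 2) :: 'x set)"
  proof (rule compactE_image[OF compact_space, of UNIV "\<lambda>x. ball x (d / 2)"])
    show "(UNIV :: 'x set) \<subseteq> (\<Union>x\<in>UNIV. ball x (d / 2))"
    proof
      fix x :: 'x
      have "x \<in> ball x (d / 2)" using d(1) by simp
      then show "x \<in> (\<Union>x\<in>UNIV. ball x (d / 2))" by blast
    qed
  qed auto
  obtain Z :: "'x set" where Z: "finite Z" "card Z = Suc (card C)"
    using infinite_arbitrarily_large[OF assms(1)] by blast
  have "\<exists>c\<in>C. dist c x < d / 2" for x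
  proof -
    have "x \<in> (\<Union>x\<in>C. ball x (d / 2))" using C(2) by blast
    then show ?thesis by (simp add: mem_ball)
  qed
  then obtain c where c: "\<And>x. c x \<in> C" "\<And>x. dist (c x) x < d / 2" by metis
  have "\<exists>p\<in>Z \<times> Z. fst p \<noteq> snd p \<and> c (T (h k) (fst p)) = c (T (h k) (snd p))" for k
  proof -
    have "\<not> inj_on (\<lambda>x. c (T (h k) x)) Z"
    proof
      assume "inj_on (\<lambda>x. c (T (h k) x)) Z"
      then have "card Z \<le> card C" by (rule card_inj_on_le) (use c(1) C(1) in auto)
      then show False using Z(2) by simp
    qed
    then show ?thesis by (auto simp: inj_on_def)
  qed
  then obtain p where p: "\<And>k. p k \<in> Z \<times> Z" "\<And>k. fst (p k) \<noteq> snd (p k)"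
    "\<And>k. c (T (h k) (fst (p k))) = c (T (h k) (snd (p k)))" by metis
  have "finite (range p)" by (rule finite_subset[of _ "Z \<times> Z"]) (use p(1) Z(1) in blast)+
  then obtain k0 where k0: "infinite {k. p k = p k0}"
    using pigeonhole_infinite[of "UNIV :: nat set" p] by auto
  have "dist (T (g + h k) (fst (p k0))) (T (g + h k) (snd (p k0))) < e"
    if "p k = p k0" "g \<in> A" for k g
  proof -
    have "dist (T (h k) (fst (p k))) (T (h k) (snd (p k))) < d"
      using c(2)[of "T (h k) (fst (p k))"] c(2)[of "T (h k) (snd (p k))"] p(3)[of k]
        dist_triangle_half_r by metis
    then show ?thesis using d(2) that unfolding T_add by auto
  qed
  then have "{k. p k = p k0} \<subseteq>
      {k. \<forall>g\<in>A. dist (T (g + h k) (fst (p k0))) (T (g + h k) (snd (p k0))) < e}" by blast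
  with k0 have "infinite {k. \<forall>g\<in>A. dist (T (g + h k) (fst (p k0))) (T (g + h k) (snd (p k0))) < e}"
    using infinite_super by blast
  with p(2)[of k0] show ?thesis by blast
qed

end

locale expansive_action = compact_action T
  for T :: "'g::ab_group_add \<Rightarrow> 'x::metric_space \<Rightarrow> 'x" +
  fixes \<epsilon> :: real and S :: "'g set"
  assumes \<epsilon>_pos: "0 < \<epsilon>" and infinite_space: "infinite (UNIV :: 'x set)"
    and expansive: "\<And>x y. x \<noteq> y \<Longrightarrow> \<exists>g. dist (T g x) (T g y) > \<epsilon>"
    and finite_S: "finite S" and generators: "group_closure S = UNIV"
begin

text \<open>
  Otherwise the closed sets of \<open>\<delta>\<close>-separated pairs that are \<open>\<epsilon>\<close>-close at a given
  group element have the finite intersection property, and a common member contradicts expansiveness.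
\<close>

lemma uniformly_expansive:
  assumes "0 < \<delta>"
  shows "\<exists>A. finite A \<and> (\<forall>x y. (\<forall>g\<in>A. dist (T g x) (T g y) \<le> \<epsilon>) \<longrightarrow> dist x y < \<delta>)"
proof (rule ccontr)
  assume no: "\<not> ?thesis"
  define C where "C = (\<lambda>g. {p :: 'x \<times> 'x. dist (fst p) (snd p) \<ge> \<delta> \<and> dist (T g (fst p)) (T g (snd p)) \<le> \<epsilon>})"
  have cpt: "compact (UNIV :: ('x \<times> 'x) set)"
    using compact_Times[OF compact_space compact_space] by simp
  have cl: "closed (C g)" for g
    unfolding C_def by (intro closed_Collect_conj closed_Collect_le continuous_intros
        continuous_on_compose2[OF continuous_T]) auto
  have fip: "UNIV \<inter> \<Inter> (C ` A) \<noteq> {}" if A: "finite A" for A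
  proof -
    obtain x y where "\<forall>g\<in>A. dist (T g x) (T g y) \<le> \<epsilon>" "\<not> dist x y < \<delta>"
      using no A by blast
    then have "(x, y) \<in> UNIV \<inter> \<Inter> (C ` A)" by (simp add: C_def)
    then show ?thesis by blast
  qed
  have "UNIV \<inter> (\<Inter>g\<in>UNIV. C g) \<noteq> {}"
    by (rule compact_imp_fip_image[OF cpt cl fip])
  then obtain x y where xy: "\<And>g. (x, y) \<in> C g" by auto
  then have "x \<noteq> y" using assms by (force simp: C_def)
  then show False using expansive[of x y] xy by (auto simp: C_def not_less[symmetric])
qed

text \<open>
  The pair is separated at the identity and close over the whole open half-space with outer normal
  \<open>u\<close>. In the language of expansive subdynamics, this half-space is nonexpansive.
\<close>

definition halfspace_pair :: "('g \<Rightarrow> real) \<Rightarrow> 'x \<Rightarrow> 'x \<Rightarrow> bool" where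
  "halfspace_pair u x y \<longleftrightarrow> dist x y \<ge> \<epsilon> \<and> (\<forall>n. dot S u (\<lambda>s. of_int (n s)) < 0 \<longrightarrow>
     dist (T (lattice_sum S n) x) (T (lattice_sum S n) y) \<le> \<epsilon>)"

definition nonexpansive_normals :: "('g \<Rightarrow> real) set" where
  "nonexpansive_normals = {u. (\<forall>s. s \<notin> S \<longrightarrow> u s = 0) \<and> dot S u u = 1 \<and> (\<exists>x y. halfspace_pair u x y)}"

lemma unit_le_1:
  assumes "\<forall>s. s \<notin> S \<longrightarrow> u s = 0" "dot S u u = 1"
  shows "\<bar>u s\<bar> \<le> 1"
proof (cases "s \<in> S")
  case True
  have "u s * u s \<le> dot S u u" unfolding dot_def
    using True finite_S by (intro member_le_sum) auto
  then show ?thesis using assms(2) by (simp add: power2_eq_square[symmetric] abs_square_le_1)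
qed (simp add: assms)

text \<open>
  Closeness is demanded on the open half-space only, and a lattice point with
  \<open>dot S u0 n < 0\<close> eventually lies in the half-spaces of the approximating normals. The hypotheses ask
  only for closeness that holds eventually, so that approximate half-spaces are covered as well.
\<close>

lemma limit_in_nonexpansive_normals:
  assumes G: "G \<noteq> bot" and lim: "(u \<longlongrightarrow> u0) G" "(x \<longlongrightarrow> x0) G" "(y \<longlongrightarrow> y0) G"
    and ev: "\<And>i s. s \<notin> S \<Longrightarrow> u i s = 0" "\<forall>\<^sub>F i in G. dot S (u i) (u i) = 1"
      "\<forall>\<^sub>F i in G. dist (x i) (y i) \<ge> \<epsilon>"
    and close: "\<And>n. dot S u0 (\<lambda>s. of_int (n s)) < 0 \<Longrightarrow>
      \<forall>\<^sub>F i in G. dist (T (lattice_sum S n) (x i)) (T (lattice_sum S n) (y i)) \<le> \<epsilon>"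
  shows "u0 \<in> nonexpansive_normals"
  unfolding nonexpansive_normals_def mem_Collect_eq
proof (intro conjI exI allI impI)
  show "u0 s = 0" if "s \<notin> S" for s
  proof -
    have "((\<lambda>i. u i s) \<longlongrightarrow> u0 s) G" by (rule tendsto_apply[OF lim(1)])
    then show ?thesis using that G by (simp add: ev(1) tendsto_const_iff)
  qed
  show "dot S u0 u0 = 1"
    by (rule tendsto_unique[OF G tendsto_dot[OF lim(1) lim(1)] tendsto_eventually[OF ev(2)]])
  show "halfspace_pair u0 x0 y0" unfolding halfspace_pair_def
  proof (intro conjI allI impI)
    show "dist x0 y0 \<ge> \<epsilon>"
      by (rule tendsto_lowerbound[OF tendsto_dist[OF lim(2,3)] ev(3) G])
    show "dist (T (lattice_sum S n) x0) (T (lattice_sum S n) y0) \<le> \<epsilon>"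
      if "dot S u0 (\<lambda>s. real_of_int (n s)) < 0" for n
      by (rule tendsto_upperbound[OF tendsto_dist[OF tendsto_T[OF lim(2)] tendsto_T[OF lim(3)]] close[OF that] G])
  qed
qed

text \<open>
  The witnessing pairs are chosen as functions of the normal and converge together with it.
\<close>

lemma compact_nonexpansive_normals: "compact nonexpansive_normals"
  unfolding compact_filter
proof (intro allI impI)
  fix F :: "('g \<Rightarrow> real) filter"
  assume F: "F \<noteq> bot" "\<forall>\<^sub>F u in F. u \<in> nonexpansive_normals"
  define X where "X = (\<lambda>u. SOME p. halfspace_pair u (fst p) (snd p))"
  have X: "halfspace_pair u (fst (X u)) (snd (X u))" if u: "u \<in> nonexpansive_normals" for u
  proof -
    obtain x y where "halfspace_pair u x y" using u unfolding nonexpansive_normals_def by blast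
    then have "halfspace_pair u (fst (x, y)) (snd (x, y))" by simp
    then show ?thesis unfolding X_def by (rule someI)
  qed
  have "compact ({u :: 'g \<Rightarrow> real. \<forall>s. \<bar>u s\<bar> \<le> 1} \<times> (UNIV :: 'x set) \<times> (UNIV :: 'x set))"
    by (intro compact_Times compact_space) (rule compact_box)
  moreover have "\<forall>\<^sub>F u in F. (u, X u) \<in> {u. \<forall>s. \<bar>u s\<bar> \<le> 1} \<times> UNIV \<times> UNIV"
    using F(2) by eventually_elim (use unit_le_1 in \<open>auto simp: nonexpansive_normals_def\<close>)
  ultimately obtain q G where q: "G \<le> F" "G \<noteq> bot" "((\<lambda>u. (u, X u)) \<longlongrightarrow> q) G"
    using F(1) by (elim compact_cluster_filter) auto
  have lim: "((\<lambda>u. u) \<longlongrightarrow> fst q) G" "((\<lambda>u. fst (X u)) \<longlongrightarrow> fst (snd q)) G"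
    "((\<lambda>u. snd (X u)) \<longlongrightarrow> snd (snd q)) G"
    using tendsto_fst[OF q(3)] tendsto_fst[OF tendsto_snd[OF q(3)]] tendsto_snd[OF tendsto_snd[OF q(3)]]
    by simp_all
  have evG: "\<forall>\<^sub>F u in G. u \<in> nonexpansive_normals" by (rule filter_leD[OF q(1) F(2)])
  define u where "u = (\<lambda>v s. if s \<in> S then v s else 0 :: real)"
  have u_eq: "\<forall>\<^sub>F v in G. u v = v"
    using evG by eventually_elim (auto simp: u_def nonexpansive_normals_def fun_eq_iff)
  have "fst q \<in> nonexpansive_normals"
  proof (rule limit_in_nonexpansive_normals[OF q(2) _ lim(2,3)])
    show "(u \<longlongrightarrow> fst q) G"
      by (rule Lim_transform_eventually[OF lim(1)]) (use u_eq in eventually_elim, simp)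
    show "u v s = 0" if "s \<notin> S" for v s using that by (simp add: u_def)
    show "\<forall>\<^sub>F v in G. dot S (u v) (u v) = 1"
      using u_eq evG by eventually_elim (simp add: nonexpansive_normals_def)
    show "\<forall>\<^sub>F v in G. dist (fst (X v)) (snd (X v)) \<ge> \<epsilon>"
      using evG by eventually_elim (use X in \<open>auto simp: halfspace_pair_def\<close>)
    fix n assume n: "dot S (fst q) (\<lambda>s. real_of_int (n s)) < 0"
    have "\<forall>\<^sub>F v in G. dot S v (\<lambda>s. real_of_int (n s)) < 0"
      by (rule order_tendstoD(2)[OF tendsto_dot[OF lim(1) tendsto_const] n])
    then show "\<forall>\<^sub>F v in G. dist (T (lattice_sum S n) (fst (X v))) (T (lattice_sum S n) (snd (X v))) \<le> \<epsilon>"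
      using evG by eventually_elim (use X in \<open>auto simp: halfspace_pair_def\<close>)
  qed
  moreover have "inf (nhds (fst q)) F \<noteq> bot"
  proof -
    have "G \<le> inf (nhds (fst q)) F"
      using lim(1) q(1) by (simp add: filterlim_def filtermap_ident)
    then show ?thesis using q(2) by (metis bot.extremum_unique)
  qed
  ultimately show "\<exists>u\<in>nonexpansive_normals. inf (nhds u) F \<noteq> bot" by blast
qed

end

section \<open>Weakly asymptotic pairs in expansive systems\<close>

lemma dot_self_nonneg: "0 \<le> dot S u u"
  by (simp add: dot_def sum_nonneg)

lemma dot_diff_self: "dot S (\<lambda>s. u s - v s) (\<lambda>s. u s - v s) = dot S u u - 2 * dot S u v + dot S v v"
  and dot_add_self: "dot S (\<lambda>s. u s + v s) (\<lambda>s. u s + v s) = dot S u u + 2 * dot S u v + dot S v v"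
  by (simp_all add: dot_def algebra_simps sum.distrib sum_subtractf sum_distrib_left)

lemma dot_scale_self: "dot S (\<lambda>s. c * u s) (\<lambda>s. c * u s) = c\<^sup>2 * dot S u u"
  by (simp add: dot_def sum_distrib_left power2_eq_square algebra_simps)

lemma finite_lattice_ball:
  assumes "finite S"
  shows "finite {lattice_sum S n | n. dot S (\<lambda>s. of_int (n s)) (\<lambda>s. of_int (n s)) < r}"
proof (rule finite_subset)
  show "finite (lattice_sum S ` PiE S (\<lambda>_. {-\<lceil>r\<rceil>..\<lceil>r\<rceil>}))"
    using assms by (intro finite_imageI finite_PiE) auto
  show "{lattice_sum S n | n. dot S (\<lambda>s. of_int (n s)) (\<lambda>s. of_int (n s)) < r}
      \<subseteq> lattice_sum S ` PiE S (\<lambda>_. {-\<lceil>r\<rceil>..\<lceil>r\<rceil>})"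
  proof clarify
    fix n assume n: "dot S (\<lambda>s. real_of_int (n s)) (\<lambda>s. real_of_int (n s)) < r"
    have "n s \<in> {-\<lceil>r\<rceil>..\<lceil>r\<rceil>}" if s: "s \<in> S" for s
    proof -
      have "real_of_int (n s) * real_of_int (n s) \<le> dot S (\<lambda>s. real_of_int (n s)) (\<lambda>s. real_of_int (n s))"
        unfolding dot_def using s assms
          member_le_sum[of s S "\<lambda>s. real_of_int (n s) * real_of_int (n s)"] by simp
      then have "real_of_int (n s * n s) < r" using n by simp
      then have "n s * n s \<le> \<lceil>r\<rceil>" by linarith
      moreover have "\<bar>n s\<bar> \<le> n s * n s"
      proof (cases "n s = 0")
        case False
        then have "\<bar>n s\<bar> * 1 \<le> \<bar>n s\<bar> * \<bar>n s\<bar>" by (intro mult_left_mono) auto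
        then show ?thesis by (simp add: abs_mult[symmetric])
      qed simp
      ultimately show ?thesis by auto
    qed
    then have "restrict n S \<in> PiE S (\<lambda>_. {-\<lceil>r\<rceil>..\<lceil>r\<rceil>})" by (simp add: restrict_PiE_iff)
    moreover have "lattice_sum S n = lattice_sum S (restrict n S)"
      unfolding lattice_sum_def by (rule sum.cong) auto
    ultimately show "lattice_sum S n \<in> lattice_sum S ` PiE S (\<lambda>_. {-\<lceil>r\<rceil>..\<lceil>r\<rceil>})" by blast
  qed
qed

context expansive_action
begin

lemma surj_lattice: "\<exists>n. lattice_sum S n = g"
  by (rule lattice_sum_surj[OF finite_S generators])

text \<open>
  The moving ball. A pair \<open>x \<noteq> y\<close> that is close on the balls of radius \<open>r\<close> around \<open>k w\<close> for
  arbitrarily large \<open>k\<close> is separated at some lattice point \<open>n0\<close>. Move the centre of the ball from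
  \<open>k w\<close> to \<open>n0\<close> in steps so short that \<open>r\<close> times their length is at most one. At the first step
  after which the ball contains a point \<open>q\<close> of separation, the ball before the step is free of such
  points, and the squared distance from its centre to \<open>q\<close> is between \<open>r^2\<close> and \<open>r^2 + 3\<close>.
  Recentring at \<open>q\<close>, the pair is close on a ball of radius \<open>r\<close> that almost has the origin on its boundary. The inequality in the
  last line of the conclusion describes this ball; it approximates the half-space where \<open>u\<close> is
  negative. Since the ball approaches \<open>q\<close>, the unit vector \<open>u\<close> from its centre to \<open>q\<close> makes an
  acute angle with the direction of motion, which is close to \<open>- w\<close> when \<open>k\<close> is large.
\<close>

lemma approximate_halfspace_pair:
  fixes w :: "'g \<Rightarrow> int" and r :: real
  assumes r: "1 \<le> r"
  shows "\<exists>u x y. (\<forall>s. s \<notin> S \<longrightarrow> u s = 0) \<and> dot S u u = 1 \<and> dist x y \<ge> \<epsilon> \<and>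
    dot S u (\<lambda>s. of_int (w s)) \<le> 1 / r \<and>
    (\<forall>n. dot S (\<lambda>s. of_int (n s)) (\<lambda>s. of_int (n s)) + 3 + 2 * r * dot S u (\<lambda>s. of_int (n s)) < 0 \<longrightarrow>
       dist (T (lattice_sum S n) x) (T (lattice_sum S n) y) \<le> \<epsilon>)"
proof -
  define \<iota> :: "('g \<Rightarrow> int) \<Rightarrow> 'g \<Rightarrow> real" where "\<iota> = (\<lambda>n s. of_int (n s))"
  define nn where "nn = (\<lambda>v. dot S v v)"
  define A where "A = {lattice_sum S n | n. nn (\<iota> n) < r\<^sup>2}"
  have "finite A" unfolding A_def nn_def \<iota>_def by (rule finite_lattice_ball[OF finite_S])
  define h where "h = (\<lambda>k. lattice_sum S (\<lambda>s. int k * w s))"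
  obtain x y where "x \<noteq> y"
    and inf: "infinite {k. \<forall>g\<in>A. dist (T (g + h k) x) (T (g + h k) y) < \<epsilon>}"
    using recurrently_close_pair[OF infinite_space \<open>finite A\<close> \<epsilon>_pos, of h] by blast
  obtain g0 where g0: "dist (T g0 x) (T g0 y) > \<epsilon>" using expansive[OF \<open>x \<noteq> y\<close>] by blast
  obtain n0 where n0: "lattice_sum S n0 = g0" using surj_lattice by blast
  \<comment> \<open>\<open>C\<close> bounds the inner product of \<open>n0\<close> with any unit vector.\<close>
  define C where "C = (1 + nn (\<iota> n0)) / 2"
  have "C > 0" unfolding C_def nn_def using dot_self_nonneg[of S "\<iota> n0"] by simp
  \<comment> \<open>With \<open>k \<ge> r * C\<close> the deviation of the direction of motion from \<open>- w\<close> is negligible.\<close>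
  obtain k where k: "\<forall>g\<in>A. dist (T (g + h k) x) (T (g + h k) y) < \<epsilon>" "real k \<ge> r * C" "k > 0"
  proof -
    obtain k where "k > nat \<lceil>r * C\<rceil>" "k \<in> {k. \<forall>g\<in>A. dist (T (g + h k) x) (T (g + h k) y) < \<epsilon>}"
      using inf unfolding infinite_nat_iff_unbounded by blast
    moreover from this have "real k \<ge> r * C" by linarith
    ultimately show ?thesis by (intro that) auto
  qed
  define start where "start = (\<lambda>s. real k * \<iota> w s)"
  define dir where "dir = (\<lambda>s. \<iota> n0 s - start s)"
  \<comment> \<open>This many steps make each of them shorter than \<open>1 / r\<close>; compare \<open>nnstep\<close>.\<close>
  obtain M :: nat where M: "real M > r * (1 + nn dir)" using reals_Archimedean2 by blast
  have nndir: "nn dir \<ge> 0" by (simp add: nn_def dot_self_nonneg)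
  have M0: "real M > 0"
    by (rule le_less_trans[OF _ M]) (use r nndir in auto)
  define step where "step = (\<lambda>s. inverse (real M) * dir s)"
  have nnstep: "r\<^sup>2 * nn step \<le> 1"
  proof -
    have "r\<^sup>2 * nn dir \<le> r\<^sup>2 * (1 + nn dir)\<^sup>2"
    proof (rule mult_left_mono)
      have "nn dir \<le> 1 + 2 * nn dir + (nn dir)\<^sup>2" using nndir by (smt (verit) zero_le_power2)
      then show "nn dir \<le> (1 + nn dir)\<^sup>2" by (simp add: power2_sum)
    qed simp
    also have "\<dots> \<le> (real M)\<^sup>2"
      unfolding power_mult_distrib[symmetric] by (rule power_mono) (use M r nndir in auto)
    finally have "r\<^sup>2 * nn dir \<le> (real M)\<^sup>2" .
    then show ?thesis unfolding step_def nn_def dot_scale_self using M0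
      by (simp add: field_simps nn_def)
  qed
  define c where "c = (\<lambda>j s. start s + real j * step s)"
  define Z where "Z = {n. dist (T (lattice_sum S n) x) (T (lattice_sum S n) y) > \<epsilon>}"
  \<comment> \<open>\<open>P j\<close> says that the ball contains a point of separation after \<open>j\<close> steps.\<close>
  define P where "P = (\<lambda>j. \<exists>n\<in>Z. nn (\<lambda>s. \<iota> n s - c j s) < r\<^sup>2)"
  have "\<not> P 0"
  proof
    assume "P 0"
    then obtain n where n: "n \<in> Z" "nn (\<lambda>s. \<iota> n s - c 0 s) < r\<^sup>2" unfolding P_def by blast
    define m where "m = (\<lambda>s. n s - int k * w s)"
    have "(\<lambda>s. \<iota> n s - c 0 s) = \<iota> m"
      by (simp add: fun_eq_iff m_def \<iota>_def c_def start_def)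
    with n(2) have "lattice_sum S m \<in> A" unfolding A_def by auto
    moreover have "lattice_sum S m + h k = lattice_sum S n"
      unfolding m_def h_def lattice_sum_diff by simp
    ultimately show False using k(1) n(1) by (force simp: Z_def)
  qed
  moreover have "P M"
  proof -
    have "(\<lambda>s. \<iota> n0 s - c M s) = (\<lambda>s. 0)"
      using M0 by (simp add: fun_eq_iff c_def step_def dir_def flip: mult.assoc)
    then have "nn (\<lambda>s. \<iota> n0 s - c M s) < r\<^sup>2" using r by (simp add: nn_def dot_def)
    moreover have "n0 \<in> Z" using g0 n0 by (simp add: Z_def)
    ultimately show ?thesis unfolding P_def by blast
  qed
  ultimately obtain j where j: "\<not> P j" "P (Suc j)"
    using nat_induct[of "\<lambda>j. \<not> P j" M] by blast
  then obtain q where q: "q \<in> Z" "nn (\<lambda>s. \<iota> q s - c (Suc j) s) < r\<^sup>2" unfolding P_def by blast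
  \<comment> \<open>\<open>a\<close> and \<open>b\<close> point to \<open>q\<close> from the centres before and after the step.\<close>
  define a where "a = (\<lambda>s. \<iota> q s - c j s)"
  define b where "b = (\<lambda>s. \<iota> q s - c (Suc j) s)"
  have a_b: "a = (\<lambda>s. b s + step s)"
    by (simp add: fun_eq_iff a_def b_def c_def algebra_simps)
  have b_a: "b = (\<lambda>s. a s - step s)" by (simp add: a_b)
  have nna: "nn a \<ge> r\<^sup>2" using j(1) q(1) unfolding P_def a_def by force
  have nnb: "nn b < r\<^sup>2" using q(2) by (simp add: b_def)
  have nnstep0: "nn step \<ge> 0" by (simp add: nn_def dot_self_nonneg)
  have a_step: "dot S a step > 0"
  proof -
    have "nn b = nn a - 2 * dot S a step + nn step"
      unfolding b_a nn_def by (rule dot_diff_self)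
    then show ?thesis using nna nnb nnstep0 by linarith
  qed
  have nna': "nn a < r\<^sup>2 + 3"
  proof -
    \<comment> \<open>The weights \<open>inverse r\<close> and \<open>r\<close> balance the length \<open>r\<close> of \<open>b\<close> against the length \<open>1 / r\<close> of the step.\<close>
    have "0 \<le> dot S (\<lambda>s. inverse r * b s - r * step s) (\<lambda>s. inverse r * b s - r * step s)"
      by (rule dot_self_nonneg)
    also have "\<dots> = (inverse r)\<^sup>2 * nn b - 2 * dot S b step + r\<^sup>2 * nn step"
    proof -
      have "dot S (\<lambda>s. inverse r * b s) (\<lambda>s. r * step s) = dot S b step"
        unfolding dot_def using r by (intro sum.cong) auto
      then show ?thesis unfolding dot_diff_self dot_scale_self nn_def by simp
    qed
    finally have "2 * dot S b step \<le> (inverse r)\<^sup>2 * nn b + r\<^sup>2 * nn step" by simp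
    also have "(inverse r)\<^sup>2 * nn b \<le> (inverse r)\<^sup>2 * r\<^sup>2" using nnb by (intro mult_left_mono) auto
    also have "(inverse r)\<^sup>2 * r\<^sup>2 = 1" using r by (simp add: power_mult_distrib[symmetric])
    finally have 1: "2 * dot S b step \<le> 2" using nnstep by simp
    have "1 * nn step \<le> r\<^sup>2 * nn step" using r nnstep0 by (intro mult_right_mono) auto
    then have 2: "nn step \<le> 1" using nnstep by simp
    have "nn a = nn b + 2 * dot S b step + nn step"
      unfolding a_b nn_def by (rule dot_add_self)
    then show ?thesis using 1 2 nnb by linarith
  qed
  define \<rho> where "\<rho> = sqrt (nn a)"
  have \<rho>: "\<rho> \<ge> r" "\<rho>\<^sup>2 = nn a"
    unfolding \<rho>_def using nna r by (auto intro!: real_le_rsqrt simp: nn_def dot_self_nonneg)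
  then have \<rho>0: "\<rho> > 0" using r by simp
  define u where "u = (\<lambda>s. if s \<in> S then inverse \<rho> * a s else 0)"
  have dot_u: "dot S u v = inverse \<rho> * dot S a v" for v
    unfolding u_def dot_def by (simp add: sum_distrib_left mult.assoc)
  have "dot S u u = 1"
  proof -
    have "dot S a u = inverse \<rho> * nn a" using dot_u[of a] dot_commute[of S a u] by (simp add: nn_def)
    then have "dot S u u = inverse \<rho> * (inverse \<rho> * (\<rho> * \<rho>))"
      using dot_u[of u] \<rho>(2) by (simp add: power2_eq_square)
    also have "\<dots> = 1" using \<rho>0 by (simp add: field_simps)
    finally show ?thesis .
  qed
  moreover have "dot S u (\<iota> w) \<le> 1 / r"
  proof -
    have "0 < dot S a dir" using a_step M0 unfolding step_def dot_scale by (simp add: zero_less_mult_iff)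
    then have "0 < dot S u dir" using dot_u \<rho>0 by simp
    then have "real k * dot S u (\<iota> w) < dot S u (\<iota> n0)"
      unfolding dir_def start_def dot_diff dot_scale by simp
    also have "\<dots> \<le> C"
    proof -
      have "0 \<le> dot S (\<lambda>s. u s - \<iota> n0 s) (\<lambda>s. u s - \<iota> n0 s)" by (rule dot_self_nonneg)
      then show ?thesis unfolding dot_diff_self C_def nn_def using \<open>dot S u u = 1\<close> by simp
    qed
    also have "C \<le> real k / r" using k(2) r by (simp add: field_simps)
    finally have "real k * dot S u (\<iota> w) < real k * (1 / r)" by simp
    then have "dot S u (\<iota> w) < 1 / r"
      by (rule mult_left_less_imp_less) simp
    then show ?thesis by simp
  qed
  moreover have "dist (T (lattice_sum S n) (T (lattice_sum S q) x)) (T (lattice_sum S n) (T (lattice_sum S q) y)) \<le> \<epsilon>"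
    if n: "nn (\<iota> n) + 3 + 2 * r * dot S u (\<iota> n) < 0" for n
  proof (rule ccontr)
    assume no: "\<not> ?thesis"
    define m where "m = (\<lambda>s. n s + q s)"
    have "lattice_sum S m = lattice_sum S n + lattice_sum S q"
      unfolding m_def by (rule lattice_sum_add)
    then have "m \<in> Z" using no by (simp add: Z_def T_add)
    then have "nn (\<lambda>s. \<iota> m s - c j s) \<ge> r\<^sup>2" using j(1) unfolding P_def by force
    moreover have "(\<lambda>s. \<iota> m s - c j s) = (\<lambda>s. \<iota> n s + a s)"
      by (simp add: fun_eq_iff m_def \<iota>_def a_def)
    ultimately have ge: "r\<^sup>2 \<le> nn (\<iota> n) + 2 * dot S (\<iota> n) a + nn a"
      unfolding nn_def dot_add_self[symmetric] by simp
    have dun: "dot S (\<iota> n) a = \<rho> * dot S u (\<iota> n)"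
      unfolding dot_u using \<rho>0 by (simp add: dot_commute)
    have "2 * r * dot S u (\<iota> n) < 0" using n dot_self_nonneg[of S "\<iota> n"] unfolding nn_def by linarith
    then have "dot S u (\<iota> n) \<le> 0" using r by (simp add: mult_less_0_iff)
    then have "\<rho> * dot S u (\<iota> n) \<le> r * dot S u (\<iota> n)" using \<rho>(1) by (intro mult_right_mono_neg)
    then show False using ge nna' n unfolding dun by linarith
  qed
  moreover have "dist (T (lattice_sum S q) x) (T (lattice_sum S q) y) \<ge> \<epsilon>"
    using q(1) by (simp add: Z_def)
  moreover have "\<forall>s. s \<notin> S \<longrightarrow> u s = 0" by (simp add: u_def)
  ultimately show ?thesis unfolding nn_def \<iota>_def by blast
qed

text \<open>
  Let the radius in \<open>approximate_halfspace_pair\<close> tend to infinity.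
\<close>

lemma halfspace_toward:
  fixes w :: "'g \<Rightarrow> int"
  shows "\<exists>u\<in>nonexpansive_normals. dot S u (\<lambda>s. of_int (w s)) \<le> 0"
proof -
  define R where "R = (\<lambda>i u x y. (\<forall>s. s \<notin> S \<longrightarrow> u s = 0) \<and> dot S u u = 1 \<and> dist x y \<ge> \<epsilon> \<and>
    dot S u (\<lambda>s. of_int (w s)) \<le> 1 / real (Suc i) \<and>
    (\<forall>n. dot S (\<lambda>s. of_int (n s)) (\<lambda>s. of_int (n s)) + 3 + 2 * real (Suc i) * dot S u (\<lambda>s. of_int (n s)) < 0 \<longrightarrow>
       dist (T (lattice_sum S n) x) (T (lattice_sum S n) y) \<le> \<epsilon>))"
  have "\<exists>u x y. R i u x y" for i
    unfolding R_def by (rule approximate_halfspace_pair) simp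
  then obtain u x y where "\<And>i. R i (u i) (x i) (y i)" by metis
  then have supp: "\<And>i s. s \<notin> S \<Longrightarrow> u i s = 0" and unit: "\<And>i. dot S (u i) (u i) = 1"
    and sep: "\<And>i. dist (x i) (y i) \<ge> \<epsilon>"
    and le: "\<And>i. dot S (u i) (\<lambda>s. of_int (w s)) \<le> 1 / real (Suc i)"
    and close: "\<And>i n. dot S (\<lambda>s. of_int (n s)) (\<lambda>s. of_int (n s)) + 3
        + 2 * real (Suc i) * dot S (u i) (\<lambda>s. of_int (n s)) < 0 \<Longrightarrow>
       dist (T (lattice_sum S n) (x i)) (T (lattice_sum S n) (y i)) \<le> \<epsilon>"
    unfolding R_def by auto
  have "compact ({u :: 'g \<Rightarrow> real. \<forall>s. \<bar>u s\<bar> \<le> 1} \<times> (UNIV :: 'x set) \<times> (UNIV :: 'x set))"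
    by (intro compact_Times compact_space) (rule compact_box)
  moreover have "\<forall>\<^sub>F i in sequentially. (u i, x i, y i) \<in> {u. \<forall>s. \<bar>u s\<bar> \<le> 1} \<times> UNIV \<times> UNIV"
    using unit_le_1 supp unit by auto
  ultimately obtain q G where q: "G \<le> sequentially" "G \<noteq> bot" "((\<lambda>i. (u i, x i, y i)) \<longlongrightarrow> q) G"
    by (elim compact_cluster_filter[OF _ sequentially_bot]) auto
  have lim: "(u \<longlongrightarrow> fst q) G" "(x \<longlongrightarrow> fst (snd q)) G" "(y \<longlongrightarrow> snd (snd q)) G"
    using tendsto_fst[OF q(3)] tendsto_fst[OF tendsto_snd[OF q(3)]] tendsto_snd[OF tendsto_snd[OF q(3)]]
    by simp_all
  have inv: "((\<lambda>i. c / real (Suc i)) \<longlongrightarrow> 0) G" for c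
    by (rule tendsto_mono[OF q(1) LIMSEQ_Suc[OF lim_const_over_n]])
  have "fst q \<in> nonexpansive_normals"
  proof (rule limit_in_nonexpansive_normals[OF q(2) lim supp])
    show "\<forall>\<^sub>F i in G. dot S (u i) (u i) = 1" "\<forall>\<^sub>F i in G. dist (x i) (y i) \<ge> \<epsilon>"
      by (simp_all add: unit sep)
    fix n assume n: "dot S (fst q) (\<lambda>s. real_of_int (n s)) < 0"
    define N where "N = dot S (\<lambda>s. real_of_int (n s)) (\<lambda>s. of_int (n s)) + 3"
    have "((\<lambda>i. (N / 2) / real (Suc i) + dot S (u i) (\<lambda>s. of_int (n s))) \<longlongrightarrow>
        0 + dot S (fst q) (\<lambda>s. of_int (n s))) G"
      by (rule tendsto_add[OF inv tendsto_dot[OF lim(1) tendsto_const]])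
    then have "\<forall>\<^sub>F i in G. (N / 2) / real (Suc i) + dot S (u i) (\<lambda>s. of_int (n s)) < 0"
      by (rule order_tendstoD(2)) (use n in simp)
    then show "\<forall>\<^sub>F i in G. dist (T (lattice_sum S n) (x i)) (T (lattice_sum S n) (y i)) \<le> \<epsilon>"
    proof eventually_elim
      case (elim i)
      have "2 * real (Suc i) * ((N / 2) / real (Suc i) + dot S (u i) (\<lambda>s. of_int (n s))) < 0"
        using elim by (intro mult_pos_neg) auto
      moreover have "2 * real (Suc i) * ((N / 2) / real (Suc i) + dot S (u i) (\<lambda>s. of_int (n s))) =
          N + 2 * real (Suc i) * dot S (u i) (\<lambda>s. of_int (n s))"
        by (simp add: distrib_left del: of_nat_Suc)
      ultimately have "N + 2 * real (Suc i) * dot S (u i) (\<lambda>s. of_int (n s)) < 0" by simp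
      then show ?case unfolding N_def by (rule close)
    qed
  qed
  moreover have "dot S (fst q) (\<lambda>s. of_int (w s)) \<le> 0"
    by (rule tendsto_le[OF q(2) inv[of 1] tendsto_dot[OF lim(1) tendsto_const]])
      (rule always_eventually, rule allI, rule le)
  ultimately show ?thesis by blast
qed

text \<open>
  Adding a large multiple of a relation \<open>m\<close> or of its negative moves any lattice point into the
  half-space without changing the group element it represents. If the normal did not vanish on \<open>m\<close>,
  the pair would be close everywhere, against expansiveness.
\<close>

lemma halfspace_normal_vanishes_on_relations:
  assumes "halfspace_pair u x y" "lattice_sum S m = 0"
  shows "dot S u (\<lambda>s. of_int (m s)) = 0"
proof (rule ccontr)
  assume "\<not> ?thesis"
  moreover have neg: "\<not> dot S u (\<lambda>s. of_int (m s)) < 0" if m: "lattice_sum S m = 0" for m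
  proof
    assume neg: "dot S u (\<lambda>s. of_int (m s)) < 0"
    have "dist (T g x) (T g y) \<le> \<epsilon>" for g
    proof -
      obtain n where n: "lattice_sum S n = g" using surj_lattice by blast
      obtain k :: nat where k: "dot S u (\<lambda>s. of_int (n s)) < real k * (- dot S u (\<lambda>s. of_int (m s)))"
        using ex_less_of_nat_mult[of "- dot S u (\<lambda>s. of_int (m s))"] neg by auto
      have "lattice_sum S (\<lambda>s. int j * m s) = 0" for j
      proof (induction j)
        case (Suc j)
        have "(\<lambda>s. int (Suc j) * m s) = (\<lambda>s. int j * m s + m s)" by (simp add: fun_eq_iff algebra_simps)
        then show ?case using Suc m by (simp add: lattice_sum_add)
      qed (simp add: lattice_sum_zero)
      then have g: "lattice_sum S (\<lambda>s. n s + int k * m s) = g"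
        using n by (simp add: lattice_sum_add)
      have "dot S u (\<lambda>s. of_int (n s + int k * m s)) < 0"
        using k by (simp add: dot_add dot_scale)
      then show ?thesis using assms(1) g unfolding halfspace_pair_def by metis
    qed
    then have "x = y" using expansive[of x y] by (meson not_less)
    then show False using assms(1) \<epsilon>_pos by (simp add: halfspace_pair_def)
  qed
  ultimately have "dot S u (\<lambda>s. of_int (m s)) > 0" using assms(2) by fastforce
  moreover have "lattice_sum S (\<lambda>s. 0 - m s) = 0"
    using assms(2) by (simp add: lattice_sum_diff lattice_sum_zero del: diff_0)
  from neg[OF this] have "\<not> dot S u (\<lambda>s. - of_int (m s)) < 0" by simp
  then have "\<not> - dot S u (\<lambda>s. of_int (m s)) < 0"
    by (simp add: dot_def sum_negf)
  ultimately show False by simp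
qed

text \<open>
  By \<open>halfspace_toward\<close> no integer vector is positive on all nonexpansive normals, hence neither is a
  real one, and \<open>positive_along_filter_imp_positive\<close> provides a normal \<open>u\<close> for which the group
  elements with nonpositive value have positive upper density. As \<open>u\<close> vanishes on relations, it
  induces an additive function \<open>\<phi>\<close> on the group. Translating by an element on which \<open>\<phi>\<close> is very
  negative yields sets of comparable density that lie deep in the half-space of closeness, where
  uniform expansiveness applies.
\<close>

theorem weakly_asymptotic_pair_if_expansive:
  assumes F: "folner_sequence F"
  shows "\<exists>x y. weakly_asymptotic_pair F T x y"
proof -
  have fin: "finite (F n)" "F n \<noteq> {}" for n using F by (auto simp: folner_sequence_def)
  obtain \<sigma> where \<sigma>: "\<And>g. lattice_sum S (\<sigma> g) = g" using surj_lattice by metis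
  have "\<exists>u\<in>nonexpansive_normals. \<not> (\<forall>\<^sub>F g in density_one_filter F. dot S u (\<lambda>s. of_int (\<sigma> g s)) > 0)"
  proof (rule ccontr)
    assume "\<not> ?thesis"
    then have "\<And>u. u \<in> nonexpansive_normals \<Longrightarrow> \<forall>\<^sub>F g in density_one_filter F. dot S u (\<lambda>s. of_int (\<sigma> g s)) > 0"
      by blast
    from positive_along_filter_imp_positive[OF finite_S compact_nonexpansive_normals
        density_one_filter_neq_bot[OF fin] this]
    obtain v where "\<forall>u\<in>nonexpansive_normals. dot S u v > 0" by blast
    from positive_imp_integer_positive[OF finite_S compact_nonexpansive_normals this]
    obtain w :: "'g \<Rightarrow> int" where "\<forall>u\<in>nonexpansive_normals. dot S u (\<lambda>s. of_int (w s)) > 0" by blast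
    with halfspace_toward[of w] show False by (meson not_less)
  qed
  then obtain u where u: "u \<in> nonexpansive_normals"
    "\<not> proportion F {g. \<not> dot S u (\<lambda>s. of_int (\<sigma> g s)) > 0} \<longlonglongrightarrow> 0"
    unfolding eventually_density_one_filter[OF fin(1)] by blast
  then obtain x y where pair: "halfspace_pair u x y" and unit: "dot S u u = 1"
    by (auto simp: nonexpansive_normals_def)
  define \<phi> where "\<phi> = (\<lambda>g. dot S u (\<lambda>s. of_int (\<sigma> g s)))"
  have \<phi>: "\<phi> (lattice_sum S n) = dot S u (\<lambda>s. of_int (n s))" for n
  proof -
    have "lattice_sum S (\<lambda>s. \<sigma> (lattice_sum S n) s - n s) = 0" by (simp add: lattice_sum_diff \<sigma>)
    from halfspace_normal_vanishes_on_relations[OF pair this]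
    show ?thesis by (simp add: \<phi>_def dot_diff)
  qed
  have \<phi>_add: "\<phi> (g + h) = \<phi> g + \<phi> h" for g h
  proof -
    have "\<phi> (lattice_sum S (\<lambda>s. \<sigma> g s + \<sigma> h s)) = \<phi> g + \<phi> h"
      unfolding \<phi> by (simp add: dot_add \<phi>_def)
    then show ?thesis by (simp add: lattice_sum_add \<sigma>)
  qed
  have close: "dist (T g x) (T g y) \<le> \<epsilon>" if "\<phi> g < 0" for g
    using pair that \<sigma>[of g] unfolding halfspace_pair_def \<phi>_def by metis
  have unbounded: "\<exists>t. \<phi> t < - R" for R
  proof -
    obtain w :: "'g \<Rightarrow> int" where w: "dot S u (\<lambda>s. of_int (w s)) > 0"
    proof -
      have "finite {u}" by simp
      then have "compact {u}" by (rule finite_imp_compact)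
      from positive_imp_integer_positive[OF finite_S this, of u] unit that show ?thesis by auto
    qed
    obtain k :: nat where "R < real k * dot S u (\<lambda>s. of_int (w s))"
      using ex_less_of_nat_mult[OF w] by blast
    moreover have "\<phi> (lattice_sum S (\<lambda>s. - int k * w s)) = - (real k * dot S u (\<lambda>s. of_int (w s)))"
      unfolding \<phi> by (simp add: dot_scale[of S u "- real k", simplified])
    ultimately show ?thesis by (intro exI[of _ "lattice_sum S (\<lambda>s. - int k * w s)"]) simp
  qed
  define H where "H = {g. \<not> \<phi> g > 0}"
  obtain c where c: "0 < c" "\<exists>\<^sub>F n in sequentially. proportion F H n \<ge> c"
    using not_tendsto_0_imp_frequently[OF proportion_nonneg u(2)] unfolding H_def \<phi>_def by blast
  have "weakly_asymptotic_pair F T x y"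
  proof (rule weakly_asymptotic_pairI[OF fin(1)])
    show "x \<noteq> y" using pair \<epsilon>_pos by (auto simp: halfspace_pair_def)
    show "0 < c / 2" using c by simp
    fix \<delta> :: real assume "0 < \<delta>"
    then obtain A where A: "finite A" "\<And>x y. (\<forall>g\<in>A. dist (T g x) (T g y) \<le> \<epsilon>) \<Longrightarrow> dist x y < \<delta>"
      using uniformly_expansive by meson
    obtain t where t: "\<phi> t < - (\<Sum>k\<in>A. \<bar>\<phi> k\<bar>)" using unbounded by blast
    have sub: "(+) t ` H \<subseteq> {g. dist (T g x) (T g y) < \<delta>}"
    proof clarify
      fix g assume "g \<in> H"
      show "dist (T (t + g) x) (T (t + g) y) < \<delta>"
      proof (rule A(2), rule ballI)
        fix k assume "k \<in> A"
        then have "\<bar>\<phi> k\<bar> \<le> (\<Sum>k\<in>A. \<bar>\<phi> k\<bar>)" using A(1) by (intro member_le_sum) auto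
        then have "\<phi> (k + (t + g)) < 0" using t \<open>g \<in> H\<close> unfolding \<phi>_add H_def by simp
        from close[OF this] show "dist (T k (T (t + g) x)) (T k (T (t + g) y)) \<le> \<epsilon>"
          by (simp only: T_add)
      qed
    qed
    show "\<exists>\<^sub>F n in sequentially. proportion F {g. dist (T g x) (T g y) < \<delta>} n \<ge> c / 2"
    proof (rule frequently_elim1[OF frequently_proportion_translate[OF F c, of t]])
      fix n assume "c / 2 \<le> proportion F ((+) t ` H) n"
      also have "\<dots> \<le> proportion F {g. dist (T g x) (T g y) < \<delta>} n"
        by (rule proportion_mono[OF fin(1)]) (use sub in blast)
      finally show "c / 2 \<le> proportion F {g. dist (T g x) (T g y) < \<delta>} n" .
    qed
  qed
  then show ?thesis by blast
qed

end

section \<open>Extreme points of compact sets of functions\<close>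

text \<open>
  The candidates in the search for extreme points: extremal subsets, cut out by closed sets so that
  compactness applies to chains of them.
\<close>

definition is_face :: "('i \<Rightarrow> real) set \<Rightarrow> ('i \<Rightarrow> real) set \<Rightarrow> bool" where
  "is_face P Q \<longleftrightarrow> Q \<noteq> {} \<and> (\<exists>C. closed C \<and> Q = P \<inter> C) \<and>
     (\<forall>p\<in>Q. \<forall>q\<in>P. \<forall>r\<in>P. \<forall>t. 0 < t \<and> t < 1 \<and> (\<forall>j. p j = t * q j + (1 - t) * r j) \<longrightarrow> q \<in> Q \<and> r \<in> Q)"

lemma is_faceD:
  assumes "is_face P Q"
  shows "Q \<noteq> {}" "\<exists>C. closed C \<and> Q = P \<inter> C"
    "p \<in> Q \<Longrightarrow> q \<in> P \<Longrightarrow> r \<in> P \<Longrightarrow> 0 < t \<Longrightarrow> t < 1 \<Longrightarrow> (\<And>j. p j = t * q j + (1 - t) * r j) \<Longrightarrow> q \<in> Q \<and> r \<in> Q"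
  using assms unfolding is_face_def by blast+

lemma is_face_maximizers:
  assumes P: "compact P" and Q: "is_face P Q"
  shows "is_face P {p \<in> Q. \<forall>q\<in>Q. q i \<le> p i}"
proof -
  obtain C where C: "closed C" "Q = P \<inter> C" using is_faceD(2)[OF Q] by blast
  have cont: "continuous_on A (\<lambda>p. p i)" for A :: "('a \<Rightarrow> real) set"
    by (rule continuous_on_subset[OF continuous_on_product_coordinates]) simp
  have "compact Q" using C P by (simp add: compact_Int_closed)
  then have "compact ((\<lambda>p. p i) ` Q)" by (rule compact_continuous_image[OF cont])
  moreover have "(\<lambda>p. p i) ` Q \<noteq> {}" using is_faceD(1)[OF Q] by simp
  ultimately obtain p0 where p0: "p0 \<in> Q" "\<And>q. q \<in> Q \<Longrightarrow> q i \<le> p0 i"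
  proof -
    assume "compact ((\<lambda>p. p i) ` Q)" "(\<lambda>p. p i) ` Q \<noteq> {}"
    from compact_attains_sup[OF this] obtain p0 where "p0 \<in> Q" "\<forall>m\<in>(\<lambda>p. p i) ` Q. m \<le> p0 i"
      by blast
    then show ?thesis by (intro that[of p0]) auto
  qed
  have eq: "{p \<in> Q. \<forall>q\<in>Q. q i \<le> p i} = P \<inter> (C \<inter> {p. p0 i \<le> p i})"
    using p0 C(2) by (auto intro: order_trans)
  show ?thesis unfolding is_face_def
  proof (intro conjI ballI allI impI)
    show "{p \<in> Q. \<forall>q\<in>Q. q i \<le> p i} \<noteq> {}" using p0 by blast
    show "\<exists>C. closed C \<and> {p \<in> Q. \<forall>q\<in>Q. q i \<le> p i} = P \<inter> C"
      using eq C(1) by (intro exI[of _ "C \<inter> {p. p0 i \<le> p i}"] conjI closed_Int closed_Collect_le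
          continuous_on_const cont)
    fix p q r t
    assume p: "p \<in> {p \<in> Q. \<forall>q\<in>Q. q i \<le> p i}" and qr: "q \<in> P" "r \<in> P"
      and t: "0 < t \<and> t < 1 \<and> (\<forall>j. p j = t * q j + (1 - t) * r j)"
    then have Qqr: "q \<in> Q" "r \<in> Q" using is_faceD(3)[OF Q, of p q r t] by auto
    have le: "q i \<le> p i" "r i \<le> p i" using p Qqr by auto
    have eqp: "p i = t * q i + (1 - t) * r i" using t by blast
    have "t * q i \<le> t * p i" "(1 - t) * r i \<le> (1 - t) * p i" using le t by (auto intro: mult_left_mono)
    moreover have "t * p i + (1 - t) * p i = p i" by (simp add: algebra_simps)
    ultimately have "t * q i = t * p i" "(1 - t) * r i = (1 - t) * p i" using eqp by linarith+
    moreover have "t \<noteq> 0" "1 - t \<noteq> 0" using t by simp_all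
    ultimately have "q i = p i" "r i = p i" by (metis mult_left_cancel)+
    then show "q \<in> {p \<in> Q. \<forall>q\<in>Q. q i \<le> p i}" "r \<in> {p \<in> Q. \<forall>q\<in>Q. q i \<le> p i}"
      using p Qqr by auto
  qed
qed

lemma chain_finite_has_least:
  assumes "finite I" "I \<noteq> {}" "\<And>A B. A \<in> I \<Longrightarrow> B \<in> I \<Longrightarrow> A \<subseteq> B \<or> B \<subseteq> A"
  shows "\<exists>A\<in>I. \<forall>B\<in>I. A \<subseteq> B"
  using assms
proof (induction rule: finite_ne_induct)
  case (insert B I)
  then obtain A where A: "A \<in> I" "\<forall>B\<in>I. A \<subseteq> B" by (metis insertCI)
  with insert.prems[of A B] show ?case by blast
qed simp

text \<open>
  Compactness keeps the intersection from being empty.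
\<close>

lemma is_face_Inter_chain:
  assumes P: "compact P" and ne: "\<Q> \<noteq> {}" and face: "\<And>Q. Q \<in> \<Q> \<Longrightarrow> is_face P Q"
    and chain: "\<And>A B. A \<in> \<Q> \<Longrightarrow> B \<in> \<Q> \<Longrightarrow> A \<subseteq> B \<or> B \<subseteq> A"
  shows "is_face P (\<Inter>\<Q>)"
proof -
  have "\<exists>C. closed C \<and> Q = P \<inter> C" if "Q \<in> \<Q>" for Q using face[OF that] by (rule is_faceD(2))
  then obtain C where C: "\<And>Q. Q \<in> \<Q> \<Longrightarrow> closed (C Q)" "\<And>Q. Q \<in> \<Q> \<Longrightarrow> Q = P \<inter> C Q" by metis
  have eq: "P \<inter> (\<Inter>Q\<in>\<R>. C Q) = \<Inter>\<R>" if "\<R> \<subseteq> \<Q>" "\<R> \<noteq> {}" for \<R>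
    using C(2) that by blast
  have "P \<inter> (\<Inter>Q\<in>\<Q>. C Q) \<noteq> {}"
  proof (rule compact_imp_fip_image[OF P C(1)])
    fix I assume I: "finite I" "I \<subseteq> \<Q>"
    show "P \<inter> (\<Inter>Q\<in>I. C Q) \<noteq> {}"
    proof (cases "I = {}")
      case True
      obtain Q where "Q \<in> \<Q>" using ne by blast
      then have "P \<noteq> {}" using is_faceD(1,2)[OF face[of Q]] by blast
      then show ?thesis using True by simp
    next
      case False
      obtain A where A: "A \<in> I" "\<forall>B\<in>I. A \<subseteq> B"
        using chain_finite_has_least[OF I(1) False] chain I(2) by (metis subsetD)
      have "A \<noteq> {}" using is_faceD(1)[OF face[of A]] A(1) I(2) by blast
      moreover have "A \<subseteq> \<Inter>I" using A(2) by blast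
      ultimately show ?thesis using eq[OF I(2) False] by auto
    qed
  qed
  then have "\<Inter>\<Q> \<noteq> {}" using eq[OF subset_refl ne] by simp
  moreover have "closed (\<Inter>Q\<in>\<Q>. C Q)" using C(1) by (intro closed_INT) auto
  moreover have "\<forall>p\<in>\<Inter>\<Q>. \<forall>q\<in>P. \<forall>r\<in>P. \<forall>t. 0 < t \<and> t < 1 \<and> (\<forall>j. p j = t * q j + (1 - t) * r j)
      \<longrightarrow> q \<in> \<Inter>\<Q> \<and> r \<in> \<Inter>\<Q>"
  proof (intro ballI allI impI)
    fix p q r t assume *: "p \<in> \<Inter>\<Q>" "q \<in> P" "r \<in> P"
      "0 < t \<and> t < 1 \<and> (\<forall>j. p j = t * q j + (1 - t) * r j)"
    have "q \<in> Q \<and> r \<in> Q" if "Q \<in> \<Q>" for Q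
    proof -
      have "p \<in> Q" using *(1) that by blast
      then show ?thesis using is_faceD(3)[OF face[OF that], of p q r t] *(2-) by blast
    qed
    then show "q \<in> \<Inter>\<Q> \<and> r \<in> \<Inter>\<Q>" by blast
  qed
  ultimately show ?thesis unfolding is_face_def using eq[OF subset_refl ne, symmetric] by (intro conjI exI)
qed

text \<open>
  The argument of Krein and Milman, begun at the face on which the coordinate \<open>i\<close> is maximal. In a
  minimal face below it, maximising a coordinate \<open>j\<close> cannot lead to a smaller face, so each
  coordinate is constant on it, and the minimal face is a single point.
\<close>

lemma extreme_maximizer:
  fixes P :: "('i \<Rightarrow> real) set"
  assumes P: "compact P" "P \<noteq> {}"
  obtains p where "p \<in> P" "\<And>q. q \<in> P \<Longrightarrow> q i \<le> p i"
    "\<And>q r t. q \<in> P \<Longrightarrow> r \<in> P \<Longrightarrow> 0 < t \<Longrightarrow> t < 1 \<Longrightarrow> (\<And>j. p j = t * q j + (1 - t) * r j) \<Longrightarrow> q = p \<and> r = p"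
proof -
  define Q0 where "Q0 = {p \<in> P. \<forall>q\<in>P. q i \<le> p i}"
  have "is_face P P" unfolding is_face_def using P(2) by (auto intro: exI[of _ UNIV])
  then have Q0: "is_face P Q0" unfolding Q0_def by (rule is_face_maximizers[OF P(1)])
  \<comment> \<open>Passing to complements turns the search for a minimal face into one for a maximal set, as required by Zorn's lemma.\<close>
  define \<A> where "\<A> = {- Q | Q. is_face P Q \<and> Q \<subseteq> Q0}"
  have "\<exists>M\<in>\<A>. \<forall>X\<in>\<A>. M \<subseteq> X \<longrightarrow> X = M"
  proof (rule subset_Zorn_nonempty)
    show "\<A> \<noteq> {}" using Q0 by (auto simp: \<A>_def)
    fix \<C> assume \<C>: "\<C> \<noteq> {}" "subset.chain \<A> \<C>"
    define \<Q> where "\<Q> = uminus ` \<C>"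
    have sub: "\<C> \<subseteq> \<A>" and ch: "\<And>A B. A \<in> \<C> \<Longrightarrow> B \<in> \<C> \<Longrightarrow> A \<subseteq> B \<or> B \<subseteq> A"
      using \<C>(2) by (auto simp: subset_chain_def)
    have 1: "is_face P Q \<and> Q \<subseteq> Q0" if "Q \<in> \<Q>" for Q using that sub by (auto simp: \<Q>_def \<A>_def)
    have "is_face P (\<Inter>\<Q>)"
    proof (rule is_face_Inter_chain[OF P(1)])
      show "\<Q> \<noteq> {}" using \<C>(1) by (simp add: \<Q>_def)
      show "A \<subseteq> B \<or> B \<subseteq> A" if "A \<in> \<Q>" "B \<in> \<Q>" for A B
        using that ch by (auto simp: \<Q>_def)
    qed (use 1 in blast)
    moreover have "\<Inter>\<Q> \<subseteq> Q0" using 1 \<C>(1) by (auto simp: \<Q>_def)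
    moreover have "\<Union>\<C> = - \<Inter>\<Q>" by (auto simp: \<Q>_def)
    ultimately show "\<Union>\<C> \<in> \<A>" unfolding \<A>_def by blast
  qed
  then obtain M where M: "M \<in> \<A>" "\<And>X. X \<in> \<A> \<Longrightarrow> M \<subseteq> X \<Longrightarrow> X = M" by metis
  define Q where "Q = - M"
  have Q: "is_face P Q" "Q \<subseteq> Q0" using M(1) by (auto simp: \<A>_def Q_def)
  have min: "Q' = Q" if Q': "is_face P Q'" "Q' \<subseteq> Q" for Q'
  proof -
    have "- Q' \<in> \<A>" using Q' Q(2) unfolding \<A>_def by blast
    moreover have "M \<subseteq> - Q'" using Q'(2) by (auto simp: Q_def)
    ultimately have "- Q' = M" by (rule M(2))
    then show ?thesis by (auto simp: Q_def)
  qed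
  obtain p where p: "p \<in> Q" using is_faceD(1)[OF Q(1)] by blast
  have single: "q = p" if "q \<in> Q" for q
  proof
    fix j
    have "{p \<in> Q. \<forall>q\<in>Q. q j \<le> p j} = Q"
      by (rule min[OF is_face_maximizers[OF P(1) Q(1)]]) blast
    then have "\<And>a b. a \<in> Q \<Longrightarrow> b \<in> Q \<Longrightarrow> b j \<le> a j" by blast
    from this[OF p that] this[OF that p] show "q j = p j" by simp
  qed
  show ?thesis
  proof (rule that)
    show "p \<in> P" using p Q(2) by (auto simp: Q0_def)
    show "q i \<le> p i" if "q \<in> P" for q using p Q(2) that by (auto simp: Q0_def)
    show "q = p \<and> r = p" if "q \<in> P" "r \<in> P" "0 < t" "t < 1" "\<And>j. p j = t * q j + (1 - t) * r j" for q r t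
    proof -
      have "q \<in> Q \<and> r \<in> Q" by (rule is_faceD(3)[OF Q(1) p that])
      then show ?thesis using single by simp
    qed
  qed
qed

section \<open>The Riesz representation of a state\<close>

abbreviation cont :: "('y::topological_space \<Rightarrow> real) \<Rightarrow> bool" where
  "cont f \<equiv> continuous_on UNIV f"

text \<open>
  A positive normalised functional on the continuous functions of a compact metric space. It accepts
  arbitrary real functions as arguments, but only its values at continuous ones are constrained.
\<close>

locale state =
  fixes \<Lambda> :: "('y::metric_space \<Rightarrow> real) \<Rightarrow> real"
  assumes compact_space: "compact (UNIV :: 'y set)"
    and add: "cont f \<Longrightarrow> cont g \<Longrightarrow> \<Lambda> (\<lambda>x. f x + g x) = \<Lambda> f + \<Lambda> g"
    and scale: "cont f \<Longrightarrow> \<Lambda> (\<lambda>x. c * f x) = c * \<Lambda> f"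
    and nonneg: "cont f \<Longrightarrow> (\<And>x. 0 \<le> f x) \<Longrightarrow> 0 \<le> \<Lambda> f"
    and one: "\<Lambda> (\<lambda>_. 1) = 1"

text \<open>
  Continuous functions increasing to the indicator function of an open set. The distance to the empty
  set is zero by convention, so the whole space has to be treated separately.
\<close>

definition ramp :: "'y::metric_space set \<Rightarrow> nat \<Rightarrow> 'y \<Rightarrow> real" where
  "ramp U n x = (if U = UNIV then 1 else min 1 (real n * infdist x (- U)))"

lemma cont_ramp: "cont (ramp U n)"
  unfolding ramp_def by (cases "U = UNIV") (auto intro!: continuous_intros)

lemma ramp_bounds: "0 \<le> ramp U n x" "ramp U n x \<le> 1"
  by (auto simp: ramp_def infdist_nonneg)

lemma ramp_outside: "x \<notin> U \<Longrightarrow> ramp U n x = 0"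
  by (auto simp: ramp_def)

lemma ramp_mono:
  assumes "m \<le> n" shows "ramp U m x \<le> ramp U n x"
proof -
  have "real m * infdist x (- U) \<le> real n * infdist x (- U)"
    using assms by (intro mult_right_mono) (auto simp: infdist_nonneg)
  then show ?thesis by (auto simp: ramp_def)
qed

lemma eventually_ramp_eq_1:
  assumes "open U" "x \<in> U"
  obtains N where "\<And>n. n \<ge> N \<Longrightarrow> ramp U n x = 1"
proof (cases "U = UNIV")
  case True
  then show ?thesis by (intro that[of 0]) (simp add: ramp_def)
next
  case False
  have "infdist x (- U) \<noteq> 0"
    using in_closed_iff_infdist_zero[of "- U" x] assms False by auto
  then have pos: "infdist x (- U) > 0" using infdist_nonneg[of x "- U"] by linarith
  obtain N where N: "1 < real N * infdist x (- U)" using reals_Archimedean3[OF pos] by blast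
  show ?thesis
  proof (rule that)
    fix n assume "n \<ge> N"
    then have "real N * infdist x (- U) \<le> real n * infdist x (- U)"
      using pos by (intro mult_right_mono) auto
    then show "ramp U n x = 1" using N False by (simp add: ramp_def)
  qed
qed

lemma ramp_tendsto_indicator:
  assumes "open U" shows "(\<lambda>n. ramp U n x) \<longlonglongrightarrow> indicator U x"
proof (cases "x \<in> U")
  case True
  obtain N where "\<And>n. n \<ge> N \<Longrightarrow> ramp U n x = 1" by (rule eventually_ramp_eq_1[OF assms True]) blast
  then have "\<forall>\<^sub>F n in sequentially. ramp U n x = 1" by (auto simp: eventually_sequentially)
  then show ?thesis using True by (simp add: tendsto_eventually)
qed (simp add: ramp_outside)

text \<open>
  Integrals of ramps determine the measures of open sets.
\<close>

lemma borel_measure_eqI: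
  fixes M N :: "'y::metric_space measure"
  assumes M: "finite_measure M" "sets M = sets borel" and N: "finite_measure N" "sets N = sets borel"
    and eq: "\<And>f. cont f \<Longrightarrow> (\<And>x. 0 \<le> f x) \<Longrightarrow> (\<And>x. f x \<le> 1) \<Longrightarrow> integral\<^sup>L M f = integral\<^sup>L N f"
  shows "M = N"
proof -
  have lim: "(\<lambda>n. integral\<^sup>L K (ramp U n)) \<longlonglongrightarrow> measure K U"
    if K: "finite_measure K" "sets K = sets borel" and U: "open U" for K and U :: "'y set"
  proof -
    interpret finite_measure K by (rule K(1))
    have U': "U \<in> sets K" using U K(2) by simp
    have "(\<lambda>n. integral\<^sup>L K (ramp U n)) \<longlonglongrightarrow> integral\<^sup>L K (indicator U)"
    proof (rule integral_dominated_convergence[where w = "\<lambda>_. 1"])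
      show "(indicator U :: 'y \<Rightarrow> real) \<in> borel_measurable K" using U' by simp
      show "ramp U n \<in> borel_measurable K" for n
        unfolding measurable_cong_sets[OF K(2) refl] by (rule borel_measurable_continuous_onI[OF cont_ramp])
      show "AE x in K. (\<lambda>n. ramp U n x) \<longlonglongrightarrow> indicator U x"
        by (simp add: ramp_tendsto_indicator[OF U])
      show "AE x in K. norm (ramp U n x) \<le> 1" for n
        by (simp add: ramp_bounds abs_of_nonneg)
    qed simp
    then show ?thesis using U' by simp
  qed
  have open_eq: "emeasure M U = emeasure N U" if U: "open U" for U
  proof -
    have "measure M U = measure N U"
      using LIMSEQ_unique[OF lim[OF M U]] lim[OF N U] eq[OF cont_ramp ramp_bounds(1) ramp_bounds(2), of U] by simp
    then show ?thesis
      using M(1) N(1) by (simp add: finite_measure.emeasure_eq_measure)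
  qed
  have sets_eq: "sets (borel :: 'y measure) = sigma_sets UNIV {S. open S}"
    by (simp add: borel_def)
  show ?thesis
  proof (rule measure_eqI_generator_eq[where E = "{S. open S}" and \<Omega> = UNIV and A = "\<lambda>_. UNIV"])
    show "Int_stable {S :: 'y set. open S}" by (auto simp: Int_stable_def)
    show "emeasure M UNIV \<noteq> \<infinity>" using finite_measure.emeasure_finite[OF M(1)] by simp
  qed (use M N sets_eq open_eq in auto)
qed

context state
begin

lemma minus: "cont f \<Longrightarrow> \<Lambda> (\<lambda>x. - f x) = - \<Lambda> f"
  using scale[of f "- 1"] by simp

lemma diff: "cont f \<Longrightarrow> cont g \<Longrightarrow> \<Lambda> (\<lambda>x. f x - g x) = \<Lambda> f - \<Lambda> g"
  using add[of f "\<lambda>x. - g x"] minus[of g] by (simp add: continuous_on_minus)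

lemma mono:
  assumes "cont f" "cont g" "\<And>x. f x \<le> g x" shows "\<Lambda> f \<le> \<Lambda> g"
  using nonneg[of "\<lambda>x. g x - f x"] diff[of g f] assms by (simp add: continuous_on_diff)

lemma const: "\<Lambda> (\<lambda>_. c) = c"
  using scale[of "\<lambda>_. 1" c] one by simp

lemma sum: "(\<And>i. i \<in> I \<Longrightarrow> cont (f i)) \<Longrightarrow> \<Lambda> (\<lambda>x. \<Sum>i\<in>I. f i x) = (\<Sum>i\<in>I. \<Lambda> (f i))"
proof (induction I rule: infinite_finite_induct)
  case (insert i I)
  then show ?case using add[of "f i" "\<lambda>x. \<Sum>i\<in>I. f i x"] by (simp add: continuous_on_sum)
qed (use const[of 0] in simp_all)

definition below :: "'y set \<Rightarrow> ('y \<Rightarrow> real) set" where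
  "below U = {f. cont f \<and> (\<forall>x. 0 \<le> f x \<and> f x \<le> indicator U x)}"

lemma belowD:
  assumes "f \<in> below U"
  shows "cont f" "0 \<le> f x" "f x \<le> 1" "x \<notin> U \<Longrightarrow> f x = 0" "0 \<le> \<Lambda> f"
proof -
  show c: "cont f" and n: "0 \<le> f x" for x using assms by (auto simp: below_def)
  show "f x \<le> 1" using assms unfolding below_def by (smt (verit) indicator_le_1 mem_Collect_eq)
  show "f x = 0" if "x \<notin> U"
    using assms that unfolding below_def by (metis (mono_tags, lifting) antisym indicator_simps(2) mem_Collect_eq)
  show "0 \<le> \<Lambda> f" by (rule nonneg[OF c n])
qed

lemma belowI:
  assumes "cont f" "\<And>x. 0 \<le> f x" "\<And>x. f x \<le> 1" "\<And>x. x \<notin> U \<Longrightarrow> f x = 0"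
  shows "f \<in> below U"
  using assms by (auto simp: below_def indicator_def)

lemma ramp_below: "ramp U n \<in> below U"
  by (intro belowI cont_ramp ramp_bounds ramp_outside)

definition content :: "'y set \<Rightarrow> ennreal" where
  "content U = (SUP f\<in>below U. ennreal (\<Lambda> f))"

lemma content_upper: "f \<in> below U \<Longrightarrow> ennreal (\<Lambda> f) \<le> content U"
  unfolding content_def by (rule SUP_upper)

lemma content_mono: "U \<subseteq> V \<Longrightarrow> content U \<le> content V"
  unfolding content_def
proof (rule SUP_subset_mono)
  assume "U \<subseteq> V"
  then show "below U \<subseteq> below V"
    by (auto intro!: belowI dest: belowD)
qed simp

lemma content_le_1: "content U \<le> 1"
  unfolding content_def
proof (rule SUP_least)
  fix f assume f: "f \<in> below U"
  have "\<Lambda> f \<le> \<Lambda> (\<lambda>_. 1)" by (rule mono) (use belowD[OF f] in auto)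
  then show "ennreal (\<Lambda> f) \<le> 1" using one by simp
qed

lemma content_UNIV: "content UNIV = 1"
proof (rule antisym[OF content_le_1])
  have "(\<lambda>_. 1) \<in> below UNIV" by (rule belowI) auto
  from content_upper[OF this] show "1 \<le> content UNIV" by (simp add: one)
qed

lemma content_empty: "content {} = 0"
proof -
  have "\<Lambda> f = 0" if f: "f \<in> below {}" for f
  proof -
    have "f = (\<lambda>_. 0)" using belowD(4)[OF f] by auto
    then show ?thesis using const[of 0] by simp
  qed
  then have "content {} \<le> 0" unfolding content_def by (intro SUP_least) simp
  then show ?thesis by simp
qed

text \<open>
  Dini's argument: the sets on which the inequality holds are open, increase with \<open>n\<close>, and exhaust the
  compact space.
\<close>

lemma dini:
  assumes f: "f \<in> below (\<Union>i. U i)" and U: "\<And>i. open (U i)" and \<delta>: "0 < \<delta>"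
  shows "\<exists>n. \<forall>x. f x \<le> (\<Sum>i<n. ramp (U i) n x) + \<delta>"
proof -
  define V where "V = (\<lambda>n. {x. f x < (\<Sum>i<n. ramp (U i) n x) + \<delta>})"
  have Vopen: "open (V n)" for n
    unfolding V_def using belowD(1)[OF f]
    by (intro open_Collect_less continuous_intros cont_ramp)
  have Vmono: "V m \<subseteq> V n" if mn: "m \<le> n" for m n
  proof -
    have "(\<Sum>i<m. ramp (U i) m x) \<le> (\<Sum>i<n. ramp (U i) n x)" for x
    proof -
      have "(\<Sum>i<m. ramp (U i) m x) \<le> (\<Sum>i<m. ramp (U i) n x)"
        by (intro sum_mono ramp_mono mn)
      also have "\<dots> \<le> (\<Sum>i<n. ramp (U i) n x)"
        using mn by (intro sum_mono2) (auto simp: ramp_bounds)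
      finally show ?thesis .
    qed
    then show ?thesis unfolding V_def by (auto intro: less_le_trans)
  qed
  have cover: "UNIV \<subseteq> (\<Union>n. V n)"
  proof
    fix x
    show "x \<in> (\<Union>n. V n)"
    proof (cases "x \<in> (\<Union>i. U i)")
      case True
      then obtain i where i: "x \<in> U i" by blast
      obtain N where N: "\<And>n. n \<ge> N \<Longrightarrow> ramp (U i) n x = 1"
        by (rule eventually_ramp_eq_1[OF U i]) blast
      define n where "n = max N (Suc i)"
      have "f x \<le> ramp (U i) n x" using N[of n] belowD(3)[OF f, of x] by (simp add: n_def)
      also have "\<dots> \<le> (\<Sum>i<n. ramp (U i) n x)"
        by (rule member_le_sum) (auto simp: n_def ramp_bounds)
      finally have "x \<in> V n" using \<delta> by (simp add: V_def)
      then show ?thesis by blast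
    next
      case False
      then have "x \<in> V 0" using belowD(4)[OF f, of x] \<delta> by (simp add: V_def)
      then show ?thesis by blast
    qed
  qed
  obtain C where C: "finite C" "UNIV \<subseteq> (\<Union>n\<in>C. V n)"
    by (rule compactE_image[OF compact_space, of UNIV V]) (use Vopen cover in auto)
  have "x \<in> V (Max (insert 0 C))" for x
  proof -
    obtain n where "n \<in> C" "x \<in> V n" using C(2) by blast
    then show ?thesis using Vmono[of n "Max (insert 0 C)"] C(1) by (auto intro: Max_ge)
  qed
  then show ?thesis unfolding V_def by (intro exI[of _ "Max (insert 0 C)"]) (auto intro: less_imp_le)
qed

lemma content_countably_subadditive:
  assumes U: "\<And>i::nat. open (U i)"
  shows "content (\<Union>i. U i) \<le> (\<Sum>i. content (U i))"
  unfolding content_def[of "\<Union>i. U i"]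
proof (rule SUP_least)
  fix f assume f: "f \<in> below (\<Union>i. U i)"
  show "ennreal (\<Lambda> f) \<le> (\<Sum>i. content (U i))"
  proof (rule ennreal_le_epsilon)
    fix e :: real assume e: "0 < e"
    obtain n where n: "\<And>x. f x \<le> (\<Sum>i<n. ramp (U i) n x) + e"
      using dini[OF f U e] by blast
    have "\<Lambda> f \<le> \<Lambda> (\<lambda>x. (\<Sum>i<n. ramp (U i) n x) + e)"
      by (rule mono) (use n belowD(1)[OF f] in \<open>auto intro!: continuous_intros cont_ramp\<close>)
    also have "\<dots> = \<Lambda> (\<lambda>x. \<Sum>i<n. ramp (U i) n x) + \<Lambda> (\<lambda>_. e)"
      by (rule add) (auto intro!: continuous_intros cont_ramp)
    also have "\<dots> = (\<Sum>i<n. \<Lambda> (ramp (U i) n)) + e"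
      using sum[of "{..<n}" "\<lambda>i. ramp (U i) n"] by (simp add: cont_ramp const)
    finally have "ennreal (\<Lambda> f) \<le> ennreal ((\<Sum>i<n. \<Lambda> (ramp (U i) n)) + e)" by (rule ennreal_leI)
    also have "\<dots> = (\<Sum>i<n. ennreal (\<Lambda> (ramp (U i) n))) + ennreal e"
      using e belowD(5)[OF ramp_below] by (simp add: ennreal_plus sum_nonneg sum_ennreal)
    also have "(\<Sum>i<n. ennreal (\<Lambda> (ramp (U i) n))) \<le> (\<Sum>i<n. content (U i))"
      by (intro sum_mono content_upper ramp_below)
    also have "\<dots> \<le> (\<Sum>i. content (U i))" by (rule sum_le_suminf) auto
    finally show "ennreal (\<Lambda> f) \<le> (\<Sum>i. content (U i)) + ennreal e" by (simp add: add_right_mono)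
  qed
qed

definition outer :: "'y set \<Rightarrow> ennreal" where
  "outer A = (INF U\<in>{U. open U \<and> A \<subseteq> U}. content U)"

lemma outer_le: "open U \<Longrightarrow> A \<subseteq> U \<Longrightarrow> outer A \<le> content U"
  unfolding outer_def by (rule INF_lower) simp

lemma outer_open: "open U \<Longrightarrow> outer U = content U"
  by (rule antisym[OF outer_le]) (auto simp: outer_def intro!: INF_greatest content_mono)

lemma outer_mono: "A \<subseteq> B \<Longrightarrow> outer A \<le> outer B"
  unfolding outer_def by (rule INF_superset_mono) auto

lemma outer_close:
  assumes "outer A < e" shows "\<exists>U. open U \<and> A \<subseteq> U \<and> content U < e"
  using assms unfolding outer_def INF_less_iff by auto

lemma outer_countably_subadditive: "outer (\<Union>i. A i) \<le> (\<Sum>i::nat. outer (A i))"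
proof (rule ennreal_le_epsilon)
  fix e :: real assume "0 < e" "(\<Sum>n. outer (A n)) < top"
  then have *: "\<And>n. outer (A n) < outer (A n) + e * (1/2)^Suc n"
    by (auto simp add: less_top dest!: ennreal_suminf_lessD)
  obtain U where U: "\<And>n. open (U n)" "\<And>n. A n \<subseteq> U n" "\<And>n. content (U n) < outer (A n) + e * (1/2)^Suc n"
    using outer_close[OF *] by metis
  have "outer (\<Union>i. A i) \<le> content (\<Union>i. U i)"
    by (rule outer_le) (use U in auto)
  also have "\<dots> \<le> (\<Sum>i. content (U i))" by (rule content_countably_subadditive[OF U(1)])
  also have "\<dots> \<le> (\<Sum>n. outer (A n) + e * (1/2) ^ Suc n)"
    by (intro suminf_le less_imp_le[OF U(3)]) auto
  also have "... = (\<Sum>n. outer (A n)) + (\<Sum>n. ennreal e * ennreal ((1/2) ^ Suc n))"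
    using \<open>0 < e\<close> by (subst suminf_add[symmetric])
      (auto simp del: ennreal_suminf_cmult simp add: ennreal_mult[symmetric])
  also have "\<dots> = (\<Sum>n. outer (A n)) + e"
    unfolding ennreal_suminf_cmult
    by (subst suminf_ennreal_eq[OF zero_le_power power_half_series]) auto
  finally show "outer (\<Union>i. A i) \<le> (\<Sum>n. outer (A n)) + e" .
qed

text \<open>
  A function below \<open>V \<inter> U\<close> is smaller than \<open>\<delta>\<close> near \<open>V - U\<close>. Adding to it a
  function supported in that region therefore exceeds one by at most \<open>\<delta>\<close>, and division by
  \<open>1 + \<delta>\<close> brings the sum below \<open>V\<close>.
\<close>

lemma content_split:
  assumes U: "open U" and V: "open V"
  shows "content (V \<inter> U) + outer (V - U) \<le> content V"
proof -
  have one_f: "ennreal (\<Lambda> f) + outer (V - U) \<le> content V" if f: "f \<in> below (V \<inter> U)" for f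
  proof (rule ennreal_le_epsilon)
    fix \<delta> :: real assume \<delta>: "0 < \<delta>"
    define W where "W = V \<inter> {x. f x < \<delta>}"
    have W: "open W" unfolding W_def using V belowD(1)[OF f]
      by (intro open_Int open_Collect_less continuous_intros)
    have "V - U \<subseteq> W" using belowD(4)[OF f] \<delta> by (auto simp: W_def)
    then have "ennreal (\<Lambda> f) + outer (V - U) \<le> ennreal (\<Lambda> f) + content W"
      by (intro add_left_mono outer_le[OF W])
    also have "\<dots> = (SUP h\<in>below W. ennreal (\<Lambda> f) + ennreal (\<Lambda> h))"
      unfolding content_def using ramp_below[of W 0] by (subst ennreal_SUP_add_right) auto
    also have "\<dots> \<le> content V + ennreal \<delta>"
    proof (rule SUP_least)
      fix h assume h: "h \<in> below W"
      define k where "k = (\<lambda>x. inverse (1 + \<delta>) * (f x + h x))"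
      have "k \<in> below V"
      proof (rule belowI)
        show "cont k" unfolding k_def using belowD(1)[OF f] belowD(1)[OF h] by (intro continuous_intros)
        show "0 \<le> k x" for x
          unfolding k_def using belowD(2)[OF f] belowD(2)[OF h] \<delta> by (intro mult_nonneg_nonneg add_nonneg_nonneg) auto
        show "k x = 0" if "x \<notin> V" for x
          using belowD(4)[OF f, of x] belowD(4)[OF h, of x] that by (simp add: k_def W_def)
        show "k x \<le> 1" for x
        proof -
          have "f x + h x \<le> 1 + \<delta>"
          proof (cases "x \<in> W")
            case True
            then show ?thesis using belowD(3)[OF h, of x] by (simp add: W_def)
          next
            case False
            then show ?thesis using belowD(4)[OF h, of x] belowD(3)[OF f, of x] \<delta> by simp
          qed
          then show ?thesis using \<delta> by (simp add: k_def field_simps)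
        qed
      qed
      note ck = content_upper[OF this] and k1 = belowD(5)[OF this]
      have "\<Lambda> k = inverse (1 + \<delta>) * (\<Lambda> f + \<Lambda> h)"
        unfolding k_def using belowD(1)[OF f] belowD(1)[OF h]
        by (subst scale) (auto intro!: continuous_intros simp: add)
      then have "\<Lambda> f + \<Lambda> h = \<Lambda> k + \<delta> * \<Lambda> k" using \<delta> by (simp add: field_simps)
      also have "\<dots> \<le> \<Lambda> k + \<delta> * 1"
      proof -
        have "\<Lambda> k \<le> 1" using order_trans[OF ck content_le_1] k1 by simp
        then show ?thesis using \<delta> by (intro add_left_mono mult_left_mono) auto
      qed
      finally have "ennreal (\<Lambda> f + \<Lambda> h) \<le> ennreal (\<Lambda> k + \<delta>)" by (intro ennreal_leI) simp
      then have "ennreal (\<Lambda> f) + ennreal (\<Lambda> h) \<le> ennreal (\<Lambda> k) + ennreal \<delta>"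
        using belowD(5)[OF f] belowD(5)[OF h] k1 \<delta> by (simp add: ennreal_plus)
      also have "\<dots> \<le> content V + ennreal \<delta>" using ck by (rule add_right_mono)
      finally show "ennreal (\<Lambda> f) + ennreal (\<Lambda> h) \<le> content V + ennreal \<delta>" .
    qed
    finally show "ennreal (\<Lambda> f) + outer (V - U) \<le> content V + ennreal \<delta>" .
  qed
  have "content (V \<inter> U) + outer (V - U) = (SUP f\<in>below (V \<inter> U). ennreal (\<Lambda> f) + outer (V - U))"
    unfolding content_def[of "V \<inter> U"] using ramp_below[of "V \<inter> U" 0] by (subst ennreal_SUP_add_left) auto
  also have "\<dots> \<le> content V" by (rule SUP_least) (rule one_f)
  finally show ?thesis .
qed

lemma outer_measure_space_outer: "outer_measure_space (Pow UNIV) outer"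
  unfolding outer_measure_space_def
proof (intro conjI)
  show "positive (Pow UNIV) outer" by (simp add: positive_def outer_open content_empty)
  show "increasing (Pow UNIV) outer" by (auto simp: increasing_def intro: outer_mono)
  show "countably_subadditive (Pow UNIV) outer"
    unfolding countably_subadditive_def using outer_countably_subadditive by blast
qed

lemma open_in_lambda_system:
  assumes U: "open U" shows "U \<in> lambda_system UNIV (Pow UNIV) outer"
proof -
  have "outer (U \<inter> A) + outer ((UNIV - U) \<inter> A) = outer A" for A
  proof (rule antisym)
    show "outer (U \<inter> A) + outer ((UNIV - U) \<inter> A) \<le> outer A"
      unfolding outer_def[of A]
    proof (rule INF_greatest)
      fix V assume "V \<in> {V. open V \<and> A \<subseteq> V}"
      then have V: "open V" "A \<subseteq> V" by auto
      have "outer (U \<inter> A) \<le> content (V \<inter> U)" using U V by (intro outer_le) auto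
      moreover have "outer ((UNIV - U) \<inter> A) \<le> outer (V - U)" using V by (intro outer_mono) auto
      ultimately have "outer (U \<inter> A) + outer ((UNIV - U) \<inter> A) \<le> content (V \<inter> U) + outer (V - U)"
        by (rule add_mono)
      also have "\<dots> \<le> content V" by (rule content_split[OF U V(1)])
      finally show "outer (U \<inter> A) + outer ((UNIV - U) \<inter> A) \<le> content V" .
    qed
    define B where "B = (\<lambda>i::nat. if i = 0 then U \<inter> A else if i = 1 then (UNIV - U) \<inter> A else {})"
    have "A = (\<Union>i. B i)" by (auto simp: B_def split: if_splits)
    then have "outer A \<le> (\<Sum>i. outer (B i))" using outer_countably_subadditive[of B] by simp
    also have "\<dots> = (\<Sum>i\<in>{0, 1}. outer (B i))"
      by (rule suminf_finite) (auto simp: B_def outer_open content_empty)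
    also have "\<dots> = outer (U \<inter> A) + outer ((UNIV - U) \<inter> A)" by (simp add: B_def)
    finally show "outer A \<le> outer (U \<inter> A) + outer ((UNIV - U) \<inter> A)" .
  qed
  then show ?thesis by (simp add: lambda_system_def)
qed

text \<open>
  The measure representing the state, obtained from Caratheodory's construction.
\<close>

definition M :: "'y measure" where
  "M = measure_of UNIV (sets borel) outer"

lemma space_M [simp]: "space M = UNIV" and sets_M [simp]: "sets M = sets borel"
  unfolding M_def using sets.sets_measure_of_eq[of "borel :: 'y measure"] by simp_all

lemma emeasure_M: "A \<in> sets borel \<Longrightarrow> emeasure M A = outer A"
proof -
  assume A: "A \<in> sets borel"
  interpret P: sigma_algebra UNIV "Pow UNIV :: 'y set set" by (rule sigma_algebra_Pow)
  have ms: "measure_space UNIV (lambda_system UNIV (Pow UNIV) outer) outer"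
    by (rule P.caratheodory_lemma[OF outer_measure_space_outer])
  have "sets (borel :: 'y measure) = sigma_sets UNIV {S. open S}" by (simp add: borel_def)
  moreover have "sigma_sets UNIV {S. open S} \<subseteq> lambda_system UNIV (Pow UNIV) outer"
  proof (rule sigma_algebra.sigma_sets_subset)
    show "sigma_algebra UNIV (lambda_system UNIV (Pow UNIV) outer)"
      using ms by (simp add: measure_space_def)
    show "{S. open S} \<subseteq> lambda_system UNIV (Pow UNIV) outer"
      using open_in_lambda_system by blast
  qed
  ultimately have sub: "sets borel \<subseteq> lambda_system UNIV (Pow UNIV) outer" by simp
  have "sigma_algebra UNIV (sets (borel :: 'y measure))"
    using sets.sigma_algebra_axioms[of "borel :: 'y measure"] by simp
  then have "measure_space UNIV (sets borel) outer"
    using measure_down[OF ms _ sub] by simp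
  then show ?thesis
    unfolding M_def using A by (intro emeasure_measure_of_sigma) (auto simp: measure_space_def)
qed

lemma prob_space_M: "prob_space M"
  by (rule prob_spaceI) (simp add: emeasure_M outer_open content_UNIV)

text \<open>
  Slice \<open>f\<close> horizontally into \<open>n\<close> layers of height \<open>1 / n\<close>. The layer between \<open>i / n\<close> and
  \<open>(i + 1) / n\<close>, scaled to height one, lies below the indicator function of \<open>{x. i / n < f x}\<close> and
  above that of \<open>{x. (i + 1) / n < f x}\<close>. This compares functional and integral up to the error
  \<open>1 / n\<close>.
\<close>

lemma integral_unit:
  assumes f: "cont f" "\<And>x. 0 \<le> f x" "\<And>x. f x \<le> 1"
  shows "\<Lambda> f \<le> integral\<^sup>L M f"
proof -
  interpret prob_space M by (rule prob_space_M)
  have meas: "f \<in> borel_measurable M"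
    unfolding measurable_cong_sets[OF sets_M refl] by (rule borel_measurable_continuous_onI[OF f(1)])
  have int: "integrable M f" by (rule integrable_const_bound[of _ 1]) (use f meas in auto)
  have bound: "\<Lambda> f \<le> integral\<^sup>L M f + 1 / real (Suc m)" for m
  proof -
    define n where "n = Suc m"
    define t where "t = (\<lambda>i. real i / real n)"
    define U where "U = (\<lambda>i. {x. t i < f x})"
    define s where "s = (\<lambda>i x. min (f x) (t (Suc i)) - min (f x) (t i))"
    have n0: "real n > 0" by (simp add: n_def)
    have t_Suc: "t (Suc i) = t i + 1 / real n" for i by (simp add: t_def add_divide_distrib)
    have t_mono: "t i \<le> t (Suc i)" for i using n0 by (simp add: t_Suc)
    have Uopen: "open (U i)" for i unfolding U_def using f(1) by (intro open_Collect_less continuous_intros)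
    have cs: "cont (s i)" for i unfolding s_def using f(1) by (intro continuous_intros)
    have s0: "0 \<le> s i x" for i x using t_mono[of i] by (auto simp: s_def)
    have s1: "s i x \<le> 1 / real n" for i x 
    proof -
      have "0 < 1 / real n" using n0 by simp
      then show ?thesis unfolding s_def t_Suc by linarith
    qed
    have below: "(\<lambda>x. real n * s i x) \<in> below (U i)" for i
    proof (rule belowI)
      show "cont (\<lambda>x. real n * s i x)" using cs by (intro continuous_intros)
      show "0 \<le> real n * s i x" for x using s0 n0 by simp
      show "real n * s i x \<le> 1" for x using s1[of i x] n0 by (simp add: field_simps)
      show "real n * s i x = 0" if "x \<notin> U i" for x
        using that t_mono[of i] by (simp add: s_def U_def min_def)
    qed
    have "real n * \<Lambda> (s i) \<le> measure M (U i)" for i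
    proof -
      have "ennreal (real n * \<Lambda> (s i)) \<le> emeasure M (U i)"
        using content_upper[OF below[of i]] Uopen by (simp add: scale[OF cs] emeasure_M outer_open)
      then show ?thesis by (simp add: emeasure_eq_measure)
    qed
    then have "(\<Sum>i<n. real n * \<Lambda> (s i)) \<le> (\<Sum>i<n. measure M (U i))" by (rule sum_mono)
    moreover have "(\<Sum>i<n. \<Lambda> (s i)) = \<Lambda> f"
    proof -
      have "(\<Sum>i<n. \<Lambda> (s i)) = \<Lambda> (\<lambda>x. \<Sum>i<n. s i x)" using sum[of "{..<n}" s] cs by simp
      also have "(\<lambda>x. \<Sum>i<n. s i x) = f"
      proof
        fix x
        have "(\<Sum>i<n. s i x) = min (f x) (t n) - min (f x) (t 0)"
          unfolding s_def by (rule sum_lessThan_telescope)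
        then show "(\<Sum>i<n. s i x) = f x" using f(2,3)[of x] n0 by (simp add: t_def)
      qed
      finally show ?thesis .
    qed
    ultimately have 1: "real n * \<Lambda> f \<le> (\<Sum>i<n. measure M (U i))" by (simp add: sum_distrib_left[symmetric])
    have "(\<Sum>i<n. measure M (U i)) = measure M (U 0) + (\<Sum>i<m. measure M (U (Suc i)))"
      unfolding n_def by (rule sum.lessThan_Suc_shift)
    also have "measure M (U 0) \<le> 1" by (rule prob_le_1)
    also have "(\<Sum>i<m. measure M (U (Suc i))) = integral\<^sup>L M (\<lambda>x. \<Sum>i<m. indicator (U (Suc i)) x)"
      using Uopen by (subst Bochner_Integration.integral_sum) (auto simp: emeasure_eq_measure)
    also have "\<dots> \<le> integral\<^sup>L M (\<lambda>x. real n * f x)"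
    proof (rule integral_mono)
      show "integrable M (\<lambda>x. \<Sum>i<m. indicator (U (Suc i)) x :: real)"
        using Uopen by (intro Bochner_Integration.integrable_sum) (auto simp: emeasure_eq_measure)
      show "integrable M (\<lambda>x. real n * f x)" using int by simp
      fix x
      have "indicator (U (Suc i)) x \<le> real n * s i x" for i
      proof (cases "x \<in> U (Suc i)")
        case True
        then have "t (Suc i) < f x" by (simp add: U_def)
        then have "s i x = 1 / real n"
          using t_mono[of i] t_Suc[of i] unfolding s_def by linarith
        then show ?thesis using True n0 by simp
      qed (use s0 n0 in auto)
      then have "(\<Sum>i<m. indicator (U (Suc i)) x) \<le> (\<Sum>i<m. real n * s i x)" by (rule sum_mono)
      also have "\<dots> = real n * (min (f x) (t m) - min (f x) (t 0))"
        unfolding sum_distrib_left[symmetric] s_def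
        using sum_lessThan_telescope[of "\<lambda>i. min (f x) (t i)" m] by simp
      also have "\<dots> \<le> real n * f x" using n0 f(2)[of x] by (intro mult_left_mono) (auto simp: t_def)
      finally show "(\<Sum>i<m. indicator (U (Suc i)) x) \<le> real n * f x" .
    qed
    also have "\<dots> = real n * integral\<^sup>L M f" by simp
    finally have "real n * \<Lambda> f \<le> 1 + real n * integral\<^sup>L M f" using 1 by simp
    then have "\<Lambda> f \<le> (1 + real n * integral\<^sup>L M f) / real n" using n0 by (simp add: field_simps)
    then show ?thesis using n0 by (simp add: add_divide_distrib n_def)
  qed
  show ?thesis
  proof (rule field_le_epsilon)
    fix e :: real assume "0 < e"
    then obtain m where "1 / real (Suc m) < e" using nat_approx_posE by blast
    then show "\<Lambda> f \<le> integral\<^sup>L M f + e" using bound[of m] by linarith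
  qed
qed

text \<open>
  Rescaling reduces to functions between zero and one; the reverse inequality comes from \<open>- f\<close>.
\<close>

theorem integral_M:
  assumes f: "cont f"
  shows "integral\<^sup>L M f = \<Lambda> f"
proof -
  interpret prob_space M by (rule prob_space_M)
  have le: "\<Lambda> f \<le> integral\<^sup>L M f" if f: "cont f" for f
  proof -
    have "compact (range f)" by (rule compact_continuous_image[OF f compact_space])
    then obtain B where B: "B > 0" "\<And>x. \<bar>f x\<bar> \<le> B"
      using compact_imp_bounded[THEN bounded_pos[THEN iffD1], of "range f"] by auto
    have int: "integrable M f"
    proof (rule integrable_const_bound[of _ B])
      show "f \<in> borel_measurable M"
        unfolding measurable_cong_sets[OF sets_M refl] by (rule borel_measurable_continuous_onI[OF f])
    qed (use B in auto)
    define h where "h = (\<lambda>x. inverse (2 * B) * (f x + B))"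
    have ch: "cont h" unfolding h_def using f by (intro continuous_intros)
    have "\<Lambda> h \<le> integral\<^sup>L M h"
    proof (rule integral_unit[OF ch])
      fix x
      have "- B \<le> f x" "f x \<le> B" using B(2)[of x] by auto
      then show "0 \<le> h x" "h x \<le> 1" using B(1) by (auto simp: h_def field_simps)
    qed
    moreover have "\<Lambda> h = inverse (2 * B) * (\<Lambda> f + B)"
      unfolding h_def using f by (subst scale) (auto intro!: continuous_intros simp: add const)
    moreover have "integral\<^sup>L M h = inverse (2 * B) * (integral\<^sup>L M f + B)"
      unfolding h_def using int by (simp add: prob_space[unfolded space_M])
    ultimately show ?thesis using B(1) by simp
  qed
  have "- \<Lambda> f \<le> integral\<^sup>L M (\<lambda>x. - f x)"
    using le[of "\<lambda>x. - f x"] minus[OF f] f by (simp add: continuous_on_minus)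
  then show ?thesis using le[OF f] by simp
qed

end

section \<open>Invariant states on the square of a system\<close>

lemma sum_diff_abs_le:
  fixes f :: "'a \<Rightarrow> real"
  assumes "finite A" "finite B" and bound: "\<And>x. \<bar>f x\<bar> \<le> b"
  shows "\<bar>sum f A - sum f B\<bar> \<le> b * real (card (sym_diff A B))"
proof -
  have "sum f A = sum f (A \<inter> B) + sum f (A - B)" by (rule sum.Int_Diff[OF assms(1)])
  moreover have "sum f B = sum f (B \<inter> A) + sum f (B - A)" by (rule sum.Int_Diff[OF assms(2)])
  ultimately have eq: "sum f A - sum f B = sum f (A - B) - sum f (B - A)" by (simp add: Int_commute)
  have "\<bar>sum f C\<bar> \<le> b * real (card C)" for C
  proof -
    have "\<bar>sum f C\<bar> \<le> (\<Sum>x\<in>C. \<bar>f x\<bar>)" by (rule sum_abs)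
    also have "\<dots> \<le> (\<Sum>x\<in>C. b)" by (intro sum_mono bound)
    finally show ?thesis by (simp add: mult.commute)
  qed
  from this[of "A - B"] this[of "B - A"]
  have "\<bar>sum f A - sum f B\<bar> \<le> b * real (card (A - B)) + b * real (card (B - A))"
    unfolding eq by linarith
  also have "\<dots> = b * real (card (sym_diff A B))"
    using assms(1,2) by (subst card_Un_disjoint) (auto simp: distrib_left)
  finally show ?thesis .
qed

lemma cont_bounded:
  assumes "compact (UNIV :: 'y::metric_space set)" "cont (f :: 'y \<Rightarrow> real)"
  shows "\<exists>b. \<forall>x. \<bar>f x\<bar> \<le> b"
proof -
  have "compact (range f)" by (rule compact_continuous_image[OF assms(2,1)])
  then have "bounded (range f)" by (rule compact_imp_bounded)
  then show ?thesis by (auto simp: bounded_iff)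
qed

context compact_action
begin

definition T2 :: "'g \<Rightarrow> 'x \<times> 'x \<Rightarrow> 'x \<times> 'x" where
  "T2 g p = (T g (fst p), T g (snd p))"

definition d :: "'x \<times> 'x \<Rightarrow> real" where
  "d p = dist (fst p) (snd p)"

lemma compact_space2: "compact (UNIV :: ('x \<times> 'x) set)"
  using compact_Times[OF compact_space compact_space] by simp

lemma T2_add: "T2 (g + h) p = T2 g (T2 h p)"
  by (simp add: T2_def T_add)

lemma continuous_T2: "continuous_on UNIV (T2 g)"
  unfolding T2_def
  by (intro continuous_on_Pair continuous_on_compose2[OF continuous_T] continuous_intros) auto

lemma cont_T2: "cont f \<Longrightarrow> cont (\<lambda>p. f (T2 g p))"
  by (rule continuous_on_compose2[OF _ continuous_T2]) auto

lemma cont_d: "cont d"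
  unfolding d_def by (intro continuous_intros)

text \<open>
  States on the square of the system that are invariant and concentrated on pairs at distance at most
  \<open>\<epsilon>\<close>, as expressed by the last condition. Requiring the value zero at discontinuous functions
  makes this set a closed subset of a product of compact intervals.
\<close>

definition invariant_states :: "real \<Rightarrow> (('x \<times> 'x \<Rightarrow> real) \<Rightarrow> real) set" where
  "invariant_states \<epsilon> = {\<Lambda>.
     (\<forall>f. \<not> cont f \<longrightarrow> \<Lambda> f = 0) \<and>
     (\<forall>f g. cont f \<and> cont g \<longrightarrow> \<Lambda> (\<lambda>x. f x + g x) = \<Lambda> f + \<Lambda> g) \<and>
     (\<forall>c f. cont f \<longrightarrow> \<Lambda> (\<lambda>x. c * f x) = c * \<Lambda> f) \<and>
     (\<forall>f. cont f \<and> (\<forall>x. 0 \<le> f x) \<longrightarrow> 0 \<le> \<Lambda> f) \<and>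
     \<Lambda> (\<lambda>_. 1) = 1 \<and>
     (\<forall>g f. cont f \<longrightarrow> \<Lambda> (\<lambda>p. f (T2 g p)) = \<Lambda> f) \<and>
     \<Lambda> (\<lambda>p. max 0 (d p - \<epsilon>)) = 0}"

lemma invariant_statesD:
  assumes "\<Lambda> \<in> invariant_states \<epsilon>"
  shows "state \<Lambda>" "\<not> cont f \<Longrightarrow> \<Lambda> f = 0" "cont f \<Longrightarrow> \<Lambda> (\<lambda>p. f (T2 g p)) = \<Lambda> f"
    "\<Lambda> (\<lambda>p. max 0 (d p - \<epsilon>)) = 0"
proof -
  show "state \<Lambda>"
    by (rule state.intro[OF compact_space2])
      (use assms in \<open>unfold invariant_states_def mem_Collect_eq, blast+\<close>)
qed (use assms in \<open>unfold invariant_states_def mem_Collect_eq, blast+\<close>)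

lemma state_abs_le:
  assumes "state \<Lambda>" "cont f" "\<And>x. \<bar>f x\<bar> \<le> b" shows "\<bar>\<Lambda> f\<bar> \<le> b"
proof -
  interpret state \<Lambda> by (rule assms(1))
  have "\<Lambda> f \<le> \<Lambda> (\<lambda>_. b)" "\<Lambda> (\<lambda>_. - b) \<le> \<Lambda> f"
    by (rule mono; use assms(2,3) in \<open>auto simp: abs_le_iff minus_le_iff\<close>)+
  then show ?thesis by (simp add: const abs_le_iff)
qed

lemma closed_invariant_states: "closed (invariant_states \<epsilon>)"
  unfolding invariant_states_def
  by (intro closed_Collect_conj closed_Collect_all closed_Collect_imp open_Collect_const
      closed_Collect_eq closed_Collect_le continuous_on_const continuous_on_add continuous_on_mult
      continuous_on_apply)

definition sup_bound :: "('x \<times> 'x \<Rightarrow> real) \<Rightarrow> real" where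
  "sup_bound f = (if cont f then SOME b. \<forall>x. \<bar>f x\<bar> \<le> b else 0)"

lemma sup_bound: "cont f \<Longrightarrow> \<bar>f x\<bar> \<le> sup_bound f"
  using someI_ex[OF cont_bounded[OF compact_space2, of f]]
  by (simp add: sup_bound_def del: split_paired_All)

lemma compact_invariant_states: "compact (invariant_states \<epsilon>)"
proof -
  have "\<bar>\<Lambda> f\<bar> \<le> sup_bound f" if "\<Lambda> \<in> invariant_states \<epsilon>" for \<Lambda> f
  proof (cases "cont f")
    case True
    then show ?thesis using state_abs_le[OF invariant_statesD(1)[OF that] True] sup_bound by blast
  next
    case False
    then show ?thesis using invariant_statesD(2)[OF that False] by (simp add: sup_bound_def)
  qed
  then have "invariant_states \<epsilon> = {\<Lambda>. \<forall>f. \<bar>\<Lambda> f\<bar> \<le> sup_bound f} \<inter> invariant_states \<epsilon>" by blast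
  then show ?thesis
    using compact_Int_closed[OF compact_box[of sup_bound] closed_invariant_states[of \<epsilon>]] by simp
qed

text \<open>
  The value at discontinuous functions is zero, in accordance with \<open>invariant_states\<close>.
\<close>

definition average :: "'g set \<Rightarrow> 'x \<times> 'x \<Rightarrow> ('x \<times> 'x \<Rightarrow> real) \<Rightarrow> real" where
  "average A p f = (if cont f then (\<Sum>g\<in>A. f (T2 g p)) / real (card A) else 0)"

lemma average_almost_invariant:
  assumes F: "folner_sequence F" and f: "cont f"
  shows "(\<lambda>n. average (F n) p (\<lambda>q. f (T2 g q)) - average (F n) p f) \<longlonglongrightarrow> 0"
proof (rule Lim_null_comparison)
  define s where "s = (\<lambda>n. real (card (sym_diff ((+) g ` F n) (F n))) / real (card (F n)))"
  have "s \<longlonglongrightarrow> 0" using F by (auto simp: folner_sequence_def s_def)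
  then show "(\<lambda>n. sup_bound f * s n) \<longlonglongrightarrow> 0" by (rule tendsto_mult_right_zero)
  show "\<forall>\<^sub>F n in sequentially. norm (average (F n) p (\<lambda>q. f (T2 g q)) - average (F n) p f) \<le> sup_bound f * s n"
  proof (rule always_eventually, rule allI)
    fix n
    have fin: "finite (F n)" using F by (auto simp: folner_sequence_def)
    have "(\<Sum>h\<in>F n. f (T2 g (T2 h p))) = (\<Sum>k\<in>(+) g ` F n. f (T2 k p))"
      by (subst sum.reindex) (auto simp: T2_add)
    then have "average (F n) p (\<lambda>q. f (T2 g q)) - average (F n) p f =
        ((\<Sum>k\<in>(+) g ` F n. f (T2 k p)) - (\<Sum>k\<in>F n. f (T2 k p))) / real (card (F n))"
      using f cont_T2[OF f] by (simp add: average_def diff_divide_distrib)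
    also have "norm \<dots> = \<bar>(\<Sum>k\<in>(+) g ` F n. f (T2 k p)) - (\<Sum>k\<in>F n. f (T2 k p))\<bar> / real (card (F n))"
      by simp
    also have "\<dots> \<le> (sup_bound f * real (card (sym_diff ((+) g ` F n) (F n)))) / real (card (F n))"
      by (intro divide_right_mono sum_diff_abs_le) (use fin sup_bound[OF f] in auto)
    finally show "norm (average (F n) p (\<lambda>q. f (T2 g q)) - average (F n) p f) \<le> sup_bound f * s n"
      by (simp add: s_def)
  qed
qed

text \<open>
  A cluster point of those averages at which the distance function has a value of at least \<open>c\<close>. All
  conditions in \<open>invariant_states\<close> hold for the averages, invariance up to an error that tends to
  zero, and they pass to the limit.
\<close>

lemma limit_of_averages:
  assumes F: "folner_sequence F" and close: "\<And>g. d (T2 g p) \<le> \<epsilon>"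
    and freq: "\<exists>\<^sub>F n in sequentially. average (F n) p d \<ge> c"
  shows "\<exists>\<Lambda>\<in>invariant_states \<epsilon>. \<Lambda> d \<ge> c"
proof -
  define A where "A = (\<lambda>n. average (F n) p)"
  define F0 where "F0 = inf sequentially (principal {n. A n d \<ge> c})"
  have fin: "finite (F n)" "F n \<noteq> {}" for n using F by (auto simp: folner_sequence_def)
  then have card0: "real (card (F n)) > 0" for n by (simp add: card_gt_0_iff)
  have "F0 \<noteq> bot"
  proof
    assume "F0 = bot"
    then have "\<forall>\<^sub>F n in F0. False" by simp
    then have "\<forall>\<^sub>F n in sequentially. \<not> A n d \<ge> c"
      unfolding F0_def eventually_inf_principal by simp
    then show False using freq unfolding frequently_def A_def by blast
  qed
  have "\<bar>A n f\<bar> \<le> sup_bound f" for n f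
  proof (cases "cont f")
    case True
    have "\<bar>\<Sum>g\<in>F n. f (T2 g p)\<bar> \<le> (\<Sum>g\<in>F n. \<bar>f (T2 g p)\<bar>)" by (rule sum_abs)
    also have "\<dots> \<le> (\<Sum>g\<in>F n. sup_bound f)" by (intro sum_mono sup_bound[OF True])
    finally have "\<bar>\<Sum>g\<in>F n. f (T2 g p)\<bar> \<le> sup_bound f * real (card (F n))" by (simp add: mult.commute)
    then show ?thesis using card0[of n] True by (simp add: A_def average_def divide_le_eq)
  qed (simp add: A_def average_def sup_bound_def)
  then have "\<forall>\<^sub>F n in F0. A n \<in> {\<Lambda>. \<forall>f. \<bar>\<Lambda> f\<bar> \<le> sup_bound f}" by simp
  from compact_cluster_filter[OF compact_box \<open>F0 \<noteq> bot\<close> this]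
  obtain \<Lambda> G where G: "G \<le> F0" "G \<noteq> bot" "(A \<longlongrightarrow> \<Lambda>) G" by blast
  have lim: "((\<lambda>n. A n f) \<longlongrightarrow> \<Lambda> f) G" for f by (rule tendsto_apply[OF G(3)])
  have G_seq: "G \<le> sequentially" using G(1) by (simp add: F0_def)
  have uniq: "\<Lambda> f = a" if "\<And>n. A n f = a" for f a
    using lim[of f] that G(2) by (simp add: tendsto_const_iff)
  have "\<Lambda> \<in> invariant_states \<epsilon>"
    unfolding invariant_states_def mem_Collect_eq
  proof (intro conjI allI impI)
    show "\<Lambda> f = 0" if "\<not> cont f" for f
      using that by (intro uniq) (simp add: A_def average_def)
    show "\<Lambda> (\<lambda>x. f x + g x) = \<Lambda> f + \<Lambda> g" if fg: "cont f \<and> cont g" for f g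
    proof (rule tendsto_unique[OF G(2) lim])
      have "A n (\<lambda>x. f x + g x) = A n f + A n g" for n
        using fg by (simp add: A_def average_def continuous_on_add sum.distrib add_divide_distrib)
      then show "((\<lambda>n. A n (\<lambda>x. f x + g x)) \<longlongrightarrow> \<Lambda> f + \<Lambda> g) G"
        using tendsto_add[OF lim lim, of f g] by simp
    qed
    show "\<Lambda> (\<lambda>x. k * f x) = k * \<Lambda> f" if f: "cont f" for k f
    proof (rule tendsto_unique[OF G(2) lim])
      have "A n (\<lambda>x. k * f x) = k * A n f" for n
        using f by (simp add: A_def average_def continuous_on_mult_left sum_distrib_left[symmetric])
      then show "((\<lambda>n. A n (\<lambda>x. k * f x)) \<longlongrightarrow> k * \<Lambda> f) G"
        using tendsto_mult[OF tendsto_const lim, of k f] by simp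
    qed
    show "0 \<le> \<Lambda> f" if f: "cont f \<and> (\<forall>x. 0 \<le> f x)" for f
    proof (rule tendsto_lowerbound[OF lim always_eventually G(2)], rule allI)
      have "0 \<le> f x" for x using f by blast
      then show "0 \<le> A n f" for n by (simp add: A_def average_def sum_nonneg)
    qed
    show "\<Lambda> (\<lambda>_. 1) = 1"
      using fin by (intro uniq) (simp add: A_def average_def card_gt_0_iff)
    show "\<Lambda> (\<lambda>p. f (T2 g p)) = \<Lambda> f" if f: "cont f" for g f
    proof -
      have "((\<lambda>n. A n (\<lambda>q. f (T2 g q)) - A n f) \<longlongrightarrow> 0) G"
        unfolding A_def by (rule tendsto_mono[OF G_seq average_almost_invariant[OF F f]])
      moreover have "((\<lambda>n. A n (\<lambda>q. f (T2 g q)) - A n f) \<longlongrightarrow> \<Lambda> (\<lambda>q. f (T2 g q)) - \<Lambda> f) G"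
        by (rule tendsto_diff[OF lim lim])
      ultimately have "\<Lambda> (\<lambda>q. f (T2 g q)) - \<Lambda> f = 0"
        using tendsto_unique[OF G(2)] by blast
      then show ?thesis by simp
    qed
    show "\<Lambda> (\<lambda>p. max 0 (d p - \<epsilon>)) = 0"
    proof (rule uniq)
      have "max 0 (d (T2 g p) - \<epsilon>) = 0" for g using close[of g] by simp
      then show "A n (\<lambda>p. max 0 (d p - \<epsilon>)) = 0" for n by (simp add: A_def average_def)
    qed
  qed
  moreover have "\<Lambda> d \<ge> c"
  proof (rule tendsto_lowerbound[OF lim _ G(2)])
    have "\<forall>\<^sub>F n in F0. c \<le> A n d" unfolding F0_def eventually_inf_principal by simp
    then show "\<forall>\<^sub>F n in G. c \<le> A n d" by (rule filter_leD[OF G(1)])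
  qed
  ultimately show ?thesis by blast
qed

text \<open>
  By Markov's inequality the distance is below \<open>\<delta>\<close> on at least half of each late Folner set.
\<close>

lemma weakly_asymptotic_if_average_tends_to_0:
  assumes F: "folner_sequence F" and "x \<noteq> y"
    and lim: "(\<lambda>n. average (F n) (x, y) d) \<longlonglongrightarrow> 0"
  shows "weakly_asymptotic_pair F T x y"
proof (rule weakly_asymptotic_pairI[OF _ \<open>x \<noteq> y\<close>])
  show fin: "finite (F n)" for n using F by (auto simp: folner_sequence_def)
  show "0 < (1 / 2 :: real)" by simp
  fix \<delta> :: real assume \<delta>: "0 < \<delta>"
  have "\<forall>\<^sub>F n in sequentially. average (F n) (x, y) d < \<delta> / 2"
    by (rule order_tendstoD(2)[OF lim]) (use \<delta> in simp)
  then have "\<forall>\<^sub>F n in sequentially. proportion F {g. dist (T g x) (T g y) < \<delta>} n \<ge> 1 / 2"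
  proof eventually_elim
    case (elim n)
    define C where "C = {g. dist (T g x) (T g y) < \<delta>}"
    have card0: "real (card (F n)) > 0" using F fin[of n] by (auto simp: folner_sequence_def card_gt_0_iff)
    have "\<delta> * real (card (F n - C)) = (\<Sum>g\<in>F n - C. \<delta>)" by (simp add: mult.commute)
    also have "\<dots> \<le> (\<Sum>g\<in>F n - C. d (T2 g (x, y)))"
      by (intro sum_mono) (auto simp: C_def d_def T2_def)
    also have "\<dots> \<le> (\<Sum>g\<in>F n. d (T2 g (x, y)))"
      by (intro sum_mono2 fin) (auto simp: d_def)
    also have "\<dots> \<le> \<delta> / 2 * real (card (F n))"
      using elim card0 cont_d by (simp add: average_def divide_less_eq)
    finally have "real (card (F n - C)) \<le> real (card (F n)) / 2"
      using \<delta> by (simp add: field_simps)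
    moreover have "real (card (F n)) = real (card (F n \<inter> C)) + real (card (F n - C))"
      using card_Int_Diff[OF fin, of n C] by linarith
    ultimately have "real (card (F n)) / 2 \<le> real (card (F n \<inter> C))" by linarith
    then show ?case using card0 unfolding proportion_def C_def[symmetric] by (simp add: field_simps)
  qed
  then show "\<exists>\<^sub>F n in sequentially. proportion F {g. dist (T g x) (T g y) < \<delta>} n \<ge> 1 / 2"
    by (rule eventually_frequently[OF sequentially_bot])
qed

end

section \<open>Extreme invariant states are ergodic\<close>

context state
begin

lemma measurable_M: "cont f \<Longrightarrow> f \<in> borel_measurable M"
  unfolding measurable_cong_sets[OF sets_M refl] by (rule borel_measurable_continuous_onI)

lemma integrable_M:
  assumes f: "cont f" shows "integrable M f"
proof -
  interpret prob_space M by (rule prob_space_M)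
  obtain b where b: "\<And>x. \<bar>f x\<bar> \<le> b" using cont_bounded[OF compact_space f] by blast
  show ?thesis by (rule integrable_const_bound[of _ b]) (use b measurable_M[OF f] in auto)
qed

lemma M_eqI:
  assumes N: "prob_space N" "sets N = sets borel"
    and eq: "\<And>f. cont f \<Longrightarrow> integral\<^sup>L N f = \<Lambda> f"
  shows "N = M"
proof (rule borel_measure_eqI)
  show "finite_measure N" "finite_measure M"
    using N(1) prob_space_M by (simp_all add: prob_space.finite_measure)
qed (use N(2) eq integral_M in auto)

lemma integral_uniform_M:
  assumes B: "B \<in> sets borel" and b: "measure M B > 0" and f: "cont f"
  shows "integral\<^sup>L (uniform_measure M B) f = (\<integral>x. f x * indicator B x \<partial>M) / measure M B"
proof -
  interpret prob_space M by (rule prob_space_M)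
  have "uniform_measure M B = density M (\<lambda>x. ennreal (indicator B x / measure M B))"
    unfolding uniform_measure_def using b
    by (intro arg_cong2[where f = density] ext refl)
      (auto simp: indicator_def emeasure_eq_measure divide_ennreal[symmetric])
  moreover have "integral\<^sup>L (density M (\<lambda>x. ennreal (indicator B x / measure M B))) f =
      (\<integral>x. (indicator B x / measure M B) *\<^sub>R f x \<partial>M)"
  proof (rule integral_density)
    show "(\<lambda>x. indicator B x / measure M B) \<in> borel_measurable M"
      using B by (intro borel_measurable_divide borel_measurable_indicator) auto
  qed (use measurable_M[OF f] in auto)
  ultimately have "integral\<^sup>L (uniform_measure M B) f = (\<integral>x. (indicator B x / measure M B) *\<^sub>R f x \<partial>M)"
    by simp
  also have "\<dots> = (\<integral>x. f x * indicator B x / measure M B \<partial>M)"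
    by (intro Bochner_Integration.integral_cong) auto
  finally show ?thesis by simp
qed

end

context compact_action
begin

lemma measurable_T2: "sets N = sets borel \<Longrightarrow> T2 g \<in> measurable N borel"
  unfolding measurable_cong_sets[OF _ refl, of N borel] by (rule borel_measurable_continuous_onI[OF continuous_T2])

lemma distr_T2:
  assumes \<Lambda>: "\<Lambda> \<in> invariant_states \<epsilon>"
  shows "distr (state.M \<Lambda>) borel (T2 g) = state.M \<Lambda>"
proof -
  interpret state \<Lambda> by (rule invariant_statesD(1)[OF \<Lambda>])
  interpret prob_space M by (rule prob_space_M)
  show ?thesis
  proof (rule M_eqI)
    show "prob_space (distr M borel (T2 g))" by (rule prob_space_distr[OF measurable_T2]) simp
    fix f :: "'x \<times> 'x \<Rightarrow> real" assume f: "cont f"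
    have "integral\<^sup>L (distr M borel (T2 g)) f = (\<integral>p. f (T2 g p) \<partial>M)"
      by (rule integral_distr[OF measurable_T2 borel_measurable_continuous_onI[OF f]]) simp
    also have "\<dots> = \<Lambda> f"
      using integral_M[OF cont_T2[OF f]] invariant_statesD(3)[OF \<Lambda> f] by simp
    finally show "integral\<^sup>L (distr M borel (T2 g)) f = \<Lambda> f" .
  qed simp
qed

lemma invariant_prob_T2:
  assumes \<Lambda>: "\<Lambda> \<in> invariant_states \<epsilon>"
  shows "invariant_prob T2 (state.M \<Lambda>)"
proof -
  interpret state \<Lambda> by (rule invariant_statesD(1)[OF \<Lambda>])
  have "T2 g \<in> measurable M M" for g
    unfolding measurable_cong_sets[OF refl sets_M] by (rule measurable_T2[OF sets_M])
  moreover have "distr M M (T2 g) = M" for g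
  proof -
    have "distr M M (T2 g) = distr M borel (T2 g)" by (rule distr_cong[OF refl sets_M refl])
    then show ?thesis unfolding distr_T2[OF \<Lambda>] .
  qed
  ultimately show ?thesis using prob_space_M by (simp add: invariant_prob_def)
qed

text \<open>
  Conditioning on an invariant set preserves invariance and the concentration on close pairs.
\<close>

lemma conditional_state:
  assumes \<Lambda>: "\<Lambda> \<in> invariant_states \<epsilon>"
    and B: "B \<in> sets borel" "\<And>g. T2 g -` B = B" "measure (state.M \<Lambda>) B > 0"
  shows "(\<lambda>f. if cont f then (\<integral>p. f p * indicator B p \<partial>state.M \<Lambda>) / measure (state.M \<Lambda>) B else 0)
    \<in> invariant_states \<epsilon>" (is "?\<Lambda>' \<in> _")
proof -
  interpret state \<Lambda> by (rule invariant_statesD(1)[OF \<Lambda>])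
  interpret prob_space M by (rule prob_space_M)
  have BM: "B \<in> sets M" using B(1) by simp
  have int: "integrable M (\<lambda>p. f p * indicator B p)" if "cont f" for f :: "'x \<times> 'x \<Rightarrow> real"
    by (rule integrable_real_mult_indicator[OF BM integrable_M[OF that]])
  show ?thesis unfolding invariant_states_def mem_Collect_eq
  proof (intro conjI allI impI)
    show "?\<Lambda>' f = 0" if "\<not> cont f" for f using that by simp
    show "?\<Lambda>' (\<lambda>x. f x + g x) = ?\<Lambda>' f + ?\<Lambda>' g" if fg: "cont f \<and> cont g" for f g
    proof -
      have "(\<integral>p. (f p + g p) * indicator B p \<partial>M) = (\<integral>p. f p * indicator B p + g p * indicator B p \<partial>M)"
        by (simp add: distrib_right)
      also have "\<dots> = (\<integral>p. f p * indicator B p \<partial>M) + (\<integral>p. g p * indicator B p \<partial>M)"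
        using fg by (intro Bochner_Integration.integral_add int) auto
      finally show ?thesis using fg by (simp add: continuous_on_add add_divide_distrib)
    qed
    show "?\<Lambda>' (\<lambda>x. c * f x) = c * ?\<Lambda>' f" if f: "cont f" for c f
      using f by (simp add: continuous_on_mult_left mult.assoc)
    show "0 \<le> ?\<Lambda>' f" if f: "cont f \<and> (\<forall>x. 0 \<le> f x)" for f
    proof -
      have "0 \<le> f x" for x using f by blast
      then have "0 \<le> (\<integral>p. f p * indicator B p \<partial>M)" by (intro integral_nonneg_AE AE_I2) simp
      then show ?thesis by simp
    qed
    show "?\<Lambda>' (\<lambda>_. 1) = 1" using B(3) BM by simp
    show "?\<Lambda>' (\<lambda>p. f (T2 g p)) = ?\<Lambda>' f" if f: "cont f" for g f
    proof -
      have "indicator B p = (indicator B (T2 g p) :: real)" for p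
        using B(2)[of g] by (auto simp: indicator_def)
      then have "(\<integral>p. f (T2 g p) * indicator B p \<partial>M) = (\<integral>p. f (T2 g p) * indicator B (T2 g p) \<partial>M)"
        by simp
      also have "\<dots> = (\<integral>p. f p * indicator B p \<partial>distr M borel (T2 g))"
        by (rule integral_distr[symmetric, OF measurable_T2[OF sets_M] borel_measurable_times[OF
            borel_measurable_continuous_onI[OF f] borel_measurable_indicator[OF B(1)]]])
      finally show ?thesis using f cont_T2[OF f] by (simp add: distr_T2[OF \<Lambda>])
    qed
    have cm: "cont (\<lambda>p. max 0 (d p - \<epsilon>))" using cont_d by (intro continuous_intros)
    have "(\<integral>p. max 0 (d p - \<epsilon>) * indicator B p \<partial>M) \<le> (\<integral>p. max 0 (d p - \<epsilon>) \<partial>M)"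
      by (intro integral_mono int integrable_M cm) (auto simp: indicator_def)
    also have "\<dots> = 0" using integral_M[OF cm] invariant_statesD(4)[OF \<Lambda>] by simp
    finally have "(\<integral>p. max 0 (d p - \<epsilon>) * indicator B p \<partial>M) \<le> 0" .
    moreover have "0 \<le> (\<integral>p. max 0 (d p - \<epsilon>) * indicator B p \<partial>M)"
      by (intro integral_nonneg_AE AE_I2) simp
    ultimately show "?\<Lambda>' (\<lambda>p. max 0 (d p - \<epsilon>)) = 0" by simp
  qed
qed

text \<open>
  An invariant set \<open>B\<close> of measure strictly between zero and one exhibits the state as a proper convex
  combination of the states conditioned on \<open>B\<close> and on its complement. Extremality identifies the
  state with the one conditioned on \<open>B\<close>, and then the complement of \<open>B\<close> would be a null set.
\<close>

lemma ergodic_if_extreme: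
  assumes \<Lambda>: "\<Lambda> \<in> invariant_states \<epsilon>"
    and extreme: "\<And>\<Phi> \<Psi> t. \<Phi> \<in> invariant_states \<epsilon> \<Longrightarrow> \<Psi> \<in> invariant_states \<epsilon> \<Longrightarrow> 0 < t \<Longrightarrow> t < 1 \<Longrightarrow>
      (\<And>f. \<Lambda> f = t * \<Phi> f + (1 - t) * \<Psi> f) \<Longrightarrow> \<Phi> = \<Lambda> \<and> \<Psi> = \<Lambda>"
  shows "ergodic T2 (state.M \<Lambda>)"
  unfolding ergodic_def
proof (intro conjI ballI impI invariant_prob_T2[OF \<Lambda>])
  interpret state \<Lambda> by (rule invariant_statesD(1)[OF \<Lambda>])
  interpret prob_space M by (rule prob_space_M)
  fix B assume "B \<in> sets M" and "\<forall>g. T2 g -` B \<inter> space M = B"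
  then have B: "B \<in> sets borel" "\<And>g. T2 g -` B = B" by auto
  then have C: "- B \<in> sets borel" "\<And>g. T2 g -` (- B) = - B"
    by (simp_all add: vimage_Compl)
  define b where "b = measure M B"
  have compl: "measure M (- B) = 1 - b"
    using prob_compl[of B] B(1) by (simp add: b_def Compl_eq_Diff_UNIV)
  show "emeasure M B = 0 \<or> emeasure M B = 1"
  proof (rule ccontr)
    assume "\<not> ?thesis"
    then have "b \<noteq> 0" "b \<noteq> 1" by (auto simp: b_def emeasure_eq_measure)
    then have b: "0 < b" "b < 1" using measure_nonneg[of M B] prob_le_1[of B] by (auto simp: b_def less_le)
    define \<Phi> where "\<Phi> = (\<lambda>f. if cont f then (\<integral>p. f p * indicator B p \<partial>M) / measure M B else 0)"
    define \<Psi> where "\<Psi> = (\<lambda>f. if cont f then (\<integral>p. f p * indicator (- B) p \<partial>M) / measure M (- B) else 0)"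
    have "\<Phi> \<in> invariant_states \<epsilon>" unfolding \<Phi>_def
      by (rule conditional_state[OF \<Lambda> B]) (use b in \<open>simp add: b_def\<close>)
    moreover have "\<Psi> \<in> invariant_states \<epsilon>" unfolding \<Psi>_def
      by (rule conditional_state[OF \<Lambda> C]) (use b compl in simp)
    moreover have "\<Lambda> f = b * \<Phi> f + (1 - b) * \<Psi> f" for f
    proof (cases "cont f")
      case True
      have "f p = f p * indicator B p + f p * indicator (- B) p" for p by (auto simp: indicator_def)
      then have "(\<integral>p. f p \<partial>M) = (\<integral>p. f p * indicator B p + f p * indicator (- B) p \<partial>M)" by simp
      also have "\<dots> = (\<integral>p. f p * indicator B p \<partial>M) + (\<integral>p. f p * indicator (- B) p \<partial>M)"
        using B(1) C(1) integrable_M[OF True]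
        by (intro Bochner_Integration.integral_add integrable_real_mult_indicator) auto
      finally show ?thesis using True b compl integral_M[OF True] by (simp add: \<Phi>_def \<Psi>_def b_def)
    next
      case False
      then show ?thesis using invariant_statesD(2)[OF \<Lambda> False] by (simp add: \<Phi>_def \<Psi>_def)
    qed
    ultimately have eq: "\<Phi> = \<Lambda>" using extreme b by blast
    have "uniform_measure M B = M"
    proof (rule M_eqI)
      show "prob_space (uniform_measure M B)"
        using b by (intro prob_space_uniform_measure) (auto simp: emeasure_eq_measure b_def)
      show "integral\<^sup>L (uniform_measure M B) f = \<Lambda> f" if f: "cont f" for f
        using integral_uniform_M[OF B(1) _ f] b f fun_cong[OF eq, of f] by (simp add: \<Phi>_def b_def)
    qed simp
    then have "measure (uniform_measure M B) (- B) = 1 - b" using compl by simp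
    moreover have "measure (uniform_measure M B) (- B) = 0"
      using b B(1) C(1) by (subst measure_uniform_measure) (auto simp: emeasure_eq_measure b_def)
    ultimately show False using b by simp
  qed
qed

end

section \<open>Self-joinings of order two\<close>

text \<open>
  The identification of pairs with functions on \<open>{..<2}\<close>, in which the powers of a space are
  formed.
\<close>

definition to_fun :: "'x \<times> 'x \<Rightarrow> nat \<Rightarrow> 'x" where
  "to_fun p = (\<lambda>i\<in>{..<2}. if i = 0 then fst p else snd p)"

definition rect :: "'x set \<Rightarrow> 'x set \<Rightarrow> (nat \<Rightarrow> 'x) set" where
  "rect B C = PiE {..<2} (\<lambda>i. if i = 0 then B else C)"

lemma to_fun_in_rect: "to_fun p \<in> rect B C \<longleftrightarrow> fst p \<in> B \<and> snd p \<in> C"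
proof -
  have two: "{..<2} = {0, 1 :: nat}" by auto
  show ?thesis unfolding rect_def to_fun_def restrict_PiE_iff two by auto
qed

lemma rect_in_sets:
  "B \<in> sets borel \<Longrightarrow> C \<in> sets borel \<Longrightarrow> rect B C \<in> sets (borel_power {..<2})"
  unfolding rect_def by (rule sets_PiM_I_finite) auto

lemma measurable_to_fun:
  fixes N :: "('x::metric_space \<times> 'x) measure"
  assumes "sets N = sets borel" shows "to_fun \<in> measurable N (borel_power {..<2})"
  unfolding to_fun_def
proof (rule measurable_restrict)
  fix i
  have "(\<lambda>p :: 'x \<times> 'x. if i = 0 then fst p else snd p) \<in> borel_measurable borel"
    by (rule borel_measurable_continuous_onI) (cases "i = 0"; simp add: continuous_intros)
  then show "(\<lambda>p :: 'x \<times> 'x. if i = 0 then fst p else snd p) \<in> borel_measurable N"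
    unfolding measurable_cong_sets[OF assms refl] .
qed

context compact_action
begin

lemma measurable_T: "T g \<in> measurable borel borel"
  by (rule borel_measurable_continuous_onI[OF continuous_T])

lemma measurable_diagonal_action: "diagonal_action T I g \<in> measurable (borel_power I) (borel_power I)"
  unfolding diagonal_action_def
  by (rule measurable_restrict, rule measurable_compose[OF _ measurable_T], rule measurable_component_singleton)

lemma to_fun_T2: "to_fun (T2 g p) = diagonal_action T {..<2} g (to_fun p)"
  by (auto simp: to_fun_def T2_def diagonal_action_def fun_eq_iff)

lemma emeasure_distr_to_fun:
  fixes M :: "('x \<times> 'x) measure"
  assumes "sets M = sets borel" "B \<in> sets borel" "C \<in> sets borel"
  shows "emeasure (distr M (borel_power {..<2}) to_fun) (rect B C) = emeasure M (B \<times> C)"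
proof -
  have "to_fun -` rect B C \<inter> space M = B \<times> C"
    using sets_eq_imp_space_eq[OF assms(1)] by (auto simp: to_fun_in_rect)
  then show ?thesis
    using emeasure_distr[OF measurable_to_fun[OF assms(1)] rect_in_sets[OF assms(2,3)]] by simp
qed

lemma ergodic_distr_to_fun:
  assumes M: "sets M = sets borel" and erg: "ergodic T2 M"
  shows "ergodic (diagonal_action T {..<2}) (distr M (borel_power {..<2}) to_fun)"
proof -
  define \<nu> where "\<nu> = distr M (borel_power {..<2}) (to_fun :: 'x \<times> 'x \<Rightarrow> nat \<Rightarrow> 'x)"
  have sets_\<nu>: "sets \<nu> = sets (borel_power {..<2})" by (simp add: \<nu>_def)
  have spM: "space M = UNIV" using sets_eq_imp_space_eq[OF M] by simp
  note e = measurable_to_fun[OF M]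
  have inv: "invariant_prob T2 M" using erg by (simp add: ergodic_def)
  then have T2: "T2 g \<in> measurable M M" "distr M M (T2 g) = M" for g by (auto simp: invariant_prob_def)
  have "prob_space \<nu>" unfolding \<nu>_def
    using inv by (intro prob_space.prob_space_distr[OF _ e]) (simp add: invariant_prob_def)
  moreover have meas: "diagonal_action T {..<2} g \<in> measurable \<nu> \<nu>" for g
    unfolding measurable_cong_sets[OF sets_\<nu> sets_\<nu>] by (rule measurable_diagonal_action)
  moreover have "distr \<nu> \<nu> (diagonal_action T {..<2} g) = \<nu>" for g
  proof -
    have "distr \<nu> \<nu> (diagonal_action T {..<2} g) = distr \<nu> (borel_power {..<2}) (diagonal_action T {..<2} g)"
      by (rule distr_cong[OF refl sets_\<nu> refl])
    also have "\<dots> = distr M (borel_power {..<2}) (diagonal_action T {..<2} g \<circ> to_fun)"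
      unfolding \<nu>_def by (rule distr_distr[OF measurable_diagonal_action e])
    also have "diagonal_action T {..<2} g \<circ> to_fun = to_fun \<circ> T2 g"
      by (simp add: fun_eq_iff to_fun_T2)
    also have "distr M (borel_power {..<2}) (to_fun \<circ> T2 g) = distr (distr M M (T2 g)) (borel_power {..<2}) to_fun"
      by (rule distr_distr[symmetric, OF e T2(1)])
    finally show ?thesis by (simp add: T2(2) \<nu>_def)
  qed
  ultimately have inv\<nu>: "invariant_prob (diagonal_action T {..<2}) \<nu>" by (simp add: invariant_prob_def)
  have "emeasure \<nu> A = 0 \<or> emeasure \<nu> A = 1"
    if A: "A \<in> sets \<nu>" "\<forall>g. diagonal_action T {..<2} g -` A \<inter> space \<nu> = A" for A
  proof -
    have A': "A \<in> sets (borel_power {..<2})" using A(1) sets_\<nu> by simp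
    define B where "B = to_fun -` A \<inter> space M"
    have B: "B \<in> sets M" unfolding B_def by (rule measurable_sets[OF e A'])
    have "T2 g -` B \<inter> space M = B" for g
    proof -
      have "to_fun (T2 g p) \<in> A \<longleftrightarrow> to_fun p \<in> A" for p
      proof -
        have "to_fun p \<in> space \<nu>"
          using measurable_space[OF e, of p] spM sets_eq_imp_space_eq[OF sets_\<nu>] by simp
        then show ?thesis unfolding to_fun_T2 using A(2) by blast
      qed
      then show ?thesis unfolding B_def spM by (simp add: vimage_def)
    qed
    then have "emeasure M B = 0 \<or> emeasure M B = 1" using erg B by (auto simp: ergodic_def)
    moreover have "emeasure \<nu> A = emeasure M B"
      unfolding \<nu>_def B_def by (rule emeasure_distr[OF e A'])
    ultimately show ?thesis by simp
  qed
  then show ?thesis using inv\<nu> unfolding \<nu>_def[symmetric] ergodic_def by blast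
qed

text \<open>
  Both marginals are invariant measures on the base, and there is only one.
\<close>

lemma self_joining_distr_to_fun:
  assumes M: "sets M = sets borel" and erg: "ergodic T2 M"
    and \<mu>: "sets \<mu> = sets borel" "invariant_prob T \<mu>" "uniquely_ergodic T"
  shows "self_joining T \<mu> 2 (distr M (borel_power {..<2}) to_fun)"
proof -
  note e = measurable_to_fun[OF M]
  have inv: "invariant_prob T2 M" using erg by (simp add: ergodic_def)
  then have T2: "T2 g \<in> measurable M M" "distr M M (T2 g) = M" for g by (auto simp: invariant_prob_def)
  have marginal: "distr M borel \<pi> = \<mu>"
    if \<pi>: "continuous_on UNIV \<pi>" "\<And>g p. \<pi> (T2 g p) = T g (\<pi> p)" for \<pi> :: "'x \<times> 'x \<Rightarrow> 'x"
  proof -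
    have m: "\<pi> \<in> measurable M borel"
      unfolding measurable_cong_sets[OF M refl] by (rule borel_measurable_continuous_onI[OF \<pi>(1)])
    have "prob_space (distr M borel \<pi>)"
      using inv by (intro prob_space.prob_space_distr[OF _ m]) (simp add: invariant_prob_def)
    moreover have "T g \<in> measurable (distr M borel \<pi>) (distr M borel \<pi>)" for g
      unfolding measurable_cong_sets[OF sets_distr sets_distr] by (rule measurable_T)
    moreover have "distr (distr M borel \<pi>) (distr M borel \<pi>) (T g) = distr M borel \<pi>" for g
    proof -
      have "distr (distr M borel \<pi>) (distr M borel \<pi>) (T g) = distr (distr M borel \<pi>) borel (T g)"
        by (rule distr_cong[OF refl sets_distr refl])
      also have "\<dots> = distr M borel (T g \<circ> \<pi>)" by (rule distr_distr[OF measurable_T m])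
      also have "T g \<circ> \<pi> = \<pi> \<circ> T2 g" by (simp add: fun_eq_iff \<pi>(2))
      also have "distr M borel (\<pi> \<circ> T2 g) = distr (distr M M (T2 g)) borel \<pi>"
        by (rule distr_distr[symmetric, OF m T2(1)])
      finally show ?thesis by (simp add: T2(2))
    qed
    ultimately have "invariant_prob T (distr M borel \<pi>)" by (simp add: invariant_prob_def)
    then show ?thesis using \<mu> unfolding uniquely_ergodic_def by (metis sets_distr)
  qed
  have "distr (distr M (borel_power {..<2}) to_fun) borel (\<lambda>x. x i) = \<mu>" if i: "i < 2" for i
  proof -
    have "distr (distr M (borel_power {..<2}) to_fun) borel (\<lambda>x. x i) = distr M borel ((\<lambda>x. x i) \<circ> to_fun)"
      by (rule distr_distr[OF measurable_component_singleton e]) (use i in simp)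
    also have "\<dots> = \<mu>"
    proof (rule marginal)
      have "(\<lambda>x. x i) \<circ> to_fun = (\<lambda>p :: 'x \<times> 'x. if i = 0 then fst p else snd p)"
        using i by (simp add: fun_eq_iff to_fun_def)
      then show "continuous_on UNIV ((\<lambda>x. x i) \<circ> to_fun :: 'x \<times> 'x \<Rightarrow> 'x)"
        by (cases "i = 0") (simp_all add: continuous_intros)
      show "((\<lambda>x. x i) \<circ> to_fun) (T2 g p) = T g (((\<lambda>x. x i) \<circ> to_fun) p)" for g p
        using i by (simp add: to_fun_def T2_def)
    qed
    finally show ?thesis .
  qed
  then show ?thesis
    using ergodic_distr_to_fun[OF M erg] by (simp add: self_joining_def ergodic_def)
qed

lemma off_diagonal_measure:
  assumes \<mu>: "sets \<mu> = sets borel" "prob_space \<mu>" and I: "finite I"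
  shows "sets (off_diagonal_measure T \<mu> I g) = sets (borel_power I)"
    and "prob_space (off_diagonal_measure T \<mu> I g)"
    and "(\<And>i. i \<in> I \<Longrightarrow> B i \<in> sets borel) \<Longrightarrow>
      emeasure (off_diagonal_measure T \<mu> I g) (PiE I B) = emeasure \<mu> {x. \<forall>i\<in>I. T (g i) x \<in> B i}"
proof -
  have d: "(\<lambda>x. \<lambda>i\<in>I. x) \<in> measurable \<mu> (borel_power I)"
    by (intro measurable_restrict) (simp add: measurable_ident_sets[OF \<mu>(1)])
  have sd: "sets (diagonal_measure \<mu> I) = sets (borel_power I)" by (simp add: diagonal_measure_def)
  have m: "(\<lambda>x. \<lambda>i\<in>I. T (g i) (x i)) \<in> measurable (diagonal_measure \<mu> I) (borel_power I)"
    unfolding measurable_cong_sets[OF sd refl]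
    by (rule measurable_restrict, rule measurable_compose[OF _ measurable_T], rule measurable_component_singleton)
  show "sets (off_diagonal_measure T \<mu> I g) = sets (borel_power I)" by (simp add: off_diagonal_measure_def)
  show "prob_space (off_diagonal_measure T \<mu> I g)"
    unfolding off_diagonal_measure_def diagonal_measure_def
    using m by (intro prob_space.prob_space_distr[OF prob_space.prob_space_distr[OF \<mu>(2) d]])
      (simp add: diagonal_measure_def)
  assume B: "\<And>i. i \<in> I \<Longrightarrow> B i \<in> sets borel"
  have pre: "(\<lambda>x. \<lambda>i\<in>I. T (g i) (x i)) -` PiE I B \<inter> space (diagonal_measure \<mu> I) = PiE I (\<lambda>i. T (g i) -` B i)"
    using sets_eq_imp_space_eq[OF sd] by (auto simp: space_PiM PiE_iff)
  have "emeasure (off_diagonal_measure T \<mu> I g) (PiE I B) =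
      emeasure (diagonal_measure \<mu> I) (PiE I (\<lambda>i. T (g i) -` B i))"
    unfolding off_diagonal_measure_def
    by (subst emeasure_distr[OF m]) (use B I pre in \<open>auto intro: sets_PiM_I_finite\<close>)
  also have "\<dots> = emeasure \<mu> (\<Inter>i\<in>I. T (g i) -` B i)"
    by (rule emeasure_diagonal_measure[OF \<mu>(1) I])
      (use B measurable_sets[OF measurable_T] in \<open>auto\<close>)
  also have "(\<Inter>i\<in>I. T (g i) -` B i) = {x. \<forall>i\<in>I. T (g i) x \<in> B i}" by auto
  finally show "emeasure (off_diagonal_measure T \<mu> I g) (PiE I B) = emeasure \<mu> {x. \<forall>i\<in>I. T (g i) x \<in> B i}" .
qed

text \<open>
  On a box the product measure factorises over the blocks of the partition \<open>b\<close>, and within a block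
  an off-diagonal measure is the distribution of \<open>x \<mapsto> (T (g i) x)\<^sub>i\<close>.
\<close>

lemma emeasure_product_of_off_diagonals:
  fixes k :: nat
  assumes \<mu>: "sets \<mu> = sets borel" "prob_space \<mu>" and b: "b ` {..<N} = {..<k}"
    and B: "\<And>i. i < N \<Longrightarrow> B i \<in> sets borel"
  shows "emeasure (distr (PiM {..<k} (\<lambda>j. off_diagonal_measure T \<mu> {i \<in> {..<N}. b i = j} g))
      (borel_power {..<N}) (\<lambda>\<omega>. \<lambda>i\<in>{..<N}. \<omega> (b i) i)) (PiE {..<N} B) =
    (\<Prod>j<k. emeasure \<mu> {x. \<forall>i\<in>{i \<in> {..<N}. b i = j}. T (g i) x \<in> B i})"
proof -
  define I where "I = (\<lambda>j. {i \<in> {..<N}. b i = j})"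
  define Q where "Q = (\<lambda>j. off_diagonal_measure T \<mu> (I j) g)"
  have I: "finite (I j)" for j by (simp add: I_def)
  have Q1: "sets (Q j) = sets (borel_power (I j))" and Q2: "prob_space (Q j)" for j
    unfolding Q_def by (rule off_diagonal_measure[OF \<mu> I])+
  have Q3: "emeasure (Q j) (PiE (I j) B) = emeasure \<mu> {x. \<forall>i\<in>I j. T (g i) x \<in> B i}" for j
    unfolding Q_def by (rule off_diagonal_measure(3)[OF \<mu> I]) (use B in \<open>simp add: I_def\<close>)
  interpret Q: product_prob_space Q by (rule product_prob_spaceI[OF Q2])
  have bk: "b i < k" if "i < N" for i using b that by auto
  have m: "(\<lambda>\<omega>. \<lambda>i\<in>{..<N}. \<omega> (b i) i) \<in> measurable (PiM {..<k} Q) (borel_power {..<N})"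
  proof (rule measurable_restrict)
    fix i assume i: "i \<in> {..<N}"
    have "(\<lambda>\<omega>. \<omega> (b i)) \<in> measurable (PiM {..<k} Q) (Q (b i))"
      by (rule measurable_component_singleton) (use bk i in simp)
    moreover have "(\<lambda>x. x i) \<in> measurable (Q (b i)) borel"
      unfolding measurable_cong_sets[OF Q1 refl]
      by (rule measurable_component_singleton) (use i in \<open>simp add: I_def\<close>)
    ultimately show "(\<lambda>\<omega>. \<omega> (b i) i) \<in> measurable (PiM {..<k} Q) borel"
      by (rule measurable_compose)
  qed
  have spQ: "space (Q j) = PiE (I j) (\<lambda>_. UNIV)" for j
    using sets_eq_imp_space_eq[OF Q1[of j]] by (simp add: space_PiM)
  have pre: "(\<lambda>\<omega>. \<lambda>i\<in>{..<N}. \<omega> (b i) i) -` PiE {..<N} B \<inter> space (PiM {..<k} Q) =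
      PiE {..<k} (\<lambda>j. PiE (I j) B)"
  proof (intro set_eqI iffI)
    fix \<omega> assume "\<omega> \<in> (\<lambda>\<omega>. \<lambda>i\<in>{..<N}. \<omega> (b i) i) -` PiE {..<N} B \<inter> space (PiM {..<k} Q)"
    then have *: "\<And>i. i < N \<Longrightarrow> \<omega> (b i) i \<in> B i" "\<omega> \<in> PiE {..<k} (\<lambda>j. PiE (I j) (\<lambda>_. UNIV))"
      by (auto simp: space_PiM spQ Pi_iff)
    show "\<omega> \<in> PiE {..<k} (\<lambda>j. PiE (I j) B)"
    proof (rule PiE_I)
      fix j assume "j \<in> {..<k}"
      then have "\<omega> j \<in> PiE (I j) (\<lambda>_. UNIV)" using *(2) by (rule PiE_mem[rotated])
      moreover have "\<omega> j i \<in> B i" if "i \<in> I j" for i using *(1)[of i] that by (simp add: I_def)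
      ultimately show "\<omega> j \<in> PiE (I j) B" by (simp add: PiE_iff)
    qed (rule PiE_arb[OF *(2)])
  next
    fix \<omega> assume \<omega>: "\<omega> \<in> PiE {..<k} (\<lambda>j. PiE (I j) B)"
    have "\<omega> j \<in> PiE (I j) B" if "j < k" for j using PiE_mem[OF \<omega>, of j] that by simp
    then have "\<omega> (b i) i \<in> B i" if "i < N" for i
      using bk[OF that] that PiE_mem[of "\<omega> (b i)" "I (b i)" B i] by (simp add: I_def)
    moreover have "\<omega> \<in> PiE {..<k} (\<lambda>j. PiE (I j) (\<lambda>_. UNIV))"
      by (rule PiE_mono[THEN subsetD, OF PiE_mono \<omega>]) simp
    ultimately show "\<omega> \<in> (\<lambda>\<omega>. \<lambda>i\<in>{..<N}. \<omega> (b i) i) -` PiE {..<N} B \<inter> space (PiM {..<k} Q)"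
      by (simp add: space_PiM spQ restrict_PiE_iff)
  qed
  have "emeasure (distr (PiM {..<k} Q) (borel_power {..<N}) (\<lambda>\<omega>. \<lambda>i\<in>{..<N}. \<omega> (b i) i)) (PiE {..<N} B)
      = emeasure (PiM {..<k} Q) (PiE {..<k} (\<lambda>j. PiE (I j) B))"
  proof -
    have "PiE {..<N} B \<in> sets (borel_power {..<N})" by (rule sets_PiM_I_finite) (use B in simp_all)
    from emeasure_distr[OF m this] show ?thesis unfolding pre .
  qed
  also have "\<dots> = (\<Prod>j<k. emeasure (Q j) (PiE (I j) B))"
  proof (rule Q.emeasure_PiM)
    fix j
    show "PiE (I j) B \<in> sets (Q j)"
      unfolding Q1 by (rule sets_PiM_I_finite[OF I]) (use B in \<open>simp add: I_def\<close>)
  qed simp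
  also have "\<dots> = (\<Prod>j<k. emeasure \<mu> {x. \<forall>i\<in>I j. T (g i) x \<in> B i})"
    by (intro prod.cong refl Q3)
  finally show ?thesis by (simp only: Q_def I_def)
qed

text \<open>
  The two coordinates either lie in the same block or in different ones.
\<close>

lemma trivial_joining_2_cases:
  assumes \<mu>: "sets \<mu> = sets borel" "prob_space \<mu>" and triv: "trivial_joining T \<mu> 2 \<nu>"
  obtains g h where "\<And>B C. B \<in> sets borel \<Longrightarrow> C \<in> sets borel \<Longrightarrow>
      emeasure \<nu> (rect B C) = emeasure \<mu> {x. T g x \<in> B \<and> T h x \<in> C}"
  | g h where "\<And>B C. B \<in> sets borel \<Longrightarrow> C \<in> sets borel \<Longrightarrow>
      emeasure \<nu> (rect B C) = emeasure \<mu> {x. T g x \<in> B} * emeasure \<mu> {x. T h x \<in> C}"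
proof -
  obtain k b g where b: "b ` {..<2::nat} = {..<k::nat}" and
    \<nu>: "\<nu> = distr (PiM {..<k} (\<lambda>j. off_diagonal_measure T \<mu> {i \<in> {..<2}. b i = j} g))
                  (borel_power {..<2}) (\<lambda>\<omega>. \<lambda>i\<in>{..<2}. \<omega> (b i) i)"
    using triv unfolding trivial_joining_def by blast
  have two: "{..<2} = {0, 1 :: nat}" by auto
  have k: "{..<k} = {b 0, b 1}" using b unfolding two by auto
  have form: "emeasure \<nu> (rect B C) =
      (\<Prod>j\<in>{b 0, b 1}. emeasure \<mu> {x. \<forall>i\<in>{i \<in> {..<2}. b i = j}. T (g i) x \<in> (if i = 0 then B else C)})"
    if "B \<in> sets borel" "C \<in> sets borel" for B C
    unfolding \<nu> rect_def k[symmetric]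
    by (rule emeasure_product_of_off_diagonals[OF \<mu> b]) (use that in simp)
  show ?thesis
  proof (cases "b 0 = b 1")
    case True
    then have s: "{i \<in> {..<2}. b i = b 0} = {0, 1}" unfolding two by auto
    have sing: "(\<Prod>j\<in>{b 0}. P j) = P (b 0)" for P :: "nat \<Rightarrow> ennreal" by simp
    show ?thesis
    proof (rule that(1)[of "g 0" "g 1"])
      fix B C :: "'x set" assume "B \<in> sets borel" "C \<in> sets borel"
      from form[OF this] show "emeasure \<nu> (rect B C) = emeasure \<mu> {x. T (g 0) x \<in> B \<and> T (g 1) x \<in> C}"
        unfolding True[symmetric] insert_absorb2 sing s by simp
    qed
  next
    case False
    then have s: "{i \<in> {..<2}. b i = b 0} = {0}" "{i \<in> {..<2}. b i = b 1} = {1}" unfolding two by auto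
    have sing: "(\<Prod>j\<in>{b 1}. P j) = P (b 1)" for P :: "nat \<Rightarrow> ennreal" by simp
    have fin: "finite {b 1}" "b 0 \<notin> {b 1}" using False by auto
    show ?thesis
    proof (rule that(2)[of "g 0" "g 1"])
      fix B C :: "'x set" assume "B \<in> sets borel" "C \<in> sets borel"
      from form[OF this]
      show "emeasure \<nu> (rect B C) = emeasure \<mu> {x. T (g 0) x \<in> B} * emeasure \<mu> {x. T (g 1) x \<in> C}"
        unfolding prod.insert[OF fin] sing s by simp
    qed
  qed
qed

section \<open>Weakly asymptotic pairs in nonexpansive systems\<close>

text \<open>
  By minimality and compactness, finitely many translates of a nonempty open set cover the space.
\<close>

lemma emeasure_open_pos:
  assumes \<mu>: "sets \<mu> = sets borel" "invariant_prob T \<mu>" and min: "minimal_action T"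
    and U: "open U" "U \<noteq> {}"
  shows "emeasure \<mu> U > 0"
proof (rule ccontr)
  assume "\<not> ?thesis"
  then have U0: "emeasure \<mu> U = 0" by simp
  have inv: "T g \<in> measurable \<mu> \<mu>" "distr \<mu> \<mu> (T g) = \<mu>" "prob_space \<mu>" for g
    using \<mu>(2) by (auto simp: invariant_prob_def)
  have sp: "space \<mu> = UNIV" using sets_eq_imp_space_eq[OF \<mu>(1)] by simp
  have Us: "U \<in> sets \<mu>" using U \<mu>(1) by simp
  have null: "T g -` U \<in> null_sets \<mu>" for g
  proof -
    have "emeasure \<mu> (T g -` U) = emeasure (distr \<mu> \<mu> (T g)) U"
      using emeasure_distr[OF inv(1) Us] sp by simp
    then show ?thesis using U0 measurable_sets[OF inv(1) Us, of g] sp by (simp add: inv(2) null_sets_def)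
  qed
  have op: "open (T g -` U)" for g by (rule open_vimage[OF U(1) continuous_T])
  have cover: "UNIV \<subseteq> (\<Union>g\<in>UNIV. T g -` U)"
  proof
    fix x
    have "closure (range (\<lambda>g. T g x)) = UNIV" using min by (simp add: minimal_action_def)
    then have "U \<inter> range (\<lambda>g. T g x) \<noteq> {}"
      using open_Int_closure_eq_empty[OF U(1), of "range (\<lambda>g. T g x)"] U(2) by simp
    then show "x \<in> (\<Union>g\<in>UNIV. T g -` U)" by auto
  qed
  obtain C where C: "finite C" "UNIV \<subseteq> (\<Union>g\<in>C. T g -` U)"
    by (rule compactE_image[OF compact_space op cover]) auto
  have "(\<Union>g\<in>C. T g -` U) \<in> null_sets \<mu>" using null by (intro null_sets_UN' countable_finite C) auto
  moreover have "(\<Union>g\<in>C. T g -` U) = space \<mu>" using C(2) sp by auto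
  ultimately have "emeasure \<mu> (space \<mu>) = 0" by (simp add: null_sets_def)
  then show False using prob_space.emeasure_space_1[OF inv(3)] by simp
qed

text \<open>
  If \<open>T h\<close> displaces no point by more than \<open>\<rho>\<close>, then it maps no point of \<open>V\<close> into \<open>U\<close>, where
  \<open>U\<close> and \<open>V\<close> are balls further apart than \<open>\<rho>\<close>; mixing permits this for finitely many \<open>h\<close>
  only. Decreasing the threshold below the displacement of a suitable point for each of the
  remaining nontrivial \<open>h\<close> leaves those acting as the identity.
\<close>

lemma displacement_threshold:
  assumes inf: "infinite (UNIV :: 'x set)"
    and \<mu>: "sets \<mu> = sets borel" "invariant_prob T \<mu>" and min: "minimal_action T"
    and mix: "mixing_of_all_orders T \<mu>"
  obtains \<epsilon> :: real and U V :: "'x set" where "0 < \<epsilon>" "open U" "open V" "U \<noteq> {}" "V \<noteq> {}"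
    "\<And>u v. u \<in> U \<Longrightarrow> v \<in> V \<Longrightarrow> dist u v > \<epsilon>"
    "\<And>h z. (\<And>z. dist z (T h z) \<le> \<epsilon>) \<Longrightarrow> T h z = z"
proof -
  obtain a b :: 'x where "a \<noteq> b"
  proof -
    have "UNIV \<noteq> {a}" for a :: 'x
    proof
      assume "UNIV = {a}"
      then have "finite (UNIV :: 'x set)" by (metis finite.emptyI finite_insert)
      then show False using inf by simp
    qed
    then show ?thesis using that by blast
  qed
  define \<rho> where "\<rho> = dist a b / 4"
  have \<rho>: "\<rho> > 0" using \<open>a \<noteq> b\<close> by (simp add: \<rho>_def)
  define U where "U = ball a \<rho>"
  define V where "V = ball b \<rho>"
  have UV: "open U" "open V" "U \<noteq> {}" "V \<noteq> {}" using \<rho> by (simp_all add: U_def V_def)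
  have sep: "dist u v > \<rho>" if "u \<in> U" "v \<in> V" for u v
  proof -
    have "dist a b \<le> dist a u + dist u v + dist v b"
      using dist_triangle[of a b u] dist_triangle[of u b v] by linarith
    moreover have "dist a u < \<rho>" "dist v b < \<rho>" using that by (simp_all add: U_def V_def dist_commute)
    ultimately show ?thesis using \<rho> unfolding \<rho>_def by linarith
  qed
  define H where "H = {h. \<forall>z. dist z (T h z) \<le> \<rho>}"
  define A where "A = (\<lambda>i::nat. if i = 0 then U else V)"
  have "prob_space \<mu>" using \<mu>(2) by (simp add: invariant_prob_def)
  then interpret prob_space \<mu> .
  have pos: "measure \<mu> U > 0" "measure \<mu> V > 0"
    using emeasure_open_pos[OF \<mu> min UV(1,3)] emeasure_open_pos[OF \<mu> min UV(2,4)]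
    by (simp_all add: emeasure_eq_measure)
  have "((\<lambda>g. measure \<mu> (\<Inter>i\<le>1. T (g i) ` A i)) \<longlongrightarrow> (\<Prod>i\<le>1. measure \<mu> (A i))) (differences_to_infinity 1)"
  proof -
    have "\<forall>i\<le>1. A i \<in> sets borel" using UV by (simp add: A_def)
    then show ?thesis using mix unfolding mixing_of_all_orders_def by blast
  qed
  moreover have "(\<Prod>i\<le>1. measure \<mu> (A i)) = measure \<mu> U * measure \<mu> V" by (simp add: A_def atMost_Suc)
  ultimately have lim: "((\<lambda>g. measure \<mu> (\<Inter>i\<le>1. T (g i) ` A i)) \<longlongrightarrow> measure \<mu> U * measure \<mu> V)
      (differences_to_infinity 1)" by (simp only:)
  have "\<forall>\<^sub>F g in differences_to_infinity 1. 0 < measure \<mu> (\<Inter>i\<le>1. T (g i) ` A i)"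
    by (rule order_tendstoD(1)[OF lim mult_pos_pos[OF pos]])
  then obtain K where K: "finite K"
    "\<And>g. \<forall>i\<le>1. \<forall>j\<le>1. i \<noteq> j \<longrightarrow> g j - g i \<notin> K \<Longrightarrow> 0 < measure \<mu> (\<Inter>i\<le>1. T (g i) ` A i)"
    unfolding eventually_differences_to_infinity by blast
  have "H \<subseteq> K \<union> uminus ` K"
  proof
    fix h assume h: "h \<in> H"
    show "h \<in> K \<union> uminus ` K"
    proof (rule ccontr)
      assume no: "h \<notin> K \<union> uminus ` K"
      then have no': "h \<notin> K" "- h \<notin> K" by force+
      define g where "g = (\<lambda>i::nat. if i = 0 then 0 else h)"
      have "0 < measure \<mu> (\<Inter>i\<le>1. T (g i) ` A i)"
        by (rule K(2)) (use no' in \<open>auto simp: g_def\<close>)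
      moreover have "(\<Inter>i\<le>1. T (g i) ` A i) = {}"
      proof (rule equals0I)
        fix p assume p: "p \<in> (\<Inter>i\<le>1. T (g i) ` A i)"
        then have "p \<in> T (g 0) ` A 0" "p \<in> T (g 1) ` A 1" by blast+
        then obtain q where "p \<in> U" "q \<in> V" "p = T h q" by (auto simp: g_def A_def)
        then have "dist p q > \<rho>" "dist q p \<le> \<rho>" using sep h by (auto simp: H_def)
        then show False by (simp add: dist_commute)
      qed
      ultimately show False by simp
    qed
  qed
  then have finH: "finite H" using K(1) by (meson finite_UnI finite_imageI finite_subset)
  define H' where "H' = {h \<in> H. \<exists>z. T h z \<noteq> z}"
  have "\<exists>z. T h z \<noteq> z" if "h \<in> H'" for h using that by (simp add: H'_def)
  then obtain z where z: "\<And>h. h \<in> H' \<Longrightarrow> T h (z h) \<noteq> z h" by metis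
  define D where "D = insert \<rho> ((\<lambda>h. dist (z h) (T h (z h)) / 2) ` H')"
  have D: "finite D" "D \<noteq> {}" using finH by (simp_all add: D_def H'_def)
  define \<epsilon> where "\<epsilon> = Min D"
  have \<epsilon>: "0 < \<epsilon>" unfolding \<epsilon>_def using D z \<rho> by (subst Min_gr_iff) (auto simp: D_def dest: not_sym)
  have \<epsilon>\<rho>: "\<epsilon> \<le> \<rho>" unfolding \<epsilon>_def using D by (intro Min_le) (auto simp: D_def)
  have trivial: "T h y = y" if h: "\<And>z. dist z (T h z) \<le> \<epsilon>" for h y
  proof (rule ccontr)
    assume "T h y \<noteq> y"
    have "h \<in> H" unfolding H_def using h \<epsilon>\<rho> by (blast intro: order_trans)
    then have "h \<in> H'" using \<open>T h y \<noteq> y\<close> by (auto simp: H'_def)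
    then have "\<epsilon> \<le> dist (z h) (T h (z h)) / 2" unfolding \<epsilon>_def using D by (intro Min_le) (auto simp: D_def)
    moreover have "0 < dist (z h) (T h (z h))" using z[OF \<open>h \<in> H'\<close>] by (metis zero_less_dist_iff)
    ultimately show False using h[of "z h"] by linarith
  qed
  show ?thesis
    by (rule that[OF \<epsilon> UV _ trivial]) (use sep \<epsilon>\<rho> in \<open>auto intro: le_less_trans\<close>)
qed

text \<open>
  The set of pairs at distance more than \<open>\<delta>\<close> is covered by finitely many products of disjoint
  balls of radius \<open>\<delta> / 4\<close>.
\<close>

lemma integral_d_le_if_disjoint_rects_null:
  assumes M: "sets M = sets borel" "prob_space M" and \<delta>: "0 < \<delta>" and int: "integrable M d"
    and null: "\<And>B C. open B \<Longrightarrow> open C \<Longrightarrow> B \<inter> C = {} \<Longrightarrow> emeasure M (B \<times> C) = 0"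
  shows "integral\<^sup>L M d \<le> \<delta>"
proof -
  interpret prob_space M by (rule M(2))
  obtain C :: "'x set" where C: "finite C" "UNIV \<subseteq> (\<Union>x\<in>C. ball x (\<delta> / 4))"
  proof (rule compactE_image[OF compact_space, of UNIV "\<lambda>x. ball x (\<delta> / 4)"])
    show "(UNIV :: 'x set) \<subseteq> (\<Union>x\<in>UNIV. ball x (\<delta> / 4))"
    proof
      fix x :: 'x
      have "x \<in> ball x (\<delta> / 4)" using \<delta> by simp
      then show "x \<in> (\<Union>x\<in>UNIV. ball x (\<delta> / 4))" by blast
    qed
  qed auto
  define R where "R = {(p, q). p \<in> C \<and> q \<in> C \<and> ball p (\<delta> / 4) \<inter> ball q (\<delta> / 4) = {}}"
  define N where "N = (\<Union>(p, q)\<in>R. ball p (\<delta> / 4) \<times> ball q (\<delta> / 4))"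
  have "finite R" by (rule finite_subset[of _ "C \<times> C"]) (auto simp: R_def C)
  moreover have "ball p (\<delta> / 4) \<times> ball q (\<delta> / 4) \<in> null_sets M" if "(p, q) \<in> R" for p q
    using null[of "ball p (\<delta> / 4)" "ball q (\<delta> / 4)"] that M(1)
    by (auto simp: null_sets_def R_def open_Times)
  ultimately have "N \<in> null_sets M"
    unfolding N_def by (intro null_sets_UN' countable_finite) auto
  then have "AE p in M. p \<notin> N" by (rule AE_not_in)
  then have "AE p in M. d p \<le> \<delta>"
  proof eventually_elim
    case (elim pq)
    obtain x y where pq: "pq = (x, y)" by fastforce
    show ?case
    proof (rule ccontr)
      assume "\<not> d pq \<le> \<delta>"
      then have far: "dist x y > \<delta>" by (simp add: pq d_def)
      have "x \<in> (\<Union>x\<in>C. ball x (\<delta> / 4))" "y \<in> (\<Union>x\<in>C. ball x (\<delta> / 4))" using C(2) by blast+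
      then obtain p q where p: "p \<in> C" "x \<in> ball p (\<delta> / 4)" and q: "q \<in> C" "y \<in> ball q (\<delta> / 4)"
        by blast
      have "ball p (\<delta> / 4) \<inter> ball q (\<delta> / 4) = {}"
      proof (rule equals0I)
        fix w assume "w \<in> ball p (\<delta> / 4) \<inter> ball q (\<delta> / 4)"
        then have "dist p w < \<delta> / 4" "dist q w < \<delta> / 4" by auto
        moreover have "dist p x < \<delta> / 4" "dist q y < \<delta> / 4" using p q by auto
        moreover have "dist x y \<le> dist p x + dist p w + dist q w + dist q y"
          using dist_triangle[of x y p] dist_triangle[of p y q] dist_triangle[of p q w]
          by (simp add: dist_commute)
        ultimately show False using far by linarith
      qed
      then have "(p, q) \<in> R" using p q by (simp add: R_def)
      then have "pq \<in> N" using p q unfolding N_def pq by blast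
      then show False using elim by blast
    qed
  qed
  then have "integral\<^sup>L M d \<le> (\<integral>p. \<delta> \<partial>M)" by (intro integral_mono_AE int) auto
  then show ?thesis by (simp add: prob_space)
qed

text \<open>
  Otherwise \<open>limit_of_averages\<close> provides an invariant state that is positive on the distance
  function. The ergodic measure of an extreme state maximising it is a trivial self-joining; the
  open sets \<open>U\<close> and \<open>V\<close> rule out the product, and \<open>trivial\<close> leaves only the diagonal, on which the
  distance vanishes.
\<close>

theorem weakly_asymptotic_if_close:
  fixes U V :: "'x set"
  assumes F: "folner_sequence F" and "x \<noteq> y" and close: "\<And>g. dist (T g x) (T g y) \<le> \<epsilon>"
    and \<mu>: "sets \<mu> = sets borel" "invariant_prob T \<mu>" and min: "minimal_action T"
    and ue: "uniquely_ergodic T" and msj: "minimal_self_joinings_of_all_orders T \<mu>"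
    and UV: "open U" "open V" "U \<noteq> {}" "V \<noteq> {}" "\<And>u v. u \<in> U \<Longrightarrow> v \<in> V \<Longrightarrow> dist u v > \<epsilon>"
    and trivial: "\<And>h z. (\<And>z. dist z (T h z) \<le> \<epsilon>) \<Longrightarrow> T h z = z"
  shows "weakly_asymptotic_pair F T x y"
proof (rule ccontr)
  assume "\<not> ?thesis"
  then have "\<not> (\<lambda>n. average (F n) (x, y) d) \<longlonglongrightarrow> 0"
    using weakly_asymptotic_if_average_tends_to_0[OF F \<open>x \<noteq> y\<close>] by blast
  moreover have "0 \<le> average (F n) (x, y) d" for n
    by (auto simp: average_def d_def intro!: divide_nonneg_nonneg sum_nonneg)
  ultimately obtain c where c: "0 < c" "\<exists>\<^sub>F n in sequentially. average (F n) (x, y) d \<ge> c"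
    using not_tendsto_0_imp_frequently[of "\<lambda>n. average (F n) (x, y) d"] by blast
  obtain \<Lambda>0 where \<Lambda>0: "\<Lambda>0 \<in> invariant_states \<epsilon>" "\<Lambda>0 d \<ge> c"
    using limit_of_averages[OF F _ c(2), of \<epsilon>] close by (auto simp: T2_def d_def)
  then have "invariant_states \<epsilon> \<noteq> {}" by blast
  from compact_invariant_states this obtain \<Lambda> where \<Lambda>: "\<Lambda> \<in> invariant_states \<epsilon>"
    and max: "\<And>\<Phi>. \<Phi> \<in> invariant_states \<epsilon> \<Longrightarrow> \<Phi> d \<le> \<Lambda> d"
    and extreme: "\<And>\<Phi> \<Psi> t. \<Phi> \<in> invariant_states \<epsilon> \<Longrightarrow> \<Psi> \<in> invariant_states \<epsilon> \<Longrightarrow> 0 < t \<Longrightarrow> t < 1 \<Longrightarrow>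
      (\<And>f. \<Lambda> f = t * \<Phi> f + (1 - t) * \<Psi> f) \<Longrightarrow> \<Phi> = \<Lambda> \<and> \<Psi> = \<Lambda>"
    by (rule extreme_maximizer[where i = d]) blast
  have \<Lambda>d: "\<Lambda> d \<ge> c" using max[OF \<Lambda>0(1)] \<Lambda>0(2) by linarith
  interpret S: state \<Lambda> by (rule invariant_statesD(1)[OF \<Lambda>])
  interpret P: prob_space S.M by (rule S.prob_space_M)
  have erg: "ergodic T2 S.M" by (rule ergodic_if_extreme[OF \<Lambda> extreme])
  define \<nu> where "\<nu> = distr S.M (borel_power {..<2}) to_fun"
  have "self_joining T \<mu> 2 \<nu>" "ergodic (diagonal_action T {..<2}) \<nu>"
    unfolding \<nu>_def using self_joining_distr_to_fun[OF S.sets_M erg \<mu> ue] ergodic_distr_to_fun[OF S.sets_M erg]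
    by simp_all
  then have triv: "trivial_joining T \<mu> 2 \<nu>"
    using msj unfolding minimal_self_joinings_of_all_orders_def by blast
  have rect: "emeasure \<nu> (rect B C) = emeasure S.M (B \<times> C)" if "open B" "open C" for B C
    unfolding \<nu>_def using that by (intro emeasure_distr_to_fun) auto
  have cm: "cont (\<lambda>p. max 0 (d p - \<epsilon>))" using cont_d by (intro continuous_intros)
  have "integral\<^sup>L S.M (\<lambda>p. max 0 (d p - \<epsilon>)) = 0"
    using S.integral_M[OF cm] invariant_statesD(4)[OF \<Lambda>] by simp
  then have AE: "AE p in S.M. max 0 (d p - \<epsilon>) = 0"
    using integral_nonneg_eq_0_iff_AE[OF S.integrable_M[OF cm]] by simp
  have far_null: "emeasure S.M (B \<times> C) = 0"
    if BC: "open B" "open C" "\<And>u v. u \<in> B \<Longrightarrow> v \<in> C \<Longrightarrow> dist u v > \<epsilon>" for B C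
  proof -
    have "AE p in S.M. p \<notin> B \<times> C" using AE
    proof eventually_elim
      case (elim p)
      then have "d p \<le> \<epsilon>" by simp
      then show ?case using BC(3) by (cases p) (fastforce simp: d_def)
    qed
    then show ?thesis using BC(1,2) by (subst (asm) AE_iff_measurable[OF _ refl]) (auto simp: open_Times)
  qed
  have prob: "prob_space \<mu>" using \<mu>(2) by (simp add: invariant_prob_def)
  from \<mu>(1) prob triv show False
  proof (cases rule: trivial_joining_2_cases)
    case (2 g h)
    have pos: "emeasure \<mu> {x. T g x \<in> W} > 0" if W: "open W" "W \<noteq> {}" for g W
    proof -
      obtain w where "w \<in> W" using W by blast
      then have "T (- g) w \<in> {x. T g x \<in> W}" by simp
      moreover have "open {x. T g x \<in> W}" using open_vimage[OF W(1) continuous_T] by (simp add: vimage_def)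
      ultimately show ?thesis using emeasure_open_pos[OF \<mu> min, of "{x. T g x \<in> W}"] by blast
    qed
    have "emeasure \<mu> {x. T g x \<in> U} * emeasure \<mu> {x. T h x \<in> V} = 0"
      using 2[of U V] rect[OF UV(1,2)] far_null[OF UV(1,2,5)] UV(1,2) by simp
    then show False using pos[OF UV(1,3), of g] pos[OF UV(2,4), of h] by (auto simp del: zero_less_iff_neq_zero)
  next
    case (1 g h)
    have near: "dist (T g z) (T h z) \<le> \<epsilon>" for z
    proof (rule ccontr)
      assume "\<not> ?thesis"
      then have far: "dist (T g z) (T h z) > \<epsilon>" by simp
      define r where "r = (dist (T g z) (T h z) - \<epsilon>) / 2"
      have r: "r > 0" using far by (simp add: r_def)
      have "dist u v > \<epsilon>" if "u \<in> ball (T g z) r" "v \<in> ball (T h z) r" for u v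
      proof -
        have "dist (T g z) (T h z) \<le> dist (T g z) u + dist u v + dist (T h z) v"
          using dist_triangle[of "T g z" "T h z" u] dist_triangle[of u "T h z" v] by (simp add: dist_commute)
        then show ?thesis using that by (simp add: r_def field_simps)
      qed
      from far_null[OF open_ball open_ball this]
      have "emeasure \<mu> {x. T g x \<in> ball (T g z) r \<and> T h x \<in> ball (T h z) r} = 0"
        using 1[of "ball (T g z) r" "ball (T h z) r"] rect[of "ball (T g z) r" "ball (T h z) r"] by simp
      moreover have "{x. T g x \<in> ball (T g z) r \<and> T h x \<in> ball (T h z) r} =
          T g -` ball (T g z) r \<inter> T h -` ball (T h z) r" by auto
      moreover have "open (T g -` ball (T g z) r \<inter> T h -` ball (T h z) r)"
        by (intro open_Int open_vimage open_ball continuous_T)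
      moreover have "z \<in> T g -` ball (T g z) r \<inter> T h -` ball (T h z) r" using r by simp
      ultimately show False using emeasure_open_pos[OF \<mu> min] by (metis empty_iff less_irrefl)
    qed
    have "T (h - g) z = z" for z
    proof (rule trivial)
      fix w
      have "T (h - g) w = T h (T (- g) w)" by (simp flip: T_add)
      then show "dist w (T (h - g) w) \<le> \<epsilon>" using near[of "T (- g) w"] by simp
    qed
    then have same: "T h x = T g x" for x
      using T_add[of "h - g" g x] by simp
    have "integral\<^sup>L S.M d \<le> c / 2"
    proof (rule integral_d_le_if_disjoint_rects_null[OF S.sets_M S.prob_space_M])
      show "0 < c / 2" using c by simp
      show "integrable S.M d" by (rule S.integrable_M[OF cont_d])
      fix B C :: "'x set" assume BC: "open B" "open C" "B \<inter> C = {}"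
      then have empty: "{x. T g x \<in> B \<and> T h x \<in> C} = {}" by (auto simp: same)
      have "emeasure S.M (B \<times> C) = emeasure \<mu> {x. T g x \<in> B \<and> T h x \<in> C}"
        using 1[of B C] rect[OF BC(1,2)] BC(1,2) by simp
      then show "emeasure S.M (B \<times> C) = 0" unfolding empty by simp
    qed
    then show False using S.integral_M[OF cont_d] \<Lambda>d c(1) by linarith
  qed
qed

end

section \<open>Nonexistence\<close>

theorem theorem6:
  fixes F :: "nat \<Rightarrow> 'g::ab_group_add set"
  assumes "finitely_generated TYPE('g)"
    and "tempered_folner_sequence F"
  shows "\<not> (\<exists>(T :: 'g \<Rightarrow> 'x::metric_space \<Rightarrow> 'x) (\<mu> :: 'x measure).
    compact (UNIV :: 'x set) \<and> infinite (UNIV :: 'x set) \<and>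
    continuous_action T \<and>
    sets \<mu> = sets borel \<and> invariant_prob T \<mu> \<and>
    minimal_action T \<and>
    uniquely_ergodic T \<and>
    mixing_of_all_orders T \<mu> \<and>
    minimal_self_joinings_of_all_orders T \<mu> \<and>
    (\<nexists>x y. weakly_asymptotic_pair F T x y))"
proof (rule notI, elim exE conjE)
  fix T :: "'g \<Rightarrow> 'x \<Rightarrow> 'x" and \<mu> :: "'x measure"
  assume X: "compact (UNIV :: 'x set)" "infinite (UNIV :: 'x set)" and action: "continuous_action T"
    and \<mu>: "sets \<mu> = sets borel" "invariant_prob T \<mu>" and min: "minimal_action T"
    and ue: "uniquely_ergodic T" and mix: "mixing_of_all_orders T \<mu>"
    and msj: "minimal_self_joinings_of_all_orders T \<mu>"
    and none: "\<nexists>x y. weakly_asymptotic_pair F T x y"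
  have F: "folner_sequence F" using assms(2) by (simp add: tempered_folner_sequence_def)
  obtain S :: "'g set" where S: "finite S" "group_closure S = UNIV"
    using assms(1) by (auto simp: finitely_generated_def)
  interpret compact_action T by unfold_locales (rule X(1), rule action)
  show False
  proof (rule displacement_threshold[OF X(2) \<mu> min mix])
    fix \<epsilon> :: real and U V :: "'x set"
    assume \<epsilon>: "0 < \<epsilon>" and UV: "open U" "open V" "U \<noteq> {}" "V \<noteq> {}"
      "\<And>u v. u \<in> U \<Longrightarrow> v \<in> V \<Longrightarrow> dist u v > \<epsilon>"
      and trivial: "\<And>h z. (\<And>z. dist z (T h z) \<le> \<epsilon>) \<Longrightarrow> T h z = z"
    show False
    proof (cases "\<exists>x y. x \<noteq> y \<and> (\<forall>g. dist (T g x) (T g y) \<le> \<epsilon>)")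
      case True
      then obtain x y where xy: "x \<noteq> y" "\<And>g. dist (T g x) (T g y) \<le> \<epsilon>" by blast
      have "weakly_asymptotic_pair F T x y"
        by (rule weakly_asymptotic_if_close[OF F xy \<mu> min ue msj UV trivial])
      then show False using none by blast
    next
      case False
      then have exp: "\<exists>g. dist (T g x) (T g y) > \<epsilon>" if "x \<noteq> y" for x y
        using that by (meson not_less)
      interpret expansive_action T \<epsilon> S
        by unfold_locales (rule \<epsilon>, rule X(2), erule exp, rule S(1), rule S(2))
      show False using weakly_asymptotic_pair_if_expansive[OF F] none by blast
    qed
  qed
qed

end
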